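(* For every RB-template $P$, the language of the B-automaton $\mathcal{B}$ constructed from $P$ (as described in the context) is exactly $\mathrm{exec}_{inf}(P^\infty)$.
   Context: Fix $k\ge1$, finite $\Sigma_{actn}$, $\Sigma_{rdz}=\{a_1,\dots,a_k:a\in\Sigma_{actn}\}$, broadcast symbol $\mathfrak{b}$. An RB-template is a finite LTS $P=(AP,\Sigma_{rdz}\cup\{\mathfrak{b}\},S,I,R,\lambda)$ with an outgoing $\mathfrak{b}$-edge from every state. For any such template $Q$ the RB-system $Q^n$ has configurations $f:[n]\to$ states (initial if all states initial), broadcast transitions where every process moves along a $\mathfrak{b}$-edge, and rendezvous transitions where for some $a\in\Sigma_{actn}$ pairwise distinct processes $i_1,\dots,i_k$ move along edges labeled $a_1,\dots,a_k$ and the others stay; an edge $e$ of $Q$ appears in a transition if some moving process takes it. Runs are finite or infinite paths from initial configurations. $\mathrm{exec}_{inf}(P^\infty)$ is the set of infinite words $\lambda(\mathrm{src}(e_1))\lambda(\mathrm{src}(e_2))\cdots$ where $e_1e_2\cdots$ is the (infinite) sequence of edges taken by process 1 along a run of some $P^n$. Reachability-unwinding $P^{\multimap}$: $I_0=I$; $S_i,R_i$ least sets with $I_i\subseteq S_i$, $R_i$ consisting of rendezvous edges of $R$, closed under: if $(s,a_h,t)\in R$, $s\in S_i$, and for each $l\in[k]\setminus\{h\}$ some edge $(s',a_l,t')\in R$ has $s'\in S_i$, then $(s,a_h,t)\in R_i$, $t\in S_i$; $I_{i+1}=\{s:(h,\mathfrak{b},s)\in R,h\in S_i\}$; $m$ least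 with $I_{m+1}=I_n$ for some $n\le m$. States $(s,i)$, $0\le i\le m$, $s\in S_i$; initial $(s,0)$, $s\in I$; labels $\lambda^{\multimap}(s,i)=\lambda(s)$; rendezvous edges $((s,i),\sigma,(t,i))$ for $(s,\sigma,t)\in R_i$; broadcast edges $((s,i),\mathfrak{b},(t,i+1))$ for $i<m$ and $((s,m),\mathfrak{b},(t,n))$, whenever $s\in S_i$ (resp. $S_m$) and $(s,\mathfrak{b},t)\in R$. Edge types of an edge $e$ of $P^{\multimap}$: locally-reusable if $e$ appears in infinitely many transitions of some infinite run of $(P^{\multimap})^n$ (some $n$) with finitely many broadcast transitions; green if it appears in infinitely many transitions of some run with infinitely many broadcasts; light green if there is a run with infinitely many broadcasts such that for every $N$ some broadcast-free segment of it contains at least $N$ transitions in which $e$ appears; dark green if green but not light green. B-automata: tuples $\langle\Sigma,S',I',R',G,cc\rangle$ with counter commands $cc:R'\to\{\mathsf{inc},\mathsf{reset},\mathsf{skip}\}$; a run on an infinite word accepts if it visits $G$ infinitely often and the counter (starting at 0, incremented/reset/unchanged per command) is bounded. The automaton $\mathcal{B}$: $\Sigma=2^{AP}$, states $\{init,grn,loc\}\times S^{\multimap}$, $G$ all states, initial states $\{init\}\times I^{\multimap}$. For each edge $e=(s,\sigma,t)$ of $P^{\multimap}$: transitions $((init,s),\lambda^{\multimap}(s),(x,t))$ for $x\in\{init,grn,loc\}$ with command $\mathsf{inc}$; if $e$ is green, a transition $((grn,s),\lambda^{\multimap}(s),(grn,t))$ with command $\mathsf{inc}$ if $e$ is a dark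 green rendezvous edge, $\mathsf{reset}$ if $e$ is a broadcast edge, $\mathsf{skip}$ otherwise; if $e$ is locally-reusable, a transition $((loc,s),\lambda^{\multimap}(s),(loc,t))$ with command $\mathsf{skip}$. *)

theory Defs
  imports Main "HOL-Library.FuncSet"
begin

section \<open>Labelled transition systems and RB-templates\<close>

text \<open>\<open>Rdz a j\<close> stands for the symbol \<open>a\<^sub>j\<close>, with \<open>j\<close> ranging over \<open>{1..k}\<close>.\<close>

datatype 'a symbol = Rdz 'a nat | Bcast

type_synonym ('s, 'a) edge = "'s \<times> 'a symbol \<times> 's"

record ('s, 'a, 'p) lts =
  props :: "'p set"
  alphabet :: "'a symbol set"
  states :: "'s set"
  inits :: "'s set"
  edges :: "('s, 'a) edge set"
  label :: "'s \<Rightarrow> 'p set"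

definition rdz_symbols :: "nat \<Rightarrow> 'a set \<Rightarrow> 'a symbol set" where
  "rdz_symbols k A = {Rdz a j | a j. a \<in> A \<and> j \<in> {1..k}}"

definition finite_lts :: "('s, 'a, 'p) lts \<Rightarrow> bool" where
  "finite_lts P \<longleftrightarrow>
     finite (props P) \<and> finite (alphabet P) \<and> finite (states P) \<and>
     inits P \<subseteq> states P \<and>
     edges P \<subseteq> states P \<times> alphabet P \<times> states P \<and>
     (\<forall>s\<in>states P. label P s \<subseteq> props P)"

definition rb_template :: "nat \<Rightarrow> 'a set \<Rightarrow> ('s, 'a, 'p) lts \<Rightarrow> bool" where
  "rb_template k A P \<longleftrightarrow>
     finite_lts P \<and> alphabet P = rdz_symbols k A \<union> {Bcast} \<and>
     (\<forall>s\<in>states P. \<exists>t. (s, Bcast, t) \<in> edges P)"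

section \<open>RB-systems\<close>

text \<open>
  A transition of the system with processes \<open>{1..n}\<close> is a triple of source configuration,
  action and target configuration.  In \<open>GRdz a is\<close> the list \<open>is = [i\<^sub>1, \<dots>, i\<^sub>k]\<close> holds
  the participating processes; list positions start at 0, so the process \<open>is ! j\<close>
  uses the symbol \<open>Rdz a (Suc j)\<close>.
\<close>

datatype 'a gaction = GBcast | GRdz 'a "nat list"

type_synonym 's config = "nat \<Rightarrow> 's"
type_synonym ('s, 'a) gtrans = "'s config \<times> 'a gaction \<times> 's config"

definition configs :: "('s, 'a, 'p) lts \<Rightarrow> nat \<Rightarrow> 's config set" where
  "configs Q n = {1..n} \<rightarrow>\<^sub>E states Q"

definition init_configs :: "('s, 'a, 'p) lts \<Rightarrow> nat \<Rightarrow> 's config set" where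
  "init_configs Q n = {1..n} \<rightarrow>\<^sub>E inits Q"

inductive_set sys_trans ::
    "nat \<Rightarrow> 'a set \<Rightarrow> ('s, 'a, 'p) lts \<Rightarrow> nat \<Rightarrow> ('s, 'a) gtrans set"
  for k A Q n where
  broadcast:
    "\<lbrakk> f \<in> configs Q n; g \<in> configs Q n;
       \<forall>i\<in>{1..n}. (f i, Bcast, g i) \<in> edges Q \<rbrakk>
     \<Longrightarrow> (f, GBcast, g) \<in> sys_trans k A Q n"
| rendezvous:
    "\<lbrakk> f \<in> configs Q n; g \<in> configs Q n; a \<in> A;
       length is = k; distinct is; set is \<subseteq> {1..n};
       \<forall>j<k. (f (is ! j), Rdz a (Suc j), g (is ! j)) \<in> edges Q;
       \<forall>i\<in>{1..n} - set is. g i = f i \<rbrakk>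
     \<Longrightarrow> (f, GRdz a is, g) \<in> sys_trans k A Q n"

fun is_broadcast :: "('s, 'a) gtrans \<Rightarrow> bool" where
  "is_broadcast (f, GBcast, g) = True"
| "is_broadcast (f, GRdz a is, g) = False"

fun takes :: "nat \<Rightarrow> ('s, 'a) gtrans \<Rightarrow> nat \<Rightarrow> ('s, 'a) edge \<Rightarrow> bool" where
  "takes n (f, GBcast, g) i e \<longleftrightarrow> i \<in> {1..n} \<and> e = (f i, Bcast, g i)"
| "takes n (f, GRdz a is, g) i e \<longleftrightarrow>
     (\<exists>j<length is. is ! j = i \<and> e = (f i, Rdz a (Suc j), g i))"

definition appears :: "nat \<Rightarrow> ('s, 'a) edge \<Rightarrow> ('s, 'a) gtrans \<Rightarrow> bool" where
  "appears n e \<tau> \<longleftrightarrow> (\<exists>i\<in>{1..n}. takes n \<tau> i e)"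

text \<open>
  Only infinite runs matter below: an infinite sequence of edges of process 1, infinitely many
  occurrences of an edge, and infinitely many broadcasts all force the run to be infinite.
\<close>

definition inf_run ::
    "nat \<Rightarrow> 'a set \<Rightarrow> ('s, 'a, 'p) lts \<Rightarrow> nat \<Rightarrow> (nat \<Rightarrow> ('s, 'a) gtrans) \<Rightarrow> bool" where
  "inf_run k A Q n \<rho> \<longleftrightarrow>
     fst (\<rho> 0) \<in> init_configs Q n \<and>
     (\<forall>i. \<rho> i \<in> sys_trans k A Q n) \<and>
     (\<forall>i. fst (\<rho> (Suc i)) = snd (snd (\<rho> i)))"

text \<open>\<open>h\<close> enumerates, in order, the positions of the run at which process \<open>i\<close> moves.\<close>

definition edge_sequence ::
    "nat \<Rightarrow> (nat \<Rightarrow> ('s, 'a) gtrans) \<Rightarrow> nat \<Rightarrow> (nat \<Rightarrow> ('s, 'a) edge) \<Rightarrow> bool" where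
  "edge_sequence n \<rho> i es \<longleftrightarrow>
     (\<exists>h::nat \<Rightarrow> nat. strict_mono h \<and> range h = {j. \<exists>e. takes n (\<rho> j) i e} \<and>
        (\<forall>m. takes n (\<rho> (h m)) i (es m)))"

definition exec_inf ::
    "nat \<Rightarrow> 'a set \<Rightarrow> ('s, 'a, 'p) lts \<Rightarrow> (nat \<Rightarrow> 'p set) set" where
  "exec_inf k A P =
     {w. \<exists>n\<ge>1. \<exists>\<rho> es. inf_run k A P n \<rho> \<and> edge_sequence n \<rho> 1 es \<and>
           w = (\<lambda>m. label P (fst (es m)))}"

section \<open>Reachability-unwinding\<close>

inductive_set
  sat_states :: "nat \<Rightarrow> ('s, 'a, 'p) lts \<Rightarrow> 's set \<Rightarrow> 's set" and
  sat_edges :: "nat \<Rightarrow> ('s, 'a, 'p) lts \<Rightarrow> 's set \<Rightarrow> ('s, 'a) edge set"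
  for k P X where
  init: "s \<in> X \<Longrightarrow> s \<in> sat_states k P X"
| state:
    "\<lbrakk> (s, Rdz a h, t) \<in> edges P; h \<in> {1..k}; s \<in> sat_states k P X;
       \<forall>l\<in>{1..k} - {h}. \<exists>s' t'. (s', Rdz a l, t') \<in> edges P \<and> s' \<in> sat_states k P X \<rbrakk>
     \<Longrightarrow> t \<in> sat_states k P X"
| edge:
    "\<lbrakk> (s, Rdz a h, t) \<in> edges P; h \<in> {1..k}; s \<in> sat_states k P X;
       \<forall>l\<in>{1..k} - {h}. \<exists>s' t'. (s', Rdz a l, t') \<in> edges P \<and> s' \<in> sat_states k P X \<rbrakk>
     \<Longrightarrow> (s, Rdz a h, t) \<in> sat_edges k P X"

primrec unw_inits :: "nat \<Rightarrow> ('s, 'a, 'p) lts \<Rightarrow> nat \<Rightarrow> 's set" where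
  "unw_inits k P 0 = inits P"
| "unw_inits k P (Suc i) =
     {s. \<exists>h \<in> sat_states k P (unw_inits k P i). (h, Bcast, s) \<in> edges P}"

abbreviation unw_states :: "nat \<Rightarrow> ('s, 'a, 'p) lts \<Rightarrow> nat \<Rightarrow> 's set" where
  "unw_states k P i \<equiv> sat_states k P (unw_inits k P i)"

abbreviation unw_edges :: "nat \<Rightarrow> ('s, 'a, 'p) lts \<Rightarrow> nat \<Rightarrow> ('s, 'a) edge set" where
  "unw_edges k P i \<equiv> sat_edges k P (unw_inits k P i)"

definition unw_last :: "nat \<Rightarrow> ('s, 'a, 'p) lts \<Rightarrow> nat" where
  "unw_last k P = (LEAST m. \<exists>n\<le>m. unw_inits k P (Suc m) = unw_inits k P n)"

text \<open>
  By minimality of \<open>unw_last\<close> the sets \<open>unw_inits k P 0, \<dots>, unw_inits k P (unw_last k P)\<close>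
  are pairwise distinct, so exactly one index \<open>n\<close> qualifies here.
\<close>

definition unw_back :: "nat \<Rightarrow> ('s, 'a, 'p) lts \<Rightarrow> nat" where
  "unw_back k P =
     (LEAST n. n \<le> unw_last k P \<and> unw_inits k P (Suc (unw_last k P)) = unw_inits k P n)"

definition unwinding :: "nat \<Rightarrow> ('s, 'a, 'p) lts \<Rightarrow> ('s \<times> nat, 'a, 'p) lts" where
  "unwinding k P = (let m = unw_last k P; n = unw_back k P in
    \<lparr> props = props P,
      alphabet = alphabet P,
      states = {(s, i) | s i. i \<le> m \<and> s \<in> unw_states k P i},
      inits = {(s, 0) | s. s \<in> inits P},
      edges =
        {((s, i), \<sigma>, (t, i)) | s \<sigma> t i. i \<le> m \<and> (s, \<sigma>, t) \<in> unw_edges k P i} \<union>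
        {((s, i), Bcast, (t, Suc i)) | s t i.
            i < m \<and> s \<in> unw_states k P i \<and> (s, Bcast, t) \<in> edges P} \<union>
        {((s, m), Bcast, (t, n)) | s t.
            s \<in> unw_states k P m \<and> (s, Bcast, t) \<in> edges P},
      label = (\<lambda>(s, i). label P s) \<rparr>)"

section \<open>Edge types\<close>

text \<open>
  Occurrences are counted by positions in the run: the same transition taken twice counts twice.
  These notions are used with \<open>Q\<close> the reachability-unwinding of a template.
\<close>

definition locally_reusable ::
    "nat \<Rightarrow> 'a set \<Rightarrow> ('s, 'a, 'p) lts \<Rightarrow> ('s, 'a) edge \<Rightarrow> bool" where
  "locally_reusable k A Q e \<longleftrightarrow>
     (\<exists>n\<ge>1. \<exists>\<rho>. inf_run k A Q n \<rho> \<and>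
        finite {j. is_broadcast (\<rho> j)} \<and> infinite {j. appears n e (\<rho> j)})"

definition green ::
    "nat \<Rightarrow> 'a set \<Rightarrow> ('s, 'a, 'p) lts \<Rightarrow> ('s, 'a) edge \<Rightarrow> bool" where
  "green k A Q e \<longleftrightarrow>
     (\<exists>n\<ge>1. \<exists>\<rho>. inf_run k A Q n \<rho> \<and>
        infinite {j. is_broadcast (\<rho> j)} \<and> infinite {j. appears n e (\<rho> j)})"

definition light_green ::
    "nat \<Rightarrow> 'a set \<Rightarrow> ('s, 'a, 'p) lts \<Rightarrow> ('s, 'a) edge \<Rightarrow> bool" where
  "light_green k A Q e \<longleftrightarrow>
     (\<exists>n\<ge>1. \<exists>\<rho>. inf_run k A Q n \<rho> \<and> infinite {j. is_broadcast (\<rho> j)} \<and>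
        (\<forall>N. \<exists>b c. (\<forall>j\<in>{b..<c}. \<not> is_broadcast (\<rho> j)) \<and>
              N \<le> card {j \<in> {b..<c}. appears n e (\<rho> j)}))"

definition dark_green ::
    "nat \<Rightarrow> 'a set \<Rightarrow> ('s, 'a, 'p) lts \<Rightarrow> ('s, 'a) edge \<Rightarrow> bool" where
  "dark_green k A Q e \<longleftrightarrow> green k A Q e \<and> \<not> light_green k A Q e"

section \<open>B-automata\<close>

datatype command = Inc | Reset | Skip

text \<open>
  Transitions \<open>(q, x, c, q')\<close> carry, besides source, letter and target, a tag \<open>c\<close>, so that
  parallel transitions with equal source, letter and target may have different counter commands.
\<close>

type_synonym ('q, 'x, 'c) btrans = "'q \<times> 'x \<times> 'c \<times> 'q"

record ('q, 'x, 'c) bautomaton =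
  ba_alphabet :: "'x set"
  ba_states :: "'q set"
  ba_inits :: "'q set"
  ba_trans :: "('q, 'x, 'c) btrans set"
  ba_good :: "'q set"
  ba_cc :: "('q, 'x, 'c) btrans \<Rightarrow> command"

fun apply_command :: "command \<Rightarrow> nat \<Rightarrow> nat" where
  "apply_command Inc v = Suc v"
| "apply_command Reset v = 0"
| "apply_command Skip v = v"

primrec counter :: "(nat \<Rightarrow> command) \<Rightarrow> nat \<Rightarrow> nat" where
  "counter cs 0 = 0"
| "counter cs (Suc i) = apply_command (cs i) (counter cs i)"

definition ba_run ::
    "('q, 'x, 'c) bautomaton \<Rightarrow> (nat \<Rightarrow> 'x) \<Rightarrow> (nat \<Rightarrow> 'q) \<Rightarrow> (nat \<Rightarrow> 'c) \<Rightarrow> bool" where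
  "ba_run B w q c \<longleftrightarrow>
     q 0 \<in> ba_inits B \<and> (\<forall>i. (q i, w i, c i, q (Suc i)) \<in> ba_trans B)"

definition ba_accepting ::
    "('q, 'x, 'c) bautomaton \<Rightarrow> (nat \<Rightarrow> 'x) \<Rightarrow> (nat \<Rightarrow> 'q) \<Rightarrow> (nat \<Rightarrow> 'c) \<Rightarrow> bool" where
  "ba_accepting B w q c \<longleftrightarrow>
     infinite {i. q i \<in> ba_good B} \<and>
     (\<exists>b. \<forall>i. counter (\<lambda>j. ba_cc B (q j, w j, c j, q (Suc j))) i \<le> b)"

definition ba_language :: "('q, 'x, 'c) bautomaton \<Rightarrow> (nat \<Rightarrow> 'x) set" where
  "ba_language B =
     {w. (\<forall>i. w i \<in> ba_alphabet B) \<and> (\<exists>q c. ba_run B w q c \<and> ba_accepting B w q c)}"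

section \<open>The automaton of a template\<close>

datatype mode = Init | Grn | Loc

text \<open>
  Each transition is tagged with the edge of the unwinding it comes from.  Two edges
  \<open>(s, \<sigma>, t)\<close> and \<open>(s, \<sigma>', t)\<close> can have different types, in which case they give parallel
  transitions with different commands.
\<close>

definition template_automaton ::
    "nat \<Rightarrow> 'a set \<Rightarrow> ('s, 'a, 'p) lts \<Rightarrow>
     (mode \<times> 's \<times> nat, 'p set, ('s \<times> nat, 'a) edge) bautomaton" where
  "template_automaton k A P = (let U = unwinding k P in
    \<lparr> ba_alphabet = Pow (props P),
      ba_states = {Init, Grn, Loc} \<times> states U,
      ba_inits = {Init} \<times> inits U,
      ba_trans =
        {((Init, s), label U s, (s, \<sigma>, t), (x, t)) | s \<sigma> t x.
            (s, \<sigma>, t) \<in> edges U \<and> x \<in> {Init, Grn, Loc}} \<union>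
        {((Grn, s), label U s, (s, \<sigma>, t), (Grn, t)) | s \<sigma> t.
            (s, \<sigma>, t) \<in> edges U \<and> green k A U (s, \<sigma>, t)} \<union>
        {((Loc, s), label U s, (s, \<sigma>, t), (Loc, t)) | s \<sigma> t.
            (s, \<sigma>, t) \<in> edges U \<and> locally_reusable k A U (s, \<sigma>, t)},
      ba_good = {Init, Grn, Loc} \<times> states U,
      ba_cc = (\<lambda>((x, _), _, (s, \<sigma>, t), _).
        case x of
          Init \<Rightarrow> Inc
        | Grn \<Rightarrow>
            (if \<sigma> \<noteq> Bcast \<and> dark_green k A U (s, \<sigma>, t) then Inc
             else if \<sigma> = Bcast then Reset
             else Skip)
        | Loc \<Rightarrow> Skip) \<rparr>)"

end

theory Submission
  imports Defs "HOL-Library.Infinite_Set" "HOL-Combinatorics.Transposition"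
begin

text \<open>
  From executions to words: a run of the system lifts to the unwinding, and from some point on
  every edge taken by process 1 occurs infinitely often in the run. These edges are locally
  reusable if there are finitely many broadcasts and green otherwise; in the latter case the
  dark green ones occur boundedly often between consecutive broadcasts.

  From words to executions: let process 1 follow the given path while groups of helper processes
  run through cycles of configurations, one cycle for each edge that remains on the path after a finite
  prefix. By symmetry, two processes in the same state may exchange their roles at any time. When
  process 1 needs the edge \<open>e\<close>, it waits for a group whose next step involves a process in the
  source of \<open>e\<close> taking \<open>e\<close>, exchanges roles with that process, and makes the step; it is free to
  leave the group again by another exchange before the next edge. A group for a locally reusable or
  light green edge returns to its configuration without a broadcast and can be used again; a group
  for a dark green edge is used up until the next broadcast, so the bound on the counter bounds the
  number of copies. The initial configuration of the groups is reachable because every state of a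
  component of the unwinding is reached by some run with the right number of broadcasts, and runs
  with equally many broadcasts can be executed side by side.
\<close>

text \<open>An index of a configuration is a role, not a process. An exchange then changes only
  which index is tracked, a group stays complete when the tracked process leaves it, and disjoint
  groups do not disturb each other. Processes are numbered only when a genuine run is built.

  The obstacle is the broadcast, which moves all groups at once. The number of broadcasts made so
  far determines the component of every process, so groups can be added after any prefix. Each cycle
  for a green edge contains a broadcast, so cycle lengths can be counted in broadcasts, and a common
  multiple of them is a period of all groups. Copies of each cycle, shifted against each other,
  ensure that the edge needed next is available after any number of broadcasts. For a dark green
  edge the return is guaranteed only by way of a broadcast; of its copies, at most as many as the
  counter bound are used up between broadcasts and one more may contain the tracked role, so two
  more than the bound suffice.\<close>

text \<open>Next state and remaining number of silent steps before the next visible one are chosen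
  greedily.\<close>

lemma weave_runs:
  fixes W :: "nat \<Rightarrow> 'c \<Rightarrow> bool" and es :: "nat \<Rightarrow> 'e"
  assumes init: "W 0 c0"
    and step: "\<And>m c. W m c \<Longrightarrow> \<exists>c1 c2. R\<^sup>*\<^sup>* c c1 \<and> V c1 (es m) c2 \<and> W (Suc m) c2"
  obtains C l h where "C 0 = c0" "\<And>t. l t = None \<Longrightarrow> R (C t) (C (Suc t))"
    "\<And>t e. l t = Some e \<Longrightarrow> V (C t) e (C (Suc t))"
    "strict_mono (h :: nat \<Rightarrow> nat)" "range h = {t. l t \<noteq> None}" "\<And>m. l (h m) = Some (es m)"
proof -
  \<comment> \<open>The number \<open>r\<close> of silent steps still to come decreases, so no
    visible step is postponed forever.\<close>
  define rem where "rem m r c \<longleftrightarrow> (\<exists>c1 c2. (R ^^ r) c c1 \<and> V c1 (es m) c2 \<and> W (Suc m) c2)" for m r c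
  define good where "good x \<longleftrightarrow> rem (fst x) (fst (snd x)) (snd (snd x))" for x
  define nxt where "nxt x y \<longleftrightarrow> (case x of (m, r, c) \<Rightarrow> (case y of (m', r', c') \<Rightarrow>
     (if r = 0 then m' = Suc m \<and> V c (es m) c' else m' = m \<and> r' = r - 1 \<and> R c c')))" for x y :: "nat \<times> nat \<times> 'c"
  have W_rem: "\<exists>r. rem m r c" if "W m c" for m c
    using step[OF that] unfolding rem_def by (metis rtranclp_power)
  have ex: "\<exists>y. good y \<and> nxt x y" if g: "good x" for x
  proof -
    obtain m r c where x: "x = (m, r, c)" by (cases x)
    obtain c1 c2 where c: "(R ^^ r) c c1" "V c1 (es m) c2" "W (Suc m) c2"
      using g x unfolding good_def rem_def by auto
    show ?thesis
    proof (cases r)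
      case 0
      then have "c1 = c" using c(1) by simp
      moreover obtain r' where "rem (Suc m) r' c2" using W_rem c(3) by blast
      ultimately have "good (Suc m, r', c2) \<and> nxt x (Suc m, r', c2)"
        using c(2) x 0 unfolding good_def nxt_def by simp
      then show ?thesis by blast
    next
      case (Suc r')
      then obtain c' where "R c c'" "(R ^^ r') c' c1"
        using c(1) by (metis relpowp_Suc_D2)
      then have "good (m, r', c') \<and> nxt x (m, r', c')"
        using c(2,3) x Suc unfolding good_def nxt_def rem_def by auto
      then show ?thesis by blast
    qed
  qed
  obtain r0 where r0: "rem 0 r0 c0" using W_rem init by blast
  obtain X where X: "\<And>t. good (X t)" "\<And>t. nxt (X t) (X (Suc t))" and X0: "X 0 = (0, r0, c0)"
  proof -
    have "\<exists>X. \<forall>t. (good (X t) \<and> (t = 0 \<longrightarrow> X t = (0, r0, c0))) \<and> nxt (X t) (X (Suc t))"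
      by (rule dependent_nat_choice) (use r0 ex in \<open>auto simp: good_def\<close>)
    then show ?thesis using that by blast
  qed
  define C where "C t = snd (snd (X t))" for t
  define M where "M t = fst (X t)" for t
  define r where "r t = fst (snd (X t))" for t
  define l where "l t = (if r t = 0 then Some (es (M t)) else None)" for t
  have n0: "M (Suc t) = Suc (M t) \<and> V (C t) (es (M t)) (C (Suc t))" if "r t = 0" for t
    using X(2)[of t] that unfolding nxt_def M_def C_def r_def by (simp split: prod.splits)
  have n1: "M (Suc t) = M t \<and> r (Suc t) = r t - 1 \<and> R (C t) (C (Suc t))" if "r t \<noteq> 0" for t
    using X(2)[of t] that unfolding nxt_def M_def C_def r_def by (simp split: prod.splits)
  have mono: "M s \<le> M t" if "s \<le> t" for s t
    using that by (induction rule: dec_induct) (use n0 n1 in \<open>metis le_SucI order_refl\<close>)+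
  have hit: "\<exists>s\<ge>t. r s = 0 \<and> M s = M t" for t
  proof (induction "r t" arbitrary: t)
    case (Suc x)
    then have "M (Suc t) = M t" "x = r (Suc t)" using n1[of t] by simp_all
    then show ?case using Suc(1)[of "Suc t"] by (metis Suc_leD)
  qed auto
  have all: "\<exists>t. r t = 0 \<and> M t = m" for m
  proof (induction m)
    case 0
    show ?case using hit[of 0] X0 unfolding M_def by auto
  next
    case (Suc m)
    then obtain t where "r t = 0" "M t = m" by blast
    then have "M (Suc t) = Suc m" using n0 by simp
    then show ?case using hit[of "Suc t"] by auto
  qed
  \<comment> \<open>Visible steps increase \<open>M\<close> by one and silent ones keep it, so
    exactly one visible step has \<open>M\<close> equal to \<open>m\<close>.\<close>
  define h where "h m = (SOME t. r t = 0 \<and> M t = m)" for m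
  have h: "r (h m) = 0 \<and> M (h m) = m" for m
    unfolding h_def by (rule someI_ex) (rule all)
  have uniq: "t = s" if "r t = 0" "r s = 0" "M t = M s" for t s
  proof (rule ccontr)
    assume "t \<noteq> s"
    then consider "Suc t \<le> s" | "Suc s \<le> t" by linarith
    then show False by cases (use mono n0 that in \<open>metis Suc_n_not_le_n\<close>)+
  qed
  have "strict_mono h"
  proof (rule strict_monoI, rule ccontr)
    fix x y :: nat assume "x < y" "\<not> h x < h y"
    then show False using mono[of "h y" "h x"] h by simp
  qed
  moreover have "range h = {t. l t \<noteq> None}"
    using h uniq unfolding l_def by (auto simp: image_iff) metis
  moreover have "l (h m) = Some (es m)" for m using h by (simp add: l_def)
  moreover have "C 0 = c0" by (simp add: C_def X0)
  ultimately show ?thesis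
    using that[of C l h] n0 n1 unfolding l_def by (metis option.distinct(1) option.inject)
qed

lemma sys_transE:
  assumes "\<tau> \<in> sys_trans k A Q n"
  obtains (broadcast) f g where "\<tau> = (f, GBcast, g)" "f \<in> configs Q n" "g \<in> configs Q n"
      "\<forall>i\<in>{1..n}. (f i, Bcast, g i) \<in> edges Q"
  | (rendezvous) f g a ps where "\<tau> = (f, GRdz a ps, g)" "f \<in> configs Q n" "g \<in> configs Q n"
      "a \<in> A" "length ps = k" "distinct ps" "set ps \<subseteq> {1..n}"
      "\<forall>j<k. (f (ps ! j), Rdz a (Suc j), g (ps ! j)) \<in> edges Q"
      "\<forall>i\<in>{1..n} - set ps. g i = f i"
proof -
  obtain f x g where \<tau>: "\<tau> = (f, x, g)" by (cases \<tau>)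
  from assms[unfolded \<tau>] show thesis
    by (cases rule: sys_trans.cases) (use that \<tau> in blast)+
qed

section \<open>Systems over arbitrary index sets\<close>

text \<open>These are the properties of the unwinding on which steps and groups rely. Totality of
  broadcasts lets a process outside every group follow a broadcast by an arbitrary edge.\<close>

locale rb_net =
  fixes k :: nat and A :: "'a set" and Q :: "('s, 'a, 'p) lts"
  assumes edges_states: "(s, \<sigma>, t) \<in> edges Q \<Longrightarrow> s \<in> states Q \<and> t \<in> states Q"
    and inits_states: "inits Q \<subseteq> states Q"
    and finite_states: "finite (states Q)"
    and broadcast_total: "s \<in> states Q \<Longrightarrow> \<exists>t. (s, Bcast, t) \<in> edges Q"
begin

text \<open>The symbol taken by process \<open>i\<close> is \<open>m i\<close>, with \<open>None\<close> for the processes that stay;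
  \<open>\<phi> h\<close> is the process that takes \<open>a\<^sub>h\<close>.\<close>

definition rst :: "'i set \<Rightarrow> ('i \<Rightarrow> 's) \<Rightarrow> ('i \<Rightarrow> 'a symbol option) \<Rightarrow> ('i \<Rightarrow> 's) \<Rightarrow> bool" where
  "rst J f m g \<longleftrightarrow> (\<exists>a\<in>A. \<exists>\<phi>. \<phi> ` {1..k} \<subseteq> J \<and>
     (\<forall>h\<in>{1..k}. m (\<phi> h) = Some (Rdz a h) \<and> (f (\<phi> h), Rdz a h, g (\<phi> h)) \<in> edges Q) \<and>
     (\<forall>i. i \<notin> \<phi> ` {1..k} \<longrightarrow> m i = None \<and> g i = f i))"

definition bst :: "'i set \<Rightarrow> ('i \<Rightarrow> 's) \<Rightarrow> ('i \<Rightarrow> 's) \<Rightarrow> bool" where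
  "bst J f g \<longleftrightarrow> (\<forall>i\<in>J. (f i, Bcast, g i) \<in> edges Q) \<and> (\<forall>i. i \<notin> J \<longrightarrow> g i = f i)"

definition rdzs :: "'i set \<Rightarrow> ('i \<Rightarrow> 's) \<Rightarrow> ('i \<Rightarrow> 's) \<Rightarrow> bool" where
  "rdzs J = (\<lambda>f g. \<exists>m. rst J f m g)\<^sup>*\<^sup>*"

text \<open>The surrounding rendezvous make \<open>brd\<close> absorb \<open>rdzs\<close> on either
  side, so chains of \<open>brd\<close> describe run segments by their broadcasts alone.\<close>

definition brd :: "'i set \<Rightarrow> ('i \<Rightarrow> 's) \<Rightarrow> ('i \<Rightarrow> 's) \<Rightarrow> bool" where
  "brd J f g \<longleftrightarrow> (\<exists>f' g'. rdzs J f f' \<and> bst J f' g' \<and> rdzs J g' g)"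

text \<open>Two conditions of a group \<open>J\<close> of helper processes: it can return to the configuration \<open>c\<close>
  at once, or only by way of one more broadcast.\<close>

definition pend :: "'i set \<Rightarrow> ('i \<Rightarrow> 's) \<Rightarrow> ('i \<Rightarrow> 's) \<Rightarrow> bool" where
  "pend J f c \<longleftrightarrow> (\<exists>g. rdzs J f g \<and> (\<forall>i\<in>J. g i = c i))"

definition bpend :: "'i set \<Rightarrow> ('i \<Rightarrow> 's) \<Rightarrow> ('i \<Rightarrow> 's) \<Rightarrow> bool" where
  "bpend J f c \<longleftrightarrow> (\<exists>g. brd J f g \<and> (\<forall>i\<in>J. g i = c i))"

lemma rstE:
  assumes "rst J f m g"
  obtains a \<phi> where "a \<in> A" "\<phi> ` {1..k} \<subseteq> J"
    "\<And>h. h \<in> {1..k} \<Longrightarrow> m (\<phi> h) = Some (Rdz a h) \<and> (f (\<phi> h), Rdz a h, g (\<phi> h)) \<in> edges Q"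
    "\<And>i. i \<notin> \<phi> ` {1..k} \<Longrightarrow> m i = None \<and> g i = f i"
  using assms unfolding rst_def by blast

lemma rst_mono:
  assumes "rst J f m g" "J \<subseteq> I" shows "rst I f m g"
proof -
  obtain a \<phi> where "a \<in> A" "\<phi> ` {1..k} \<subseteq> I"
    "\<And>h. h \<in> {1..k} \<Longrightarrow> m (\<phi> h) = Some (Rdz a h) \<and> (f (\<phi> h), Rdz a h, g (\<phi> h)) \<in> edges Q"
    "\<And>i. i \<notin> \<phi> ` {1..k} \<Longrightarrow> m i = None \<and> g i = f i"
    using assms by (elim rstE) (meson order_trans)
  then show ?thesis unfolding rst_def by blast
qed

lemma rst_frame: "rst J f m g \<Longrightarrow> i \<notin> J \<Longrightarrow> m i = None \<and> g i = f i"
  unfolding rst_def by blast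

lemma rst_edge:
  assumes "rst J f m g" "m i = Some \<sigma>"
  shows "(f i, \<sigma>, g i) \<in> edges Q \<and> \<sigma> \<noteq> Bcast"
proof -
  obtain a \<phi> where
    mv: "\<And>h. h \<in> {1..k} \<Longrightarrow> m (\<phi> h) = Some (Rdz a h) \<and> (f (\<phi> h), Rdz a h, g (\<phi> h)) \<in> edges Q"
    and idle: "\<And>i. i \<notin> \<phi> ` {1..k} \<Longrightarrow> m i = None \<and> g i = f i"
    using assms(1) by (elim rstE) blast
  have "i \<in> \<phi> ` {1..k}" using idle[of i] assms(2) by fastforce
  then show ?thesis using mv assms(2) by fastforce
qed

lemma rst_idle:
  assumes "rst J f m g" "m i = None" shows "g i = f i"
proof -
  obtain a \<phi> where mv: "\<And>h. h \<in> {1..k} \<Longrightarrow> m (\<phi> h) = Some (Rdz a h)"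
    and idle: "\<And>i. i \<notin> \<phi> ` {1..k} \<Longrightarrow> g i = f i"
    using assms(1) by (elim rstE) blast
  have "i \<notin> \<phi> ` {1..k}" using mv assms(2) by fastforce
  then show ?thesis using idle by blast
qed

lemma rdzs_refl: "rdzs J f f"
  by (simp add: rdzs_def)

lemma rdzs_trans: "rdzs J f g \<Longrightarrow> rdzs J g h \<Longrightarrow> rdzs J f h"
  by (simp add: rdzs_def)

lemma rst_rdzs: "rst J f m g \<Longrightarrow> rdzs J f g"
  by (auto simp add: rdzs_def)

lemma rdzs_induct [consumes 1, case_names base step]:
  assumes "rdzs J f g" "R f" "\<And>g m h. rdzs J f g \<Longrightarrow> rst J g m h \<Longrightarrow> R g \<Longrightarrow> R h"
  shows "R g"
  using assms(1) unfolding rdzs_def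
  by (induction rule: rtranclp_induct) (use assms(2,3) in \<open>auto simp: rdzs_def\<close>)

lemma rdzs_mono: "rdzs J f g \<Longrightarrow> J \<subseteq> I \<Longrightarrow> rdzs I f g"
  unfolding rdzs_def by (erule rtranclp_mono[THEN predicate2D, rotated]) (blast intro: rst_mono)

lemma rdzs_frame:
  assumes "rdzs J f g" "i \<notin> J" shows "g i = f i"
  using assms(1) by (induction rule: rdzs_induct) (auto dest: rst_frame[OF _ assms(2)])

lemma rdzs_brd: "rdzs J f g \<Longrightarrow> brd J g h \<Longrightarrow> brd J f h"
  unfolding brd_def by (blast intro: rdzs_trans)

lemma brd_rdzs: "brd J f g \<Longrightarrow> rdzs J g h \<Longrightarrow> brd J f h"
  unfolding brd_def by (blast intro: rdzs_trans)

lemma bst_brd: "bst J f g \<Longrightarrow> brd J f g"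
  unfolding brd_def by (blast intro: rdzs_refl)

section \<open>Renaming processes\<close>

text \<open>Process symmetry: the step is copied along \<open>\<psi>\<close> and \<open>F\<close> is
  kept elsewhere. \<open>F\<close> is constrained on the image only, so a group can be copied into
  any larger configuration.\<close>

lemma rst_transfer:
  assumes "rst J f m g" "inj_on \<psi> J" "\<forall>i\<in>J. F (\<psi> i) = f i"
  shows "\<exists>M G. rst (\<psi> ` J) F M G \<and> (\<forall>i\<in>J. G (\<psi> i) = g i \<and> M (\<psi> i) = m i)"
proof -
  obtain a \<phi> where a: "a \<in> A" and \<phi>: "\<phi> ` {1..k} \<subseteq> J"
    and mv: "\<forall>h\<in>{1..k}. m (\<phi> h) = Some (Rdz a h) \<and> (f (\<phi> h), Rdz a h, g (\<phi> h)) \<in> edges Q"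
    and idle: "\<forall>i. i \<notin> \<phi> ` {1..k} \<longrightarrow> m i = None \<and> g i = f i"
    using assms(1) unfolding rst_def by blast
  let ?v = "inv_into J \<psi>"
  define M where "M x = (if x \<in> \<psi> ` J then m (?v x) else None)" for x
  define G where "G x = (if x \<in> \<psi> ` J then g (?v x) else F x)" for x
  have v: "?v (\<psi> i) = i" if "i \<in> J" for i
    using assms(2) that by simp
  have on: "M (\<psi> i) = m i \<and> G (\<psi> i) = g i" if "i \<in> J" for i
    using that v[OF that] by (simp add: M_def G_def)
  have "M x = None \<and> G x = F x" if "x \<notin> (\<psi> \<circ> \<phi>) ` {1..k}" for x
  proof (cases "x \<in> \<psi> ` J")
    case True
    then obtain i where i: "i \<in> J" "x = \<psi> i" by blast
    then have "i \<notin> \<phi> ` {1..k}" using that by auto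
    then show ?thesis using i idle on[OF i(1)] assms(3) by simp
  qed (simp add: M_def G_def)
  moreover have "M (\<psi> (\<phi> h)) = Some (Rdz a h) \<and> (F (\<psi> (\<phi> h)), Rdz a h, G (\<psi> (\<phi> h))) \<in> edges Q"
    if "h \<in> {1..k}" for h
  proof -
    have "\<phi> h \<in> J" using \<phi> that by blast
    then show ?thesis using mv that on[of "\<phi> h"] assms(3) by simp
  qed
  ultimately have "rst (\<psi> ` J) F M G"
    unfolding rst_def using a \<phi> by (intro bexI[of _ a] exI[of _ "\<psi> \<circ> \<phi>"]) auto
  then show ?thesis using on by blast
qed

lemma rdzs_transfer:
  assumes "rdzs J f g" "inj_on \<psi> J" "\<forall>i\<in>J. F (\<psi> i) = f i"
  shows "\<exists>G. rdzs (\<psi> ` J) F G \<and> (\<forall>i\<in>J. G (\<psi> i) = g i)"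
  using assms(1)
proof (induction rule: rdzs_induct)
  case base
  then show ?case using assms(3) rdzs_refl by blast
next
  case (step g m h)
  then obtain G where G: "rdzs (\<psi> ` J) F G" "\<forall>i\<in>J. G (\<psi> i) = g i" by blast
  obtain M H where "rst (\<psi> ` J) G M H" "\<forall>i\<in>J. H (\<psi> i) = h i"
    using rst_transfer[OF step.hyps(2) assms(2) G(2)] by blast
  then show ?case using G(1) rst_rdzs rdzs_trans by blast
qed

lemma bst_transfer:
  assumes "bst J f g" "inj_on \<psi> J" "\<forall>i\<in>J. F (\<psi> i) = f i"
  shows "\<exists>G. bst (\<psi> ` J) F G \<and> (\<forall>i\<in>J. G (\<psi> i) = g i)"
proof -
  let ?G = "\<lambda>x. if x \<in> \<psi> ` J then g (inv_into J \<psi> x) else F x"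
  have "bst (\<psi> ` J) F ?G \<and> (\<forall>i\<in>J. ?G (\<psi> i) = g i)"
    using assms unfolding bst_def by simp
  then show ?thesis by blast
qed

lemma brd_transfer:
  assumes "brd J f g" "inj_on \<psi> J" "\<forall>i\<in>J. F (\<psi> i) = f i"
  shows "\<exists>G. brd (\<psi> ` J) F G \<and> (\<forall>i\<in>J. G (\<psi> i) = g i)"
proof -
  obtain f' g' where "rdzs J f f'" "bst J f' g'" "rdzs J g' g"
    using assms(1) unfolding brd_def by blast
  obtain F' where F': "rdzs (\<psi> ` J) F F'" "\<forall>i\<in>J. F' (\<psi> i) = f' i"
    using rdzs_transfer[OF \<open>rdzs J f f'\<close> assms(2,3)] by blast
  obtain G' where G': "bst (\<psi> ` J) F' G'" "\<forall>i\<in>J. G' (\<psi> i) = g' i"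
    using bst_transfer[OF \<open>bst J f' g'\<close> assms(2) F'(2)] by blast
  obtain G where "rdzs (\<psi> ` J) G' G" "\<forall>i\<in>J. G (\<psi> i) = g i"
    using rdzs_transfer[OF \<open>rdzs J g' g\<close> assms(2) G'(2)] by blast
  then show ?thesis using F'(1) G'(1) unfolding brd_def by blast
qed

lemma pend_transfer:
  assumes "pend J f c" "inj_on \<psi> J" "\<forall>i\<in>J. F (\<psi> i) = f i" "\<forall>i\<in>J. C (\<psi> i) = c i"
  shows "pend (\<psi> ` J) F C"
proof -
  obtain g where g: "rdzs J f g" "\<forall>i\<in>J. g i = c i"
    using assms(1) unfolding pend_def by blast
  show ?thesis using rdzs_transfer[OF g(1) assms(2,3)] g(2) assms(4) unfolding pend_def by auto
qed

lemma bpend_transfer: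
  assumes "bpend J f c" "inj_on \<psi> J" "\<forall>i\<in>J. F (\<psi> i) = f i" "\<forall>i\<in>J. C (\<psi> i) = c i"
  shows "bpend (\<psi> ` J) F C"
proof -
  obtain g where g: "brd J f g" "\<forall>i\<in>J. g i = c i"
    using assms(1) unfolding bpend_def by blast
  show ?thesis using brd_transfer[OF g(1) assms(2,3)] g(2) assms(4) unfolding bpend_def by auto
qed

text \<open>The renaming \<open>id\<close> already says something: a step keeps the values outside
  \<open>J\<close>, so replaying it from an \<open>F\<close> that differs there needs a new
  target.\<close>

lemma rst_cong:
  assumes "rst J f m g" "\<forall>i\<in>J. F i = f i"
  shows "\<exists>M G. rst J F M G \<and> (\<forall>i\<in>J. G i = g i \<and> M i = m i)"
  using rst_transfer[OF assms(1) inj_on_id, of F] assms(2) by simp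

lemma bst_cong: "bst J f g \<Longrightarrow> \<forall>i\<in>J. F i = f i \<Longrightarrow> \<exists>G. bst J F G \<and> (\<forall>i\<in>J. G i = g i)"
  using bst_transfer[OF _ inj_on_id, of J f g F] by simp

lemma pend_cong: "pend J f c \<Longrightarrow> \<forall>i\<in>J. F i = f i \<Longrightarrow> pend J F c"
  using pend_transfer[OF _ inj_on_id, of J f c F c] by simp

lemma bpend_cong: "bpend J f c \<Longrightarrow> \<forall>i\<in>J. F i = f i \<Longrightarrow> bpend J F c"
  using bpend_transfer[OF _ inj_on_id, of J f c F c] by simp

lemma pend_bpend:
  assumes "pend J f c" "bpend J c c'" shows "bpend J f c'"
proof -
  obtain g where g: "rdzs J f g" "\<forall>i\<in>J. g i = c i"
    using assms(1) unfolding pend_def by blast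
  then have "bpend J g c'" using bpend_cong[OF assms(2)] by simp
  then show ?thesis using g(1) rdzs_brd unfolding bpend_def by blast
qed

lemma bpend_split:
  assumes "bpend J f c"
  shows "\<exists>f' g'. rdzs J f f' \<and> bst J f' g' \<and> pend J g' c"
  using assms unfolding bpend_def brd_def pend_def by blast

lemma rst_states:
  assumes "rst J f m g" "f i \<in> states Q" shows "g i \<in> states Q"
proof (cases "m i")
  case None
  then show ?thesis using assms rst_idle by metis
next
  case (Some \<sigma>)
  then show ?thesis using assms(1) rst_edge edges_states by metis
qed

lemma rdzs_states:
  assumes "rdzs J f g" "f i \<in> states Q" shows "g i \<in> states Q"
  using assms(1) by (induction rule: rdzs_induct) (metis assms(2), metis rst_states)

section \<open>Exchanging roles\<close>

text \<open>The tracked process may first change its role within the configuration, from \<open>r\<close> to an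
  index \<open>r'\<close> in the same state; process symmetry makes this invisible.\<close>

definition quiet :: "'i set \<Rightarrow> ('i \<Rightarrow> 's) \<times> 'i \<Rightarrow> ('i \<Rightarrow> 's) \<times> 'i \<Rightarrow> bool" where
  "quiet I = (\<lambda>(f, r) (g, r'). r' \<in> I \<and> f r = f r' \<and> (\<exists>m. rst I f m g \<and> m r' = None))"

definition acts ::
    "'i set \<Rightarrow> ('i \<Rightarrow> 's) \<times> 'i \<Rightarrow> ('s, 'a) edge \<Rightarrow> ('i \<Rightarrow> 's) \<times> 'i \<Rightarrow> bool" where
  "acts I = (\<lambda>(f, r) e (g, r'). r' \<in> I \<and> f r = f r' \<and>
     ((\<exists>m \<sigma>. rst I f m g \<and> m r' = Some \<sigma> \<and> e = (f r', \<sigma>, g r')) \<or>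
      (bst I f g \<and> e = (f r', Bcast, g r'))))"

lemma rdzs_quiet:
  assumes "rdzs J f g" "J \<subseteq> I" "r \<in> I - J"
  shows "(quiet I)\<^sup>*\<^sup>* (f, r) (g, r)"
  using assms(1)
proof (induction rule: rdzs_induct)
  case (step g m h)
  then have "quiet I (g, r) (h, r)"
    using rst_mono[OF _ assms(2)] rst_frame[of J g m h r] assms(3) unfolding quiet_def by auto
  then show ?case using step.IH by simp
qed simp

text \<open>Every step begins with a free choice among roles in the same state, so an exchange in
  front of the sequence is absorbed by its first step.\<close>

lemma quiet_acts_swap:
  assumes "(quiet I)\<^sup>*\<^sup>* (f, r') c" "acts I c e d" "f r = f r'"
  shows "\<exists>c'. (quiet I)\<^sup>*\<^sup>* (f, r) c' \<and> acts I c' e d"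
  using assms(1)
proof (cases rule: converse_rtranclpE)
  case base
  then have "acts I (f, r) e d" using assms(2,3) unfolding acts_def by auto
  then show ?thesis by blast
next
  case (step y)
  then have "quiet I (f, r) y" using assms(3) unfolding quiet_def by auto
  then show ?thesis using step(2) assms(2) by (meson converse_rtranclp_into_rtranclp)
qed

section \<open>From steps over an index set to runs of the system\<close>

lemma rst_sys_trans:
  assumes rst: "rst I f m g" and \<pi>: "bij_betw \<pi> {1..n} I"
    and st: "\<forall>i\<in>I. f i \<in> states Q"
  shows "\<exists>\<tau>\<in>sys_trans k A Q n. fst \<tau> = restrict (f \<circ> \<pi>) {1..n} \<and>
    snd (snd \<tau>) = restrict (g \<circ> \<pi>) {1..n} \<and>
    (\<forall>i\<in>{1..n}. \<forall>e. takes n \<tau> i e \<longleftrightarrow> (\<exists>\<sigma>. m (\<pi> i) = Some \<sigma> \<and> e = (f (\<pi> i), \<sigma>, g (\<pi> i))))"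
proof -
  obtain a \<phi> where a: "a \<in> A" and \<phi>: "\<phi> ` {1..k} \<subseteq> I"
    and mv: "\<And>h. h \<in> {1..k} \<Longrightarrow> m (\<phi> h) = Some (Rdz a h) \<and> (f (\<phi> h), Rdz a h, g (\<phi> h)) \<in> edges Q"
    and idle: "\<And>i. i \<notin> \<phi> ` {1..k} \<Longrightarrow> m i = None \<and> g i = f i"
    using rst by (elim rstE) blast
  define v where "v = inv_into {1..n} \<pi>"
  have v: "v x \<in> {1..n}" "\<pi> (v x) = x" if "x \<in> I" for x
    using \<pi> that unfolding v_def bij_betw_def by (auto intro: inv_into_into f_inv_into_f)
  \<comment> \<open>\<open>v\<close> inverts the numbering \<open>\<pi>\<close>; list positions
    start at 0 and rendezvous symbols at 1, hence \<open>Suc j\<close>.\<close>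
  define ps where "ps = map (\<lambda>j. v (\<phi> (Suc j))) [0..<k]"
  have nth: "ps ! j \<in> {1..n}" "\<pi> (ps ! j) = \<phi> (Suc j)" if "j < k" for j
  proof -
    have "\<phi> (Suc j) \<in> I" using \<phi> that by force
    then show "ps ! j \<in> {1..n}" "\<pi> (ps ! j) = \<phi> (Suc j)" using v that by (simp_all add: ps_def)
  qed
  have len: "length ps = k" by (simp add: ps_def)
  have mv': "m (\<phi> (Suc j)) = Some (Rdz a (Suc j))"
    "(f (\<phi> (Suc j)), Rdz a (Suc j), g (\<phi> (Suc j))) \<in> edges Q" if "j < k" for j
    using mv[of "Suc j"] that by auto
  \<comment> \<open>\<open>rst\<close> encodes injectivity of \<open>\<phi>\<close> in
    \<open>m\<close>: one process cannot be assigned two symbols.\<close>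
  have dist: "distinct ps"
    unfolding distinct_conv_nth len
  proof (intro allI impI)
    fix i j assume "i < k" "j < k" "i \<noteq> j"
    then show "ps ! i \<noteq> ps ! j"
      using nth(2)[of i] nth(2)[of j] mv'(1)[of i] mv'(1)[of j] by force
  qed
  have \<pi>I: "\<pi> i \<in> I" if "i \<in> {1..n}" for i using \<pi> that by (auto simp: bij_betw_def)
  have in_set: "i \<in> set ps \<longleftrightarrow> \<pi> i \<in> \<phi> ` {1..k}" if "i \<in> {1..n}" for i
  proof
    assume "i \<in> set ps"
    then obtain j where "j < k" "i = ps ! j" using len by (metis in_set_conv_nth)
    then show "\<pi> i \<in> \<phi> ` {1..k}" using nth(2) by force
  next
    assume "\<pi> i \<in> \<phi> ` {1..k}"
    then obtain h where "h \<in> {1..k}" "\<pi> i = \<phi> h" by blast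
    then have "h - 1 < k" "\<pi> (ps ! (h - 1)) = \<pi> i" "ps ! (h - 1) \<in> {1..n}"
      using nth[of "h - 1"] by auto
    then show "i \<in> set ps"
      using \<pi> that len unfolding bij_betw_def inj_on_def by (metis nth_mem)
  qed
  let ?F = "restrict (f \<circ> \<pi>) {1..n}" and ?G = "restrict (g \<circ> \<pi>) {1..n}"
  have "(?F, GRdz a ps, ?G) \<in> sys_trans k A Q n"
  proof (rule sys_trans.rendezvous)
    show "?F \<in> configs Q n" using st \<pi>I by (auto simp: configs_def)
    show "?G \<in> configs Q n" using st \<pi>I rst_states[OF rst] by (auto simp: configs_def)
    show "set ps \<subseteq> {1..n}" using nth(1) len by (metis in_set_conv_nth subsetI)
    show "\<forall>j<k. (?F (ps ! j), Rdz a (Suc j), ?G (ps ! j)) \<in> edges Q"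
      using nth mv' by simp
    show "\<forall>i\<in>{1..n} - set ps. ?G i = ?F i"
    proof
      fix i assume i: "i \<in> {1..n} - set ps"
      then have "\<pi> i \<notin> \<phi> ` {1..k}" using in_set by blast
      then have "g (\<pi> i) = f (\<pi> i)" using idle by blast
      then show "?G i = ?F i" using i by simp
    qed
  qed (use a len dist in auto)
  moreover have "takes n (?F, GRdz a ps, ?G) i e \<longleftrightarrow>
      (\<exists>\<sigma>. m (\<pi> i) = Some \<sigma> \<and> e = (f (\<pi> i), \<sigma>, g (\<pi> i)))" if i: "i \<in> {1..n}" for i e
  proof (cases "i \<in> set ps")
    case True
    then obtain j where j: "j < k" "ps ! j = i" using len by (metis in_set_conv_nth)
    then have "\<forall>j'<k. ps ! j' = i \<longleftrightarrow> j' = j" using dist len by (metis distinct_conv_nth)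
    moreover have "m (\<pi> i) = Some (Rdz a (Suc j))" using nth(2)[OF j(1)] mv'(1)[OF j(1)] j(2) by simp
    ultimately show ?thesis using j i len by auto
  next
    case False
    then have "m (\<pi> i) = None" using in_set i idle by blast
    then show ?thesis using False len by auto
  qed
  ultimately show ?thesis by (intro bexI[of _ "(?F, GRdz a ps, ?G)"]) simp_all
qed

lemma bst_sys_trans:
  assumes bst: "bst I f g" and \<pi>: "bij_betw \<pi> {1..n} I"
  shows "\<exists>\<tau>\<in>sys_trans k A Q n. fst \<tau> = restrict (f \<circ> \<pi>) {1..n} \<and>
    snd (snd \<tau>) = restrict (g \<circ> \<pi>) {1..n} \<and>
    (\<forall>i\<in>{1..n}. \<forall>e. takes n \<tau> i e \<longleftrightarrow> e = (f (\<pi> i), Bcast, g (\<pi> i)))"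
proof -
  let ?F = "restrict (f \<circ> \<pi>) {1..n}" and ?G = "restrict (g \<circ> \<pi>) {1..n}"
  have "(f (\<pi> i), Bcast, g (\<pi> i)) \<in> edges Q" if "i \<in> {1..n}" for i
    using bst \<pi> that by (auto simp: bst_def bij_betw_def)
  moreover from this have "f (\<pi> i) \<in> states Q \<and> g (\<pi> i) \<in> states Q" if "i \<in> {1..n}" for i
    using edges_states that by blast
  ultimately have "(?F, GBcast, ?G) \<in> sys_trans k A Q n"
    by (intro sys_trans.broadcast) (auto simp: configs_def)
  then show ?thesis by (intro bexI[of _ "(?F, GBcast, ?G)"]) auto
qed

text \<open>Process 1 must follow the tracked role \<open>r t\<close>. The numbering
  \<open>\<pi> t\<close> of the roles is changed by transpositions that maintain
  \<open>\<pi> t 1 = r t\<close>; roles are exchanged only in equal states, so the configuration of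
  the numbered processes does not jump. \<open>W m\<close> is the invariant of a strategy that has
  to take \<open>es m\<close> next.\<close>

lemma exec_infI:
  assumes fin: "finite I" and r0: "r0 \<in> I" and f0: "\<forall>i\<in>I. f0 i \<in> inits Q"
    and W0: "W 0 (f0, r0)"
    and step: "\<And>m c. W m c \<Longrightarrow> \<exists>c1 c2. (quiet I)\<^sup>*\<^sup>* c c1 \<and> acts I c1 (es m) c2 \<and> W (Suc m) c2"
  shows "(\<lambda>m. label Q (fst (es m))) \<in> exec_inf k A Q"
proof -
  obtain C l h where C0: "C 0 = (f0, r0)"
    and Cq: "\<And>t. l t = None \<Longrightarrow> quiet I (C t) (C (Suc t))"
    and Ca: "\<And>t e. l t = Some e \<Longrightarrow> acts I (C t) e (C (Suc t))"
    and h: "strict_mono (h :: nat \<Rightarrow> nat)" "range h = {t. l t \<noteq> None}" "\<And>m. l (h m) = Some (es m)"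
    by (rule weave_runs[where W = W and R = "quiet I" and V = "acts I" and es = es, OF W0 step])
      (assumption | rule that)+
  define f where "f t = fst (C t)" for t
  define r where "r t = snd (C t)" for t
  define n where "n = card I"
  have n: "n \<ge> 1" using fin r0 unfolding n_def by (simp add: Suc_le_eq card_gt_0_iff) blast
  \<comment> \<open>\<open>map_option\<close> joins the silent case, where the tracked role is idle,
    with the visible rendezvous.\<close>
  have step': "r (Suc t) \<in> I \<and> f t (r t) = f t (r (Suc t)) \<and>
      ((\<exists>m. rst I (f t) m (f (Suc t)) \<and>
          l t = map_option (\<lambda>\<sigma>. (f t (r (Suc t)), \<sigma>, f (Suc t) (r (Suc t)))) (m (r (Suc t)))) \<or>
       (bst I (f t) (f (Suc t)) \<and> l t = Some (f t (r (Suc t)), Bcast, f (Suc t) (r (Suc t)))))" for t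
  proof (cases "l t")
    case None
    then show ?thesis using Cq[OF None] unfolding quiet_def f_def r_def by (auto split: prod.splits)
  next
    case (Some e)
    show ?thesis using Ca[OF Some] Some unfolding acts_def f_def r_def
      by (auto split: prod.splits)
  qed
  have st: "\<forall>i\<in>I. f t i \<in> states Q" for t
  proof (induction t)
    case 0
    then show ?case using C0 f0 inits_states by (auto simp: f_def)
  next
    case (Suc t)
    show ?case
    proof
      fix i assume i: "i \<in> I"
      from step'[of t] consider m where "rst I (f t) m (f (Suc t))" | "bst I (f t) (f (Suc t))" by blast
      then show "f (Suc t) i \<in> states Q"
      proof cases
        case 1
        then show ?thesis using rst_states[OF 1] Suc i by simp
      next
        case 2
        then have "(f t i, Bcast, f (Suc t) i) \<in> edges Q" using i by (simp add: bst_def)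
        then show ?thesis using edges_states by blast
      qed
    qed
  qed
  have r: "r t \<in> I" for t using r0 C0 step' by (cases t) (auto simp: r_def)
  have "\<exists>\<pi>. bij_betw \<pi> {1..n} I \<and> \<pi> 1 = r0"
  proof -
    obtain \<pi> where \<pi>: "bij_betw \<pi> {1..n} I"
      using ex_bij_betw_nat_finite_1[OF fin] unfolding n_def by blast
    then have "bij_betw (transpose (\<pi> 1) r0 \<circ> \<pi>) {1..n} I"
      using n r0 by (intro bij_betw_trans[OF \<pi>] bij_betw_transpose_iff) (auto simp: bij_betw_def)
    then show ?thesis by (intro exI[of _ "transpose (\<pi> 1) r0 \<circ> \<pi>"]) simp
  qed
  then obtain \<pi>0 where \<pi>0: "bij_betw \<pi>0 {1..n} I" "\<pi>0 1 = r0" by blast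
  define \<pi> where "\<pi> = rec_nat \<pi>0 (\<lambda>t p. transpose (r t) (r (Suc t)) \<circ> p)"
  have \<pi>_simps: "\<pi> 0 = \<pi>0" "\<pi> (Suc t) = transpose (r t) (r (Suc t)) \<circ> \<pi> t" for t
    by (simp_all add: \<pi>_def)
  have \<pi>: "bij_betw (\<pi> t) {1..n} I \<and> \<pi> t 1 = r t" for t
  proof (induction t)
    case 0
    then show ?case using \<pi>0 C0 by (simp add: \<pi>_simps r_def)
  next
    case (Suc t)
    have "bij_betw (transpose (r t) (r (Suc t))) I I"
      using r by (intro bij_betw_transpose_iff) simp
    then have "bij_betw (\<pi> (Suc t)) {1..n} I"
      unfolding \<pi>_simps using Suc by (blast intro: bij_betw_trans)
    moreover have "\<pi> (Suc t) 1 = r (Suc t)" using Suc by (simp add: \<pi>_simps(2))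
    ultimately show ?case by blast
  qed
  define c where "c t = restrict (f t \<circ> \<pi> t) {1..n}" for t
  \<comment> \<open>The source of step \<open>t\<close> reads the same under \<open>\<pi> t\<close>
    and \<open>\<pi> (Suc t)\<close>, so consecutive transitions fit together.\<close>
  have c: "c t = restrict (f t \<circ> \<pi> (Suc t)) {1..n}" for t
  proof -
    have "f t (transpose (r t) (r (Suc t)) x) = f t x" for x
      using step'[of t] by (simp add: transpose_def)
    then show ?thesis by (simp add: c_def \<pi>_simps fun_eq_iff restrict_def)
  qed
  have "\<exists>\<tau>\<in>sys_trans k A Q n. fst \<tau> = c t \<and> snd (snd \<tau>) = c (Suc t) \<and>
     (\<forall>e. takes n \<tau> 1 e \<longleftrightarrow> l t = Some e)" for t
  proof -
    have one: "1 \<in> {1..n}" using n by simp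
    have \<pi>1: "\<pi> (Suc t) 1 = r (Suc t)" and \<pi>b: "bij_betw (\<pi> (Suc t)) {1..n} I" using \<pi> by blast+
    from step'[of t] consider m where "rst I (f t) m (f (Suc t))"
        "l t = map_option (\<lambda>\<sigma>. (f t (r (Suc t)), \<sigma>, f (Suc t) (r (Suc t)))) (m (r (Suc t)))"
      | "bst I (f t) (f (Suc t))" "l t = Some (f t (r (Suc t)), Bcast, f (Suc t) (r (Suc t)))"
      by blast
    then show ?thesis
    proof cases
      case (1 m)
      obtain \<tau> where \<tau>: "\<tau> \<in> sys_trans k A Q n" "fst \<tau> = c t" "snd (snd \<tau>) = c (Suc t)"
        "\<forall>i\<in>{1..n}. \<forall>e. takes n \<tau> i e \<longleftrightarrow> (\<exists>\<sigma>. m (\<pi> (Suc t) i) = Some \<sigma> \<and>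
           e = (f t (\<pi> (Suc t) i), \<sigma>, f (Suc t) (\<pi> (Suc t) i)))"
        using rst_sys_trans[OF 1(1) \<pi>b st] unfolding c[of t] c_def[of "Suc t"] by blast
      have "takes n \<tau> 1 e \<longleftrightarrow> l t = Some e" for e
        using \<tau>(4)[rule_format, OF one, of e] 1(2) unfolding \<pi>1 by auto
      then show ?thesis using \<tau>(1-3) by blast
    next
      case 2
      obtain \<tau> where \<tau>: "\<tau> \<in> sys_trans k A Q n" "fst \<tau> = c t" "snd (snd \<tau>) = c (Suc t)"
        "\<forall>i\<in>{1..n}. \<forall>e. takes n \<tau> i e \<longleftrightarrow>
           e = (f t (\<pi> (Suc t) i), Bcast, f (Suc t) (\<pi> (Suc t) i))"
        using bst_sys_trans[OF 2(1) \<pi>b] unfolding c[of t] c_def[of "Suc t"] by blast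
      have "takes n \<tau> 1 e \<longleftrightarrow> l t = Some e" for e
        using \<tau>(4)[rule_format, OF one, of e] 2(2) unfolding \<pi>1 by auto
      then show ?thesis using \<tau>(1-3) by blast
    qed
  qed
  then obtain \<rho> where \<rho>: "\<And>t. \<rho> t \<in> sys_trans k A Q n" "\<And>t. fst (\<rho> t) = c t"
    "\<And>t. snd (snd (\<rho> t)) = c (Suc t)" "\<And>t e. takes n (\<rho> t) 1 e \<longleftrightarrow> l t = Some e"
    by metis
  have "c 0 \<in> init_configs Q n"
    using f0 C0 \<pi>0(1) by (auto simp: c_def f_def init_configs_def \<pi>_simps bij_betw_def)
  then have "inf_run k A Q n \<rho>" using \<rho> by (simp add: inf_run_def)
  moreover have "edge_sequence n \<rho> 1 es"
    using h \<rho>(4) unfolding edge_sequence_def by (intro exI[of _ h]) auto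
  ultimately show ?thesis unfolding exec_inf_def using n by blast
qed

section \<open>Groups of helper processes\<close>

text \<open>After lending the edge \<open>e\<close> to the tracked process, a group at rest in \<open>c\<close> may return to
  \<open>c\<close> and serve again before the next broadcast. A group for a dark green edge is instead used
  up until the next rest configuration \<open>c'\<close>, which lies beyond that broadcast.\<close>

definition rdz_station ::
    "'i set \<Rightarrow> ('i \<Rightarrow> 's) \<Rightarrow> ('i \<Rightarrow> 's) \<Rightarrow> bool \<Rightarrow> ('s, 'a) edge \<Rightarrow> bool" where
  "rdz_station J c c' dark = (\<lambda>(s, \<sigma>, t). \<exists>j\<in>J. c j = s \<and>
     (\<exists>m g. rst J c m g \<and> m j = Some \<sigma> \<and> g j = t \<and> (pend J g c \<or> dark \<and> bpend J g c')))"

text \<open>No return to \<open>c\<close> is asked for, since the broadcast itself leads on to the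
  next rest configuration \<open>c'\<close>.\<close>

definition bc_station :: "'i set \<Rightarrow> ('i \<Rightarrow> 's) \<Rightarrow> ('i \<Rightarrow> 's) \<Rightarrow> ('s, 'a) edge \<Rightarrow> bool" where
  "bc_station J c c' = (\<lambda>(s, \<sigma>, t). \<exists>j\<in>J. c j = s \<and> (\<exists>g. bst J c g \<and> g j = t \<and> pend J g c'))"

text \<open>\<open>U\<close> is the set of groups that are used up.\<close>

definition ready ::
    "'i set \<Rightarrow> 'g set \<Rightarrow> ('g \<Rightarrow> 'i set) \<Rightarrow> ('i \<Rightarrow> 's) \<Rightarrow> ('i \<Rightarrow> 's) \<Rightarrow> nat \<Rightarrow> 's \<Rightarrow> ('i \<Rightarrow> 's) \<times> 'i \<Rightarrow> bool"
  where
  "ready I \<Gamma> J c c' u s = (\<lambda>(F, r). r \<in> I \<and> (\<forall>i\<in>I. F i \<in> states Q) \<and> F r = s \<and>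
     (\<exists>U\<subseteq>\<Gamma>. card U \<le> u \<and> (\<forall>\<gamma>\<in>\<Gamma> - U. pend (J \<gamma>) F c) \<and> (\<forall>\<gamma>\<in>U. bpend (J \<gamma>) F c')))"

lemma pend_rest:
  assumes "pend J F c" "J \<subseteq> I" "r \<in> I - J"
  obtains F' where "(quiet I)\<^sup>*\<^sup>* (F, r) (F', r)" "\<forall>i\<in>J. F' i = c i" "\<forall>i. i \<notin> J \<longrightarrow> F' i = F i"
    "\<forall>i. F i \<in> states Q \<longrightarrow> F' i \<in> states Q"
proof -
  obtain F' where F': "rdzs J F F'" "\<forall>i\<in>J. F' i = c i" using assms(1) unfolding pend_def by blast
  show ?thesis
    by (rule that[of F']) (use F' rdzs_quiet[OF F'(1) assms(2,3)] rdzs_frame[OF F'(1)] rdzs_states[OF F'(1)] in auto)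
qed

text \<open>Besides the at most \<open>b\<close> groups that are used up, one more group is unavailable: the one
  whose role the tracked process plays.\<close>

lemma free_station:
  assumes "finite \<Gamma>" "\<Gamma>' \<subseteq> \<Gamma>" "card \<Gamma>' \<ge> b + 2" "card U \<le> b" "U \<subseteq> \<Gamma>"
    and disj: "\<And>\<gamma> \<delta>. \<gamma> \<in> \<Gamma> \<Longrightarrow> \<delta> \<in> \<Gamma> \<Longrightarrow> \<gamma> \<noteq> \<delta> \<Longrightarrow> J \<gamma> \<inter> J \<delta> = {}"
  shows "\<exists>\<gamma>\<in>\<Gamma>' - U. r \<notin> J \<gamma>"
proof -
  have fin: "finite \<Gamma>'" "finite U" using assms finite_subset by auto
  have "card (\<Gamma>' - U) \<ge> 2"
    using diff_card_le_card_Diff[OF fin(2), of \<Gamma>'] assms(3,4) by linarith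
  then obtain \<gamma> \<delta> where "\<gamma> \<in> \<Gamma>' - U" "\<delta> \<in> \<Gamma>' - U" "\<gamma> \<noteq> \<delta>"
    by (elim obtain_subset_with_card_n) (auto simp: card_2_iff)
  then show ?thesis using disj[of \<gamma> \<delta>] assms(2) by blast
qed

text \<open>A group that is neither used up nor contains the tracked role is led back to rest by
  silent steps; then the tracked process takes over its role \<open>j\<close>. The role it leaves
  stays in the configuration, so the group left behind is still complete, and disjointness protects
  all other groups.\<close>

lemma ready_rdz_step:
  assumes \<Gamma>: "finite \<Gamma>" "\<And>\<gamma>. \<gamma> \<in> \<Gamma> \<Longrightarrow> J \<gamma> \<subseteq> I"
    and disj: "\<And>\<gamma> \<delta>. \<gamma> \<in> \<Gamma> \<Longrightarrow> \<delta> \<in> \<Gamma> \<Longrightarrow> \<gamma> \<noteq> \<delta> \<Longrightarrow> J \<gamma> \<inter> J \<delta> = {}"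
    and ready: "ready I \<Gamma> J c c' u (fst e) C" and u: "u \<le> b"
    and st: "\<Gamma>' \<subseteq> \<Gamma>" "card \<Gamma>' \<ge> b + 2" "\<And>\<gamma>. \<gamma> \<in> \<Gamma>' \<Longrightarrow> rdz_station (J \<gamma>) c c' dark e"
  shows "\<exists>C1 C2. (quiet I)\<^sup>*\<^sup>* C C1 \<and> acts I C1 e C2 \<and>
    ready I \<Gamma> J c c' (if dark then Suc u else u) (snd (snd e)) C2"
proof -
  obtain F r where C: "C = (F, r)" by fastforce
  obtain s \<sigma> t where e: "e = (s, \<sigma>, t)" by (cases e)
  obtain U where r: "r \<in> I" and FI: "\<forall>i\<in>I. F i \<in> states Q" and Fr: "F r = s"
    and U: "U \<subseteq> \<Gamma>" "card U \<le> u" "\<forall>\<gamma>\<in>\<Gamma> - U. pend (J \<gamma>) F c" "\<forall>\<gamma>\<in>U. bpend (J \<gamma>) F c'"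
    using ready unfolding ready_def C e by auto
  have "card U \<le> b" using U(2) u by simp
  obtain \<gamma> where \<gamma>: "\<gamma> \<in> \<Gamma>' - U" "r \<notin> J \<gamma>"
    using free_station[OF \<Gamma>(1) st(1,2) \<open>card U \<le> b\<close> U(1), of J r] disj by blast
  then have \<gamma>\<Gamma>: "\<gamma> \<in> \<Gamma>" "\<gamma> \<in> \<Gamma> - U" using st(1) by auto
  obtain F1 where F1: "(quiet I)\<^sup>*\<^sup>* (F, r) (F1, r)" "\<forall>i\<in>J \<gamma>. F1 i = c i"
    "\<forall>i. i \<notin> J \<gamma> \<longrightarrow> F1 i = F i" "\<forall>i. F i \<in> states Q \<longrightarrow> F1 i \<in> states Q"
    using pend_rest[OF bspec[OF U(3) \<gamma>\<Gamma>(2)] \<Gamma>(2)[OF \<gamma>\<Gamma>(1)], of r] r \<gamma>(2) by blast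
  obtain j m g where j: "j \<in> J \<gamma>" "c j = s" and g: "rst (J \<gamma>) c m g" "m j = Some \<sigma>" "g j = t"
    "pend (J \<gamma>) g c \<or> dark \<and> bpend (J \<gamma>) g c'"
    using st(3)[of \<gamma>] \<gamma>(1) unfolding rdz_station_def e by auto
  obtain M G where G: "rst (J \<gamma>) F1 M G" "\<forall>i\<in>J \<gamma>. G i = g i \<and> M i = m i"
    using rst_cong[OF g(1) F1(2)] by blast
  have "acts I (F1, r) e (G, j)"
    unfolding acts_def e
  proof (clarify, intro conjI disjI1)
    show "j \<in> I" using j(1) \<Gamma>(2)[OF \<gamma>\<Gamma>(1)] by blast
    show "F1 r = F1 j" using j F1(2,3) \<gamma>(2) Fr by simp
    have "rst I F1 M G" using rst_mono[OF G(1) \<Gamma>(2)[OF \<gamma>\<Gamma>(1)]] .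
    moreover have "M j = Some \<sigma>" "(s, \<sigma>, t) = (F1 j, \<sigma>, G j)" using G(2) j g(2,3) F1(2) by simp_all
    ultimately show "\<exists>m \<sigma>'. rst I F1 m G \<and> m j = Some \<sigma>' \<and> (s, \<sigma>, t) = (F1 j, \<sigma>', G j)" by blast
  qed
  moreover have "ready I \<Gamma> J c c' (if dark then Suc u else u) t (G, j)"
  proof -
    have same: "G i = F i" if "\<delta> \<in> \<Gamma>" "\<delta> \<noteq> \<gamma>" "i \<in> J \<delta>" for \<delta> i
    proof -
      have "i \<notin> J \<gamma>" using that disj[of \<delta> \<gamma>] \<gamma>\<Gamma>(1) by blast
      then show ?thesis using F1(3) rst_frame[OF G(1), of i] by simp
    qed
    have p: "pend (J \<delta>) G c" if "\<delta> \<in> \<Gamma> - U" "\<delta> \<noteq> \<gamma>" for \<delta>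
      by (rule pend_cong[of _ F]) (use U(3) that same[of \<delta>] in auto)
    have bp: "bpend (J \<delta>) G c'" if "\<delta> \<in> U" for \<delta>
      by (rule bpend_cong[of _ F]) (use U(1,4) that same[of \<delta>] \<gamma>(1) in auto)
    have "\<exists>V\<subseteq>\<Gamma>. card V \<le> (if dark then Suc u else u) \<and>
      (\<forall>\<gamma>\<in>\<Gamma> - V. pend (J \<gamma>) G c) \<and> (\<forall>\<gamma>\<in>V. bpend (J \<gamma>) G c')"
      using g(4)
    proof
      assume "pend (J \<gamma>) g c"
      then have "pend (J \<gamma>) G c" using G(2) by (blast intro: pend_cong)
      then have "\<forall>\<delta>\<in>\<Gamma> - U. pend (J \<delta>) G c" using p by metis
      moreover have "card U \<le> (if dark then Suc u else u)" using U(2) by simp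
      ultimately show ?thesis using U(1) bp by blast
    next
      \<comment> \<open>The group joins \<open>U\<close>, at the cost of one unit of the
        bound.\<close>
      assume d: "dark \<and> bpend (J \<gamma>) g c'"
      then have "bpend (J \<gamma>) G c'" using G(2) by (blast intro: bpend_cong)
      moreover have "card (insert \<gamma> U) \<le> Suc u"
        using card_insert_le_m1[of "Suc u" U \<gamma>] U(2) by simp
      moreover have "insert \<gamma> U \<subseteq> \<Gamma>" using U(1) \<gamma>\<Gamma>(1) by blast
      moreover have "\<forall>\<delta>\<in>\<Gamma> - insert \<gamma> U. pend (J \<delta>) G c" using p by blast
      moreover have "dark" using d by blast
      ultimately show ?thesis using bp by (intro exI[of _ "insert \<gamma> U"]) simp
    qed
    moreover have "\<forall>i\<in>I. G i \<in> states Q" using FI F1(4) rst_states[OF G(1)] by metis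
    moreover have "G j = t" using G(2) j(1) g(3) by simp
    moreover have "j \<in> I" using j(1) \<Gamma>(2)[OF \<gamma>\<Gamma>(1)] by blast
    ultimately show ?thesis unfolding ready_def by simp
  qed
  ultimately show ?thesis using F1(1) unfolding C e snd_conv by blast
qed

text \<open>Each group runs by itself up to the moment before its broadcast and waits there while
  the other, disjoint groups do the same.\<close>

lemma all_broadcast:
  assumes "finite D" "\<And>\<gamma>. \<gamma> \<in> D \<Longrightarrow> bpend (J \<gamma>) F c'"
    and disj: "\<And>\<gamma> \<delta>. \<gamma> \<in> D \<Longrightarrow> \<delta> \<in> D \<Longrightarrow> \<gamma> \<noteq> \<delta> \<Longrightarrow> J \<gamma> \<inter> J \<delta> = {}"
  shows "\<exists>F'. rdzs (\<Union>\<gamma>\<in>D. J \<gamma>) F F' \<and> (\<forall>\<gamma>\<in>D. \<exists>g. bst (J \<gamma>) F' g \<and> pend (J \<gamma>) g c')"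
  using assms
proof (induction D rule: finite_induct)
  case empty
  then show ?case using rdzs_refl by fastforce
next
  case (insert \<delta> D)
  obtain F1 where F1: "rdzs (\<Union>\<gamma>\<in>D. J \<gamma>) F F1" "\<forall>\<gamma>\<in>D. \<exists>g. bst (J \<gamma>) F1 g \<and> pend (J \<gamma>) g c'"
    using insert.IH insert.prems by auto
  have off: "J \<delta> \<inter> J \<gamma> = {}" if "\<gamma> \<in> D" for \<gamma>
    using insert.prems(2)[of \<delta> \<gamma>] insert.hyps(2) that by blast
  have "\<forall>i\<in>J \<delta>. F1 i = F i"
    using off rdzs_frame[OF F1(1)] by blast
  then have "bpend (J \<delta>) F1 c'" using insert.prems(1)[of \<delta>] by (auto intro: bpend_cong)
  then obtain F2 g2 where F2: "rdzs (J \<delta>) F1 F2" "bst (J \<delta>) F2 g2" "pend (J \<delta>) g2 c'"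
    using bpend_split by blast
  have "\<exists>g. bst (J \<gamma>) F2 g \<and> pend (J \<gamma>) g c'" if \<gamma>: "\<gamma> \<in> D" for \<gamma>
  proof -
    obtain g where g: "bst (J \<gamma>) F1 g" "pend (J \<gamma>) g c'" using F1(2) \<gamma> by blast
    have "\<forall>i\<in>J \<gamma>. F2 i = F1 i" using off[OF \<gamma>] rdzs_frame[OF F2(1)] by blast
    then obtain G where "bst (J \<gamma>) F2 G" "\<forall>i\<in>J \<gamma>. G i = g i" using bst_cong[OF g(1)] by blast
    then show ?thesis using pend_cong[OF g(2)] by blast
  qed
  moreover have "rdzs (\<Union>\<gamma>\<in>insert \<delta> D. J \<gamma>) F F2"
    using rdzs_trans[OF rdzs_mono[OF F1(1)] rdzs_mono[OF F2(1)]] by auto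
  ultimately show ?case using F2(2,3) by blast
qed

text \<open>The station group goes to rest at \<open>c\<close>, where its broadcast starts; all
  others, used up or not, are led up to their broadcasts. The common broadcast puts every group on
  its way to \<open>c'\<close>, so none is used up afterwards and the bound restarts at 0.\<close>

lemma ready_broadcast_step:
  assumes \<Gamma>: "finite \<Gamma>" "\<And>\<gamma>. \<gamma> \<in> \<Gamma> \<Longrightarrow> J \<gamma> \<subseteq> I"
    and disj: "\<And>\<gamma> \<delta>. \<gamma> \<in> \<Gamma> \<Longrightarrow> \<delta> \<in> \<Gamma> \<Longrightarrow> \<gamma> \<noteq> \<delta> \<Longrightarrow> J \<gamma> \<inter> J \<delta> = {}"
    and ready: "ready I \<Gamma> J c c' u (fst e) C" and u: "u \<le> b"
    and bc: "fst (snd e) = Bcast" and next_rest: "\<And>\<gamma>. \<gamma> \<in> \<Gamma> \<Longrightarrow> bpend (J \<gamma>) c c'"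
    and st: "\<Gamma>' \<subseteq> \<Gamma>" "card \<Gamma>' \<ge> b + 2" "\<And>\<gamma>. \<gamma> \<in> \<Gamma>' \<Longrightarrow> bc_station (J \<gamma>) c c' e"
  shows "\<exists>C1 C2. (quiet I)\<^sup>*\<^sup>* C C1 \<and> acts I C1 e C2 \<and> ready I \<Gamma> J c' c'' 0 (snd (snd e)) C2"
proof -
  obtain F r where C: "C = (F, r)" by fastforce
  obtain s t where e: "e = (s, Bcast, t)" using bc by (cases e) auto
  obtain U where r: "r \<in> I" and FI: "\<forall>i\<in>I. F i \<in> states Q" and Fr: "F r = s"
    and U: "U \<subseteq> \<Gamma>" "card U \<le> u" "\<forall>\<gamma>\<in>\<Gamma> - U. pend (J \<gamma>) F c" "\<forall>\<gamma>\<in>U. bpend (J \<gamma>) F c'"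
    using ready unfolding ready_def C e by auto
  have "card U \<le> b" using U(2) u by simp
  obtain \<gamma> where \<gamma>: "\<gamma> \<in> \<Gamma>' - U" "r \<notin> J \<gamma>"
    using free_station[OF \<Gamma>(1) st(1,2) \<open>card U \<le> b\<close> U(1), of J r] disj by blast
  then have \<gamma>\<Gamma>: "\<gamma> \<in> \<Gamma>" "\<gamma> \<in> \<Gamma> - U" using st(1) by auto
  obtain F1 where F1: "(quiet I)\<^sup>*\<^sup>* (F, r) (F1, r)" "\<forall>i\<in>J \<gamma>. F1 i = c i"
    "\<forall>i. i \<notin> J \<gamma> \<longrightarrow> F1 i = F i" "\<forall>i. F i \<in> states Q \<longrightarrow> F1 i \<in> states Q"
    using pend_rest[OF bspec[OF U(3) \<gamma>\<Gamma>(2)] \<Gamma>(2)[OF \<gamma>\<Gamma>(1)], of r] r \<gamma>(2) by blast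
  obtain j g where j: "j \<in> J \<gamma>" "c j = s" and g: "bst (J \<gamma>) c g" "g j = t" "pend (J \<gamma>) g c'"
    using st(3)[of \<gamma>] \<gamma>(1) unfolding bc_station_def e by auto
  let ?D = "\<Gamma> - {\<gamma>}"
  have "bpend (J \<delta>) F1 c'" if \<delta>: "\<delta> \<in> ?D" for \<delta>
  proof -
    have "bpend (J \<delta>) F c'"
      using U(3,4) \<delta> pend_bpend next_rest by blast
    moreover have "\<forall>i\<in>J \<delta>. F1 i = F i" using disj[of \<delta> \<gamma>] \<delta> \<gamma>\<Gamma>(1) F1(3) by blast
    ultimately show ?thesis using bpend_cong by blast
  qed
  then obtain F2 where F2: "rdzs (\<Union>\<gamma>\<in>?D. J \<gamma>) F1 F2"
    "\<forall>\<delta>\<in>?D. \<exists>g. bst (J \<delta>) F2 g \<and> pend (J \<delta>) g c'"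
    using all_broadcast[of ?D J F1 c'] \<Gamma>(1) disj by auto
  have j_off: "i \<notin> (\<Union>\<gamma>\<in>?D. J \<gamma>)" if "i \<in> J \<gamma>" for i
    using that disj \<gamma>\<Gamma>(1) by blast
  then have F2\<gamma>: "\<forall>i\<in>J \<gamma>. F2 i = c i" using rdzs_frame[OF F2(1)] F1(2) by simp
  obtain g' where g': "bst (J \<gamma>) F2 g'" "\<forall>i\<in>J \<gamma>. g' i = g i" using bst_cong[OF g(1) F2\<gamma>] by blast
  have "\<forall>\<delta>\<in>\<Gamma>. \<exists>h. bst (J \<delta>) F2 h \<and> pend (J \<delta>) h c' \<and> (\<delta> = \<gamma> \<longrightarrow> h j = t)"
  proof
    fix \<delta> assume \<delta>: "\<delta> \<in> \<Gamma>"
    show "\<exists>h. bst (J \<delta>) F2 h \<and> pend (J \<delta>) h c' \<and> (\<delta> = \<gamma> \<longrightarrow> h j = t)"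
    proof (cases "\<delta> = \<gamma>")
      case True
      moreover have "g' j = t" using g'(2) g(2) j(1) by simp
      ultimately show ?thesis using g'(1) pend_cong[OF g(3) g'(2)] by metis
    next
      case False
      then show ?thesis using F2(2) \<delta> by auto
    qed
  qed
  then obtain H where H: "\<And>\<delta>. \<delta> \<in> \<Gamma> \<Longrightarrow> bst (J \<delta>) F2 (H \<delta>)"
    "\<And>\<delta>. \<delta> \<in> \<Gamma> \<Longrightarrow> pend (J \<delta>) (H \<delta>) c'" "H \<gamma> j = t"
    using \<gamma>\<Gamma>(1) by metis
  have F2I: "\<forall>i\<in>I. F2 i \<in> states Q" using FI F1(4) rdzs_states[OF F2(1)] by blast
  \<comment> \<open>The global broadcast is glued from those of the disjoint groups; processes
    outside all groups take any broadcast edge.\<close>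
  have "\<exists>x. (i \<in> I \<longrightarrow> (F2 i, Bcast, x) \<in> edges Q) \<and> (i \<notin> I \<longrightarrow> x = F2 i) \<and>
      (\<forall>\<delta>\<in>\<Gamma>. i \<in> J \<delta> \<longrightarrow> x = H \<delta> i)" for i
  proof (cases "\<exists>\<delta>\<in>\<Gamma>. i \<in> J \<delta>")
    case True
    then obtain \<delta> where \<delta>: "\<delta> \<in> \<Gamma>" "i \<in> J \<delta>" by blast
    then have "\<delta>' = \<delta>" if "\<delta>' \<in> \<Gamma>" "i \<in> J \<delta>'" for \<delta>' using that disj by blast
    moreover have "(F2 i, Bcast, H \<delta> i) \<in> edges Q" using H(1)[OF \<delta>(1)] \<delta>(2) by (simp add: bst_def)
    ultimately show ?thesis using \<delta> \<Gamma>(2) by (intro exI[of _ "H \<delta> i"]) blast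
  next
    case False
    then show ?thesis using F2I broadcast_total by (cases "i \<in> I") blast+
  qed
  then obtain G where G: "\<And>i. i \<in> I \<Longrightarrow> (F2 i, Bcast, G i) \<in> edges Q" "\<And>i. i \<notin> I \<Longrightarrow> G i = F2 i"
    "\<And>i \<delta>. \<delta> \<in> \<Gamma> \<Longrightarrow> i \<in> J \<delta> \<Longrightarrow> G i = H \<delta> i"
    by metis
  have jI: "j \<in> I" using j(1) \<Gamma>(2)[OF \<gamma>\<Gamma>(1)] by blast
  have Gj: "G j = t" using G(3)[OF \<gamma>\<Gamma>(1) j(1)] H(3) by simp
  have "bst I F2 G" using G(1,2) by (simp add: bst_def)
  then have "acts I (F2, j) e (G, j)"
    unfolding acts_def e using jI Gj F2\<gamma> j by simp
  \<comment> \<open>The old role \<open>r\<close> may lie in a group that has to move on the way to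
    \<open>F2\<close>, whereas \<open>j\<close> lies in the resting group. The exchange must
    therefore precede these steps.\<close>
  moreover have "(quiet I)\<^sup>*\<^sup>* (F1, j) (F2, j)"
    using rdzs_quiet[OF F2(1), of I j] \<Gamma>(2) jI j_off[OF j(1)] by blast
  moreover have "F1 r = F1 j" using F1(2,3) j \<gamma>(2) Fr by simp
  ultimately obtain C1 where "(quiet I)\<^sup>*\<^sup>* (F1, r) C1" "acts I C1 e (G, j)"
    using quiet_acts_swap by metis
  moreover have "ready I \<Gamma> J c' c'' 0 t (G, j)"
  proof -
    have "pend (J \<delta>) G c'" if "\<delta> \<in> \<Gamma>" for \<delta>
      using H(2)[OF that] G(3)[OF that] by (auto intro: pend_cong)
    moreover have "\<forall>i\<in>I. G i \<in> states Q" using G(1) edges_states by blast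
    ultimately have "G j = t \<and> (\<forall>i\<in>I. G i \<in> states Q) \<and> (\<forall>\<gamma>\<in>\<Gamma> - {}. pend (J \<gamma>) G c')"
      using Gj by blast
    then show ?thesis using jI unfolding ready_def by (simp, intro exI[of _ "{}"]) simp
  qed
  ultimately show ?thesis using rtranclp_trans[OF F1(1)] unfolding C e snd_conv by metis
qed

section \<open>Composition of finite runs\<close>

text \<open>\<open>N\<close> counts the broadcasts and \<open>es\<close> lists the edges taken by
  \<open>p\<close>.\<close>

inductive frun :: "'i set \<Rightarrow> 'i \<Rightarrow> nat \<Rightarrow> ('s, 'a) edge list \<Rightarrow> ('i \<Rightarrow> 's) \<Rightarrow> bool" for I p where
  base: "\<forall>i\<in>I. f i \<in> inits Q \<Longrightarrow> frun I p 0 [] f"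
| bcast: "frun I p N es f \<Longrightarrow> bst I f g \<Longrightarrow> frun I p (Suc N) (es @ [(f p, Bcast, g p)]) g"
| idle: "frun I p N es f \<Longrightarrow> rst I f m g \<Longrightarrow> m p = None \<Longrightarrow> frun I p N es g"
| move: "frun I p N es f \<Longrightarrow> rst I f m g \<Longrightarrow> m p = Some \<sigma> \<Longrightarrow>
    frun I p N (es @ [(f p, \<sigma>, g p)]) g"

lemma frun_states: "frun I p N es f \<Longrightarrow> i \<in> I \<Longrightarrow> f i \<in> states Q"
proof (induction rule: frun.induct)
  case (base f)
  then show ?case using inits_states by blast
next
  case (bcast N es f g)
  then show ?case using edges_states unfolding bst_def by blast
qed (use rst_states in metis)+

text \<open>Built from the front, so that a run can be consumed edge by edge, whereas
  \<open>frun\<close> grows at the end.\<close>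

fun fpath :: "'i set \<Rightarrow> ('i \<Rightarrow> 's) \<times> 'i \<Rightarrow> ('s, 'a) edge list \<Rightarrow> ('i \<Rightarrow> 's) \<times> 'i \<Rightarrow> bool" where
  "fpath I c [] c' = (quiet I)\<^sup>*\<^sup>* c c'"
| "fpath I c (e # es) c' = (\<exists>c1 c2. (quiet I)\<^sup>*\<^sup>* c c1 \<and> acts I c1 e c2 \<and> fpath I c2 es c')"

lemma fpath_quiet: "fpath I c es c' \<Longrightarrow> quiet I c' c'' \<Longrightarrow> fpath I c es c''"
proof (induction es arbitrary: c)
  case (Cons e es)
  then show ?case by (metis fpath.simps(2))
qed simp

lemma fpath_acts: "fpath I c es c' \<Longrightarrow> acts I c' e c'' \<Longrightarrow> fpath I c (es @ [e]) c''"
proof (induction es arbitrary: c)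
  case (Cons x es)
  then show ?case by (metis append_Cons fpath.simps(2))
next
  case Nil
  then show ?case unfolding append_Nil fpath.simps by blast
qed

lemma frun_fpath:
  assumes "frun I p N es f" "p \<in> I"
  shows "\<exists>f0. (\<forall>i\<in>I. f0 i \<in> inits Q) \<and> fpath I (f0, p) es (f, p)"
  using assms(1)
proof (induction rule: frun.induct)
  case (base f)
  then show ?case by (intro exI[of _ f]) simp
next
  case (bcast N es f g)
  then have "acts I (f, p) (f p, Bcast, g p) (g, p)" using assms(2) by (simp add: acts_def)
  then show ?case using bcast.IH fpath_acts by metis
next
  case (idle N es f m g)
  then have "quiet I (f, p) (g, p)" using assms(2) by (auto simp add: quiet_def)
  then show ?case using idle.IH fpath_quiet by metis
next
  case (move N es f m g \<sigma>)
  then have "acts I (f, p) (f p, \<sigma>, g p) (g, p)" using assms(2) by (auto simp add: acts_def)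
  then show ?case using move.IH fpath_acts by metis
qed

lemma rst_override_left:
  assumes "rst I f m g" "I \<inter> J = {}"
  shows "rst (I \<union> J) (override_on f f' J) m (override_on g f' J)"
proof -
  obtain a \<phi> where a: "a \<in> A" "\<phi> ` {1..k} \<subseteq> I"
    and mv: "\<And>h. h \<in> {1..k} \<Longrightarrow> m (\<phi> h) = Some (Rdz a h) \<and> (f (\<phi> h), Rdz a h, g (\<phi> h)) \<in> edges Q"
    and idle: "\<And>i. i \<notin> \<phi> ` {1..k} \<Longrightarrow> m i = None \<and> g i = f i"
    using assms(1) by (elim rstE) blast
  have "\<phi> h \<notin> J" if "h \<in> {1..k}" for h using a(2) assms(2) that by blast
  then show ?thesis unfolding rst_def using a mv idle
    by (intro bexI[of _ a] exI[of _ \<phi>]) (auto simp: override_on_def)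
qed

lemma rst_override_right:
  assumes "rst J f' m g'"
  shows "rst (I \<union> J) (override_on f f' J) m (override_on f g' J)"
proof -
  obtain a \<phi> where a: "a \<in> A" "\<phi> ` {1..k} \<subseteq> J"
    and mv: "\<And>h. h \<in> {1..k} \<Longrightarrow> m (\<phi> h) = Some (Rdz a h) \<and> (f' (\<phi> h), Rdz a h, g' (\<phi> h)) \<in> edges Q"
    and idle: "\<And>i. i \<notin> \<phi> ` {1..k} \<Longrightarrow> m i = None \<and> g' i = f' i"
    using assms(1) by (elim rstE) blast
  have "\<phi> h \<in> J" if "h \<in> {1..k}" for h using a(2) that by blast
  then show ?thesis unfolding rst_def using a mv idle
    by (intro bexI[of _ a] exI[of _ \<phi>]) (auto simp: override_on_def)
qed

lemma bst_override:
  assumes "bst I f g" "bst J f' g'" "I \<inter> J = {}"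
  shows "bst (I \<union> J) (override_on f f' J) (override_on g g' J)"
  using assms unfolding bst_def by (auto simp: override_on_def)

lemma frun_extend_right:
  assumes "frun (I \<union> J) p N es (override_on f f' J)" "rst J f' m g'" "p \<notin> J"
  shows "frun (I \<union> J) p N es (override_on f g' J)"
  using frun.idle[OF assms(1) rst_override_right[OF assms(2)]] rst_frame[OF assms(2,3)] by simp

text \<open>Rendezvous of the two runs interleave freely and only broadcasts have to meet. Whenever
  the first run ends in a broadcast, the inner induction peels trailing rendezvous off the second
  until its last broadcast is exposed.\<close>

lemma frun_compose:
  assumes "frun I p N es f" "frun J q N es' f'" "I \<inter> J = {}" "p \<in> I"
  shows "frun (I \<union> J) p N es (override_on f f' J)"
  using assms(1,2)
proof (induction arbitrary: es' f' rule: frun.induct)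
  case (base f)
  have p: "p \<notin> J" using assms(3,4) by blast
  from base(2) show ?case
  proof (induction "0::nat" es' f' rule: frun.induct)
    case (base f')
    have "\<forall>i\<in>I \<union> J. override_on f f' J i \<in> inits Q"
      using base \<open>\<forall>i\<in>I. f i \<in> inits Q\<close> by (auto simp: override_on_def)
    then show ?case by (rule frun.base)
  next
    case (idle es' f' m g')
    show ?case by (rule frun_extend_right[OF idle.hyps(2) idle.hyps(3) p])
  next
    case (move es' f' m g' \<sigma>)
    show ?case by (rule frun_extend_right[OF move.hyps(2) move.hyps(3) p])
  qed
next
  case (bcast N es f g)
  have p: "p \<notin> J" using assms(3,4) by blast
  note left = bcast.IH bcast.hyps(2)
  from bcast.prems show ?case
  proof (induction "Suc N" es' f' rule: frun.induct)
    case (bcast es' f' g')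
    from frun.bcast[OF left(1)[OF bcast.hyps(1)] bst_override[OF left(2) bcast.hyps(3) assms(3)]]
    show ?case using p by simp
  next
    case (idle es' f' m g')
    show ?case by (rule frun_extend_right[OF idle.hyps(2) idle.hyps(3) p])
  next
    case (move es' f' m g' \<sigma>)
    show ?case by (rule frun_extend_right[OF move.hyps(2) move.hyps(3) p])
  qed
next
  case (idle N es f m g)
  show ?case
    by (rule frun.idle[OF idle.IH[OF idle.prems] rst_override_left[OF idle.hyps(2) assms(3)] idle.hyps(3)])
next
  case (move N es f m g \<sigma>)
  have "p \<notin> J" using assms(3,4) by blast
  then show ?case
    using frun.move[OF move.IH[OF move.prems] rst_override_left[OF move.hyps(2) assms(3)] move.hyps(3)]
    by simp
qed

text \<open>The set \<open>X\<close> of forbidden indices makes runs composable without renaming.\<close>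

definition reach :: "nat \<Rightarrow> 's \<Rightarrow> bool" where
  "reach N s \<longleftrightarrow> (\<forall>X :: nat set. finite X \<longrightarrow>
     (\<exists>I p es f. finite I \<and> I \<inter> X = {} \<and> p \<in> I \<and> frun I p N es f \<and> f p = s))"

lemma reachE:
  fixes X :: "nat set"
  assumes "reach N s" "finite X"
  obtains I p es f where "finite I" "I \<inter> X = {}" "p \<in> I" "frun I p N es f" "f p = s"
proof -
  have "\<exists>I p es f. finite I \<and> I \<inter> X = {} \<and> p \<in> I \<and> frun I p N es f \<and> f p = s"
    using assms unfolding reach_def by simp
  then show thesis by (elim exE conjE) (rule that)
qed

text \<open>A fresh run is merged in for each requested state. \<open>\<iota> \<rho>\<close> is its
  tracked process; the remaining processes of that run enter \<open>I'\<close> as well.\<close>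

lemma load:
  fixes I X :: "nat set" and st :: "'r \<Rightarrow> 's"
  assumes "finite R" "\<And>\<rho>. \<rho> \<in> R \<Longrightarrow> reach N (st \<rho>)"
    and "finite I" "p \<in> I" "frun I p N es f" "finite X" "I \<inter> X = {}"
  shows "\<exists>I' F \<iota>. finite I' \<and> I \<subseteq> I' \<and> I' \<inter> X = {} \<and> frun I' p N es F \<and> (\<forall>i\<in>I. F i = f i) \<and>
    inj_on \<iota> R \<and> \<iota> ` R \<subseteq> I' - I \<and> (\<forall>\<rho>\<in>R. F (\<iota> \<rho>) = st \<rho>)"
  using assms(1,2)
proof (induction R rule: finite_induct)
  case empty
  then show ?case using assms(3-) by (intro exI[of _ I] exI[of _ f]) auto
next
  case (insert x R)
  obtain I' F \<iota> where IH: "finite I'" "I \<subseteq> I'" "I' \<inter> X = {}" "frun I' p N es F" "\<forall>i\<in>I. F i = f i"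
    "inj_on \<iota> R" "\<iota> ` R \<subseteq> I' - I" "\<forall>\<rho>\<in>R. F (\<iota> \<rho>) = st \<rho>"
    using insert.IH insert.prems by auto
  have "finite (X \<union> I')" using assms(6) IH(1) by simp
  then obtain K q es' g where K: "finite K" "K \<inter> (X \<union> I') = {}" "q \<in> K" "frun K q N es' g" "g q = st x"
    by (rule reachE[OF insert.prems(1)[OF insertI1]])
  let ?F = "override_on F g K" and ?\<iota> = "\<iota>(x := q)"
  have KI: "I' \<inter> K = {}" and "p \<in> I'" using K(2) IH(2) assms(4) by auto
  then have "frun (I' \<union> K) p N es ?F" using frun_compose[OF IH(4) K(4)] by blast
  moreover have "finite (I' \<union> K)" "I \<subseteq> I' \<union> K" "(I' \<union> K) \<inter> X = {}" using IH K by auto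
  moreover have "\<forall>i\<in>I. ?F i = f i" using IH(2,5) KI by (auto simp: override_on_def)
  moreover have \<iota>: "?\<iota> \<rho> = \<iota> \<rho> \<and> \<iota> \<rho> \<in> I' - I" if "\<rho> \<in> R" for \<rho>
    using that insert.hyps(2) IH(7) by auto
  moreover have "inj_on ?\<iota> (insert x R)"
  proof -
    have "inj_on ?\<iota> R \<longleftrightarrow> inj_on \<iota> R" using \<iota> by (intro inj_on_cong) blast
    moreover have "q \<notin> \<iota> ` R" using \<iota> K(3) KI by blast
    moreover have "?\<iota> ` R = \<iota> ` R" using \<iota> by (intro image_cong) blast+
    moreover have "R - {x} = R" using insert.hyps(2) by blast
    ultimately show ?thesis using IH(6) by simp
  qed
  moreover have "?\<iota> ` insert x R \<subseteq> I' \<union> K - I"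
  proof -
    have "?\<iota> x \<in> I' \<union> K - I" using K(3) KI IH(2) by auto
    moreover have "?\<iota> \<rho> \<in> I' \<union> K - I" if "\<rho> \<in> R" for \<rho> using \<iota>[OF that] by auto
    ultimately show ?thesis by blast
  qed
  moreover have "\<forall>\<rho>\<in>insert x R. ?F (?\<iota> \<rho>) = st \<rho>"
  proof
    fix \<rho> assume "\<rho> \<in> insert x R"
    then consider "\<rho> = x" | "\<rho> \<in> R" by blast
    then show "?F (?\<iota> \<rho>) = st \<rho>"
    proof cases
      case 2
      then have "\<iota> \<rho> \<notin> K" "?\<iota> \<rho> = \<iota> \<rho>" using \<iota>[OF 2] KI by auto
      then show ?thesis using IH(8) 2 by simp
    qed (use K in simp)
  qed
  ultimately show ?case by blast
qed

text \<open>\<open>load\<close> recruits a fresh process for each symbol other than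
  \<open>h\<close>, and \<open>p\<close> itself plays \<open>h\<close>.\<close>

lemma frun_snoc_rdz:
  fixes I X :: "nat set"
  assumes I: "finite I" "p \<in> I" "frun I p N es f" "finite X" "I \<inter> X = {}"
    and e: "(f p, Rdz a h, t) \<in> edges Q" "a \<in> A" "h \<in> {1..k}"
    and partners: "\<forall>l\<in>{1..k} - {h}. \<exists>s' t'. (s', Rdz a l, t') \<in> edges Q \<and> reach N s'"
  shows "\<exists>I' g. finite I' \<and> p \<in> I' \<and> I' \<inter> X = {} \<and> frun I' p N (es @ [(f p, Rdz a h, t)]) g \<and> g p = t"
proof -
  obtain S T where ST: "\<And>l. l \<in> {1..k} - {h} \<Longrightarrow> (S l, Rdz a l, T l) \<in> edges Q \<and> reach N (S l)"
    using partners by metis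
  have "finite ({1..k} - {h})" by simp
  from load[OF this, of N S I p es f X] ST I
  obtain I' F \<iota> where L: "finite I'" "I \<subseteq> I'" "I' \<inter> X = {}" "frun I' p N es F" "\<forall>i\<in>I. F i = f i"
    "inj_on \<iota> ({1..k} - {h})" "\<iota> ` ({1..k} - {h}) \<subseteq> I' - I" "\<forall>l\<in>{1..k} - {h}. F (\<iota> l) = S l"
    by auto
  define \<phi> where "\<phi> = \<iota>(h := p)"
  have \<phi>l: "\<phi> l = \<iota> l \<and> \<iota> l \<in> I' - I" if "l \<in> {1..k} - {h}" for l
  proof -
    have "\<iota> l \<in> I' - I" using that L(7) by blast
    then show ?thesis using that by (simp add: \<phi>_def)
  qed
  have \<phi>h: "\<phi> h = p" by (simp add: \<phi>_def)
  have inj: "inj_on \<phi> {1..k}"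
  proof (rule inj_onI)
    fix x y assume xy: "x \<in> {1..k}" "y \<in> {1..k}" "\<phi> x = \<phi> y"
    show "x = y"
    proof (cases "x = h \<or> y = h")
      case True
      have ne: "\<phi> l \<noteq> \<phi> h" if "l \<in> {1..k}" "l \<noteq> h" for l
        using \<phi>l[of l] that I(2) unfolding \<phi>h by auto
      from True show ?thesis
      proof
        assume "x = h"
        then show ?thesis using ne[of y] xy by argo
      next
        assume "y = h"
        then show ?thesis using ne[of x] xy by argo
      qed
    next
      case False
      then have m: "x \<in> {1..k} - {h}" "y \<in> {1..k} - {h}" using xy(1,2) by blast+
      then have "\<iota> x = \<iota> y" using xy(3) \<phi>l[OF m(1)] \<phi>l[OF m(2)] by argo
      from inj_onD[OF L(6) this m] show ?thesis .
    qed
  qed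
  define v where "v = inv_into {1..k} \<phi>"
  have v: "v (\<phi> l) = l" if "l \<in> {1..k}" for l using inj that by (simp add: v_def)
  define m where "m i = (if i \<in> \<phi> ` {1..k} then Some (Rdz a (v i)) else None)" for i
  define g where "g i = (if i \<in> \<phi> ` {1..k} then (if i = p then t else T (v i)) else F i)" for i
  have "rst I' F m g"
    unfolding rst_def
  proof (intro bexI[of _ a] exI[of _ \<phi>] conjI ballI allI impI)
    show "\<phi> ` {1..k} \<subseteq> I'"
    proof
      fix x assume "x \<in> \<phi> ` {1..k}"
      then obtain l where "l \<in> {1..k}" "x = \<phi> l" by blast
      then show "x \<in> I'" using \<phi>h \<phi>l[of l] L(2) I(2) by (cases "l = h") auto
    qed
    fix l assume l: "l \<in> {1..k}"
    then show "m (\<phi> l) = Some (Rdz a l)" using v[OF l] by (simp add: m_def)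
    show "(F (\<phi> l), Rdz a l, g (\<phi> l)) \<in> edges Q"
    proof (cases "l = h")
      case True
      have "g p = t" using e(3) \<phi>h unfolding g_def by (metis image_eqI)
      then show ?thesis using e(1) \<phi>h L(5) I(2) True by simp
    next
      case False
      then have "\<phi> l \<noteq> p" "F (\<phi> l) = S l" using \<phi>l[of l] l I(2) L(8) by auto
      then show ?thesis using ST[of l] l False v[OF l] by (simp add: g_def)
    qed
  qed (simp_all add: m_def g_def e)
  moreover have "p \<in> \<phi> ` {1..k}" using \<phi>h e(3) by blast
  then have "m p = Some (Rdz a h)" "g p = t" using v[OF e(3)] \<phi>h by (simp_all add: m_def g_def)
  moreover have "F p = f p" using L(5) I(2) by blast
  ultimately have "frun I' p N (es @ [(f p, Rdz a h, t)]) g" using frun.move[OF L(4)] by metis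
  then show ?thesis using L(1-3) I(2) \<open>g p = t\<close> by blast
qed

lemma frun_snoc_bcast:
  assumes "p \<in> I" "frun I p N es f" "(f p, Bcast, t) \<in> edges Q"
  shows "\<exists>g. frun I p (Suc N) (es @ [(f p, Bcast, t)]) g \<and> g p = t"
proof -
  have "\<exists>x. (i \<in> I \<longrightarrow> (f i, Bcast, x) \<in> edges Q) \<and> (i \<notin> I \<longrightarrow> x = f i) \<and> (i = p \<longrightarrow> x = t)" for i
    using broadcast_total frun_states[OF assms(2)] assms(1,3) by blast
  then obtain g where g: "\<And>i. i \<in> I \<Longrightarrow> (f i, Bcast, g i) \<in> edges Q" "\<And>i. i \<notin> I \<Longrightarrow> g i = f i" "g p = t"
    by metis
  then have "bst I f g" by (simp add: bst_def)
  from frun.bcast[OF assms(2) this] g(3) show ?thesis by metis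
qed

lemma reach_init: assumes "s \<in> inits Q" shows "reach 0 s"
  unfolding reach_def
proof (intro allI impI)
  fix X :: "nat set" assume "finite X"
  then obtain p where "p \<notin> X" using ex_new_if_finite infinite_UNIV_nat by blast
  moreover have "frun {p} p 0 [] (\<lambda>_. s)" using assms by (intro frun.base) simp
  ultimately show "\<exists>I p es f. finite I \<and> I \<inter> X = {} \<and> p \<in> I \<and> frun I p 0 es f \<and> f p = s"
    by (intro exI[of _ "{p}"] exI[of _ p]) auto
qed

lemma reach_bcast: assumes "reach N s" "(s, Bcast, t) \<in> edges Q" shows "reach (Suc N) t"
  unfolding reach_def
proof (intro allI impI)
  fix X :: "nat set" assume "finite X"
  from assms(1) this obtain I p es f where I: "finite I" "I \<inter> X = {}" "p \<in> I" "frun I p N es f" "f p = s"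
    by (rule reachE)
  then show "\<exists>I p es f. finite I \<and> I \<inter> X = {} \<and> p \<in> I \<and> frun I p (Suc N) es f \<and> f p = t"
    using frun_snoc_bcast[OF I(3,4), of t] assms(2) by metis
qed

lemma reach_rdz:
  assumes "reach N s" "(s, Rdz a h, t) \<in> edges Q" "a \<in> A" "h \<in> {1..k}"
    and "\<forall>l\<in>{1..k} - {h}. \<exists>s' t'. (s', Rdz a l, t') \<in> edges Q \<and> reach N s'"
  shows "reach N t"
  unfolding reach_def
proof (intro allI impI)
  fix X :: "nat set" assume X: "finite X"
  from assms(1) this obtain I p es f where I: "finite I" "I \<inter> X = {}" "p \<in> I" "frun I p N es f" "f p = s"
    by (rule reachE)
  show "\<exists>I p es f. finite I \<and> I \<inter> X = {} \<and> p \<in> I \<and> frun I p N es f \<and> f p = t"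
    using frun_snoc_rdz[OF I(1,3,4) X I(2), of a h t] assms I(5) by metis
qed

section \<open>Executions from a supply of groups\<close>

text \<open>The first \<open>M\<close> edges are taken while the groups are being loaded, the later
  ones by way of stations. \<open>T m\<close> indexes the current rest configuration and
  \<open>u m\<close> bounds the number of groups used up.\<close>

lemma exec_inf_of_stations:
  assumes I: "finite I" "p \<in> I" "frun I p N (map es [0..<M]) F" "F p = fst (es M)"
    and chain: "\<And>m. fst (es (Suc m)) = snd (snd (es m))"
    and \<Gamma>: "finite \<Gamma>" "\<And>\<gamma>. \<gamma> \<in> \<Gamma> \<Longrightarrow> J \<gamma> \<subseteq> I"
    and disj: "\<And>\<gamma> \<delta>. \<gamma> \<in> \<Gamma> \<Longrightarrow> \<delta> \<in> \<Gamma> \<Longrightarrow> \<gamma> \<noteq> \<delta> \<Longrightarrow> J \<gamma> \<inter> J \<delta> = {}"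
    and Fc: "\<And>\<gamma> i. \<gamma> \<in> \<Gamma> \<Longrightarrow> i \<in> J \<gamma> \<Longrightarrow> F i = c (T M) i"
    and T: "\<And>m. m \<ge> M \<Longrightarrow> T (Suc m) = (if fst (snd (es m)) = Bcast then Suc (T m) else T m)"
    and u: "\<And>m. m \<ge> M \<Longrightarrow> fst (snd (es m)) \<noteq> Bcast \<Longrightarrow>
      u (Suc m) = (if dark (es m) then Suc (u m) else u m)"
    and ub: "\<And>m. u m \<le> b"
    and rdz: "\<And>m. m \<ge> M \<Longrightarrow> fst (snd (es m)) \<noteq> Bcast \<Longrightarrow> \<exists>\<Gamma>'\<subseteq>\<Gamma>. card \<Gamma>' \<ge> b + 2 \<and>
      (\<forall>\<gamma>\<in>\<Gamma>'. rdz_station (J \<gamma>) (c (T m)) (c (Suc (T m))) (dark (es m)) (es m))"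
    and bc: "\<And>m. m \<ge> M \<Longrightarrow> fst (snd (es m)) = Bcast \<Longrightarrow> \<exists>\<Gamma>'\<subseteq>\<Gamma>. card \<Gamma>' \<ge> b + 2 \<and>
      (\<forall>\<gamma>\<in>\<Gamma>'. bc_station (J \<gamma>) (c (T m)) (c (Suc (T m))) (es m))"
    and rest: "\<And>m \<gamma>. m \<ge> M \<Longrightarrow> fst (snd (es m)) = Bcast \<Longrightarrow> \<gamma> \<in> \<Gamma> \<Longrightarrow>
      bpend (J \<gamma>) (c (T m)) (c (Suc (T m)))"
  shows "(\<lambda>m. label Q (fst (es m))) \<in> exec_inf k A Q"
proof -
  define rdy where "rdy m = ready I \<Gamma> J (c (T m)) (c (Suc (T m))) (u m) (fst (es m))" for m
  \<comment> \<open>Before \<open>M\<close> the invariant holds the remainder of the loading run;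
    afterwards it is readiness up to silent steps, because the loading run may end in some.\<close>
  define W where "W m C = (if m < M then fpath I C (map es [m..<M]) (F, p)
    else \<exists>C'. (quiet I)\<^sup>*\<^sup>* C C' \<and> rdy m C')" for m C
  have "pend (J \<gamma>) F (c (T M))" if "\<gamma> \<in> \<Gamma>" for \<gamma>
    unfolding pend_def using rdzs_refl Fc[OF that] by blast
  moreover have "\<forall>i\<in>I. F i \<in> states Q" using frun_states[OF I(3)] by blast
  ultimately have rM: "rdy M (F, p)"
    using I(2,4) unfolding rdy_def ready_def by (simp, intro exI[of _ "{}"]) simp
  have WM: "W m C" if "fpath I C (map es [m..<M]) (F, p)" "m \<le> M" for m C
    using that rM by (cases "m < M") (auto simp: W_def)
  have go: "\<exists>C1 C2. (quiet I)\<^sup>*\<^sup>* C C1 \<and> acts I C1 (es m) C2 \<and> rdy (Suc m) C2"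
    if C: "rdy m C" and m: "m \<ge> M" for m C
  proof (cases "fst (snd (es m)) = Bcast")
    case True
    obtain \<Gamma>' where \<Gamma>': "\<Gamma>' \<subseteq> \<Gamma>" "card \<Gamma>' \<ge> b + 2"
      "\<And>\<gamma>. \<gamma> \<in> \<Gamma>' \<Longrightarrow> bc_station (J \<gamma>) (c (T m)) (c (Suc (T m))) (es m)"
      using bc[OF m True] by blast
    \<comment> \<open>A broadcast leaves the bound 0, which is weakened to the value that
      \<open>u\<close> takes next.\<close>
    have up: "ready I \<Gamma> J x y 0 s C2 \<Longrightarrow> ready I \<Gamma> J x y (u (Suc m)) s C2" for x y s C2
      unfolding ready_def by fastforce
    show ?thesis
      using ready_broadcast_step[where c'' = "c (Suc (Suc (T m)))", OF \<Gamma> disj C[unfolded rdy_def] ub True rest[OF m True] \<Gamma>']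
        T[OF m] True up unfolding rdy_def chain by fastforce
  next
    case False
    obtain \<Gamma>' where \<Gamma>': "\<Gamma>' \<subseteq> \<Gamma>" "card \<Gamma>' \<ge> b + 2"
      "\<And>\<gamma>. \<gamma> \<in> \<Gamma>' \<Longrightarrow> rdz_station (J \<gamma>) (c (T m)) (c (Suc (T m))) (dark (es m)) (es m)"
      using rdz[OF m False] by blast
    show ?thesis
      using ready_rdz_step[OF \<Gamma> disj C[unfolded rdy_def] ub \<Gamma>'] T[OF m] u[OF m False] False
      unfolding rdy_def chain by simp
  qed
  have step: "\<exists>C1 C2. (quiet I)\<^sup>*\<^sup>* C C1 \<and> acts I C1 (es m) C2 \<and> W (Suc m) C2" if W: "W m C" for m C
  proof (cases "m < M")
    case True
    then have "[m..<M] = m # [Suc m..<M]" by (rule upt_conv_Cons)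
    then have "fpath I C (es m # map es [Suc m..<M]) (F, p)" using W True unfolding W_def by simp
    then obtain C1 C2 where "(quiet I)\<^sup>*\<^sup>* C C1" "acts I C1 (es m) C2" "fpath I C2 (map es [Suc m..<M]) (F, p)"
      by auto
    moreover from this(3) have "W (Suc m) C2" using WM True by simp
    ultimately show ?thesis by blast
  next
    case False
    then obtain C' where "(quiet I)\<^sup>*\<^sup>* C C'" "rdy m C'" using W unfolding W_def by auto
    moreover obtain C1 C2 where "(quiet I)\<^sup>*\<^sup>* C' C1" "acts I C1 (es m) C2" "rdy (Suc m) C2"
      using go[OF \<open>rdy m C'\<close>] False by auto
    ultimately show ?thesis using False unfolding W_def by (meson less_SucI not_less_eq rtranclp.rtrancl_refl rtranclp_trans)
  qed
  obtain f0 where f0: "\<forall>i\<in>I. f0 i \<in> inits Q" "fpath I (f0, p) (map es [0..<M]) (F, p)"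
    using frun_fpath[OF I(3,2)] by blast
  show ?thesis by (rule exec_infI[OF I(1,2) f0(1) WM[OF f0(2)] step]) simp
qed

section \<open>Cycles in infinite runs\<close>

text \<open>Converse of \<open>rst_sys_trans\<close> and \<open>bst_sys_trans\<close>.
  Configurations are extensional, so source and target agree outside \<open>{1..n}\<close>, as
  \<open>rst\<close> and \<open>bst\<close> demand.\<close>

lemma sys_trans_steps:
  assumes "\<tau> \<in> sys_trans k A Q n"
  obtains (bcast) "is_broadcast \<tau>" "bst {1..n} (fst \<tau>) (snd (snd \<tau>))"
      "\<And>i e. takes n \<tau> i e \<longleftrightarrow> i \<in> {1..n} \<and> e = (fst \<tau> i, Bcast, snd (snd \<tau>) i)"
  | (rdz) m where "\<not> is_broadcast \<tau>" "rst {1..n} (fst \<tau>) m (snd (snd \<tau>))"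
      "\<And>i e. takes n \<tau> i e \<longleftrightarrow> (\<exists>\<sigma>. m i = Some \<sigma> \<and> e = (fst \<tau> i, \<sigma>, snd (snd \<tau>) i))"
  using assms
proof (cases rule: sys_transE)
  case (broadcast f g)
  then have "g i = f i" if "i \<notin> {1..n}" for i
    using that unfolding configs_def by (metis PiE_arb)
  then show ?thesis using broadcast by (intro bcast) (auto simp: bst_def)
next
  case (rendezvous f g a ps)
  define \<phi> where "\<phi> h = ps ! (h - 1)" for h
  have \<phi>: "\<phi> ` {1..k} = set ps"
  proof
    show "\<phi> ` {1..k} \<subseteq> set ps" using rendezvous(5) by (auto simp: \<phi>_def)
    show "set ps \<subseteq> \<phi> ` {1..k}"
    proof
      fix x assume "x \<in> set ps"
      then obtain j where "j < k" "x = ps ! j" using rendezvous(5) by (metis in_set_conv_nth)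
      then show "x \<in> \<phi> ` {1..k}" by (intro image_eqI[of _ _ "Suc j"]) (auto simp: \<phi>_def)
    qed
  qed
  define m where "m i = (if i \<in> set ps then Some (Rdz a (Suc (THE j. j < k \<and> ps ! j = i))) else None)" for i
  have m: "m (ps ! j) = Some (Rdz a (Suc j))" if "j < k" for j
  proof -
    have "(THE j'. j' < k \<and> ps ! j' = ps ! j) = j"
      using that rendezvous(5,6) by (intro the_equality) (auto simp: nth_eq_iff_index_eq)
    then show ?thesis using that rendezvous(5) by (simp add: m_def)
  qed
  have "rst {1..n} f m g"
    unfolding rst_def
  proof (intro bexI[of _ a] exI[of _ \<phi>] conjI ballI allI impI)
    show "\<phi> ` {1..k} \<subseteq> {1..n}" using \<phi> rendezvous(7) by simp
    fix h assume "h \<in> {1..k}"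
    then obtain j where j: "h = Suc j" "j < k" by (cases h) auto
    then show "m (\<phi> h) = Some (Rdz a h)" using m[OF j(2)] by (simp add: \<phi>_def)
    show "(f (\<phi> h), Rdz a h, g (\<phi> h)) \<in> edges Q"
      using rendezvous(8) j by (simp add: \<phi>_def)
  next
    fix i assume i: "i \<notin> \<phi> ` {1..k}"
    then show "m i = None" unfolding \<phi> by (simp add: m_def)
    show "g i = f i"
    proof (cases "i \<in> {1..n}")
      case True
      then show ?thesis using i rendezvous(9) unfolding \<phi> by blast
    next
      case False
      then show ?thesis using rendezvous(2,3) unfolding configs_def by (metis PiE_arb)
    qed
  qed (rule rendezvous(4))
  moreover have "takes n \<tau> i e \<longleftrightarrow> (\<exists>\<sigma>. m i = Some \<sigma> \<and> e = (f i, \<sigma>, g i))" for i e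
  proof (cases "i \<in> set ps")
    case True
    then obtain j where j: "j < k" "ps ! j = i" using rendezvous(5) by (metis in_set_conv_nth)
    then have "\<forall>j'<k. ps ! j' = i \<longleftrightarrow> j' = j"
      using rendezvous(5,6) by (metis nth_eq_iff_index_eq)
    then show ?thesis using m[OF j(1)] j rendezvous(1,5) by auto
  next
    case False
    then show ?thesis using rendezvous(1,5) by (auto simp: m_def)
  qed
  ultimately show ?thesis using rendezvous(1) by (intro rdz[of m]) auto
qed

text \<open>Keeps of a run only what is needed later to place all processes in one
  component.\<close>

definition visited :: "nat \<Rightarrow> 's config \<Rightarrow> bool" where
  "visited n f \<longleftrightarrow> (\<exists>\<rho> p. inf_run k A Q n \<rho> \<and> fst (\<rho> p) = f)"

text \<open>A positive power of \<open>brd\<close> absorbs the rendezvous around its broadcasts, but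
  the power 0 is the identity and would allow none.\<close>

definition brds :: "'i set \<Rightarrow> nat \<Rightarrow> ('i \<Rightarrow> 's) \<Rightarrow> ('i \<Rightarrow> 's) \<Rightarrow> bool" where
  "brds J B f g \<longleftrightarrow> (if B = 0 then rdzs J f g else (brd J ^^ B) f g)"

lemma brds_rdzs: "brds J B f g \<Longrightarrow> rdzs J g h \<Longrightarrow> brds J B f h"
  unfolding brds_def by (cases B) (auto intro: rdzs_trans brd_rdzs)

lemma brds_bst: "brds J B f g \<Longrightarrow> bst J g h \<Longrightarrow> brds J (Suc B) f h"
  unfolding brds_def by (cases B) (auto intro: rdzs_brd bst_brd)

lemma run_segment:
  assumes "inf_run k A Q n \<rho>" "p \<le> p'"
  shows "\<exists>B. brds {1..n} B (fst (\<rho> p)) (fst (\<rho> p')) \<and> (B = 0 \<longleftrightarrow> (\<forall>j\<in>{p..<p'}. \<not> is_broadcast (\<rho> j)))"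
  using assms(2)
proof (induction rule: dec_induct)
  case base
  then show ?case using rdzs_refl unfolding brds_def by (intro exI[of _ 0]) simp
next
  case (step q)
  then obtain B where B: "brds {1..n} B (fst (\<rho> p)) (fst (\<rho> q))"
    "B = 0 \<longleftrightarrow> (\<forall>j\<in>{p..<q}. \<not> is_broadcast (\<rho> j))" by blast
  have set: "{p..<Suc q} = insert q {p..<q}" using step.hyps by auto
  have "\<rho> q \<in> sys_trans k A Q n" "snd (snd (\<rho> q)) = fst (\<rho> (Suc q))"
    using assms(1) by (auto simp: inf_run_def)
  then show ?case
  proof (cases rule: sys_trans_steps)
    case bcast
    then show ?thesis using brds_bst[OF B(1) bcast(2)] \<open>snd (snd (\<rho> q)) = _\<close> set
      by (intro exI[of _ "Suc B"]) auto
  next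
    case (rdz m)
    then show ?thesis using brds_rdzs[OF B(1) rst_rdzs[OF rdz(2)]] \<open>snd (snd (\<rho> q)) = _\<close> set B(2)
      by (intro exI[of _ B]) auto
  qed
qed

lemma recurring_config:
  assumes "inf_run k A Q n \<rho>" "infinite X"
  shows "\<exists>f. infinite {p \<in> X. fst (\<rho> p) = f}"
proof -
  have "fst (\<rho> p) \<in> configs Q n" for p
  proof -
    have "\<rho> p \<in> sys_trans k A Q n" using assms(1) by (simp add: inf_run_def)
    then show ?thesis by (cases rule: sys_transE) auto
  qed
  moreover have "finite (configs Q n)"
    unfolding configs_def using finite_states by (intro finite_PiE) auto
  ultimately have "finite ((\<lambda>p. fst (\<rho> p)) ` X)" by (meson finite_subset image_subsetI)
  from pigeonhole_infinite[OF assms(2) this] show ?thesis by auto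
qed

lemma rdz_stationI:
  assumes "rst J c m g" "j \<in> J" "m j = Some \<sigma>" "pend J g c \<or> d \<and> bpend J g c'"
  shows "rdz_station J c c' d (c j, \<sigma>, g j)"
  unfolding rdz_station_def prod.case using assms by metis

lemma bc_stationI:
  assumes "bst J c g" "j \<in> J" "pend J g c'"
  shows "bc_station J c c' (c j, Bcast, g j)"
  unfolding bc_station_def prod.case using assms by metis

text \<open>The run itself shows the way back: from the step at \<open>p\<close> it leads without
  broadcast to the same configuration at \<open>p'\<close>. So the group can return at once,
  whatever \<open>c\<close> and \<open>d\<close> are.\<close>

lemma local_station:
  assumes run: "inf_run k A Q n \<rho>" and p: "p < p'" "fst (\<rho> p) = fst (\<rho> p')"
    and loc: "\<forall>j\<in>{p..<p'}. \<not> is_broadcast (\<rho> j)" and e: "appears n e (\<rho> p)"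
  shows "rdz_station {1..n} (fst (\<rho> p)) c d e \<and> fst (snd e) \<noteq> Bcast"
proof -
  have \<rho>p: "\<rho> p \<in> sys_trans k A Q n" "snd (snd (\<rho> p)) = fst (\<rho> (Suc p))"
    using run by (auto simp: inf_run_def)
  have nb: "\<not> is_broadcast (\<rho> p)" using loc p(1) by simp
  obtain B where "brds {1..n} B (fst (\<rho> (Suc p))) (fst (\<rho> p'))"
    "B = 0 \<longleftrightarrow> (\<forall>j\<in>{Suc p..<p'}. \<not> is_broadcast (\<rho> j))"
    using run_segment[OF run, of "Suc p" p'] p(1) by auto
  then have ret: "rdzs {1..n} (fst (\<rho> (Suc p))) (fst (\<rho> p))"
    using loc p unfolding brds_def by auto
  obtain i where i: "i \<in> {1..n}" "takes n (\<rho> p) i e" using e by (auto simp: appears_def)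
  from \<rho>p(1) show ?thesis
  proof (cases rule: sys_trans_steps)
    case bcast
    then show ?thesis using nb by simp
  next
    case (rdz m)
    obtain \<sigma> where \<sigma>: "m i = Some \<sigma>" "e = (fst (\<rho> p) i, \<sigma>, snd (snd (\<rho> p)) i)"
      using i(2) rdz(3) by blast
    moreover have "pend {1..n} (snd (snd (\<rho> p))) (fst (\<rho> p))"
      using ret \<rho>p(2) unfolding pend_def by auto
    ultimately show ?thesis
      using rdz_stationI[OF rdz(2) i(1) \<sigma>(1)] rst_edge[OF rdz(2) \<sigma>(1)] by auto
  qed
qed

text \<open>Infinitely many occurrences of \<open>e\<close> lie after the last broadcast, so two of
  them share a configuration.\<close>

lemma locally_reusable_station:
  assumes "locally_reusable k A Q e"
  shows "\<exists>n f. visited n f \<and> (\<forall>c d. rdz_station {1..n} f c d e) \<and> fst (snd e) \<noteq> Bcast"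
proof -
  obtain n \<rho> where run: "inf_run k A Q n \<rho>" and fin: "finite {j. is_broadcast (\<rho> j)}"
    and inf: "infinite {j. appears n e (\<rho> j)}"
    using assms unfolding locally_reusable_def by blast
  obtain b where b: "\<forall>j. is_broadcast (\<rho> j) \<longrightarrow> j < b"
    using fin finite_nat_set_iff_bounded by auto
  obtain f where "infinite {p \<in> {j. appears n e (\<rho> j)}. fst (\<rho> p) = f}"
    using recurring_config[OF run inf] by blast
  then have "\<exists>p\<ge>q. appears n e (\<rho> p) \<and> fst (\<rho> p) = f" for q
    unfolding infinite_nat_iff_unbounded_le by blast
  then obtain p p' where p: "p \<ge> b" "appears n e (\<rho> p)" "fst (\<rho> p) = f" "p' \<ge> Suc p" "fst (\<rho> p') = f"
    by metis
  then have "\<forall>j\<in>{p..<p'}. \<not> is_broadcast (\<rho> j)" using b by fastforce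
  then have "rdz_station {1..n} f c d e \<and> fst (snd e) \<noteq> Bcast" for c d
    using local_station[OF run, of p p' e c d] p by auto
  moreover have "visited n f" using run p(3) unfolding visited_def by blast
  ultimately show ?thesis by blast
qed

lemma periodic_config:
  assumes "brd J f c1" "(brd J ^^ B) c1 f"
  shows "\<exists>c. c 0 = f \<and> c (Suc 0) = c1 \<and> (\<forall>x. c (x + Suc B) = c x) \<and> (\<forall>x. brd J (c x) (c (Suc x)))"
proof -
  obtain d where d: "d 0 = c1" "d B = f" "\<forall>i<B. brd J (d i) (d (Suc i))"
    using assms(2) by (auto simp: relpowp_fun_conv)
  \<comment> \<open>Position 0 of the cycle is \<open>f\<close> and position \<open>Suc y\<close> is
    \<open>d y\<close>; \<open>d B = f\<close> is position 0 of the next round.\<close>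
  define c where "c x = (case x mod Suc B of 0 \<Rightarrow> f | Suc y \<Rightarrow> d y)" for x
  have "brd J (c x) (c (Suc x))" for x
  proof (cases "Suc (x mod Suc B) = Suc B")
    case True
    then have "Suc x mod Suc B = 0" "x mod Suc B = B" by (simp_all add: mod_Suc)
    then show ?thesis using assms(1) d by (cases B) (auto simp: c_def)
  next
    case False
    have "x mod Suc B < Suc B" by (rule mod_less_divisor) simp
    with False have "x mod Suc B < B" by linarith
    moreover have "Suc x mod Suc B = Suc (x mod Suc B)" using mod_Suc[of x "Suc B"] False by simp
    ultimately show ?thesis using assms(1) d by (cases "x mod Suc B") (auto simp: c_def)
  qed
  moreover have "c 0 = f" by (simp add: c_def)
  moreover have "c (Suc 0) = c1" using d by (cases B) (auto simp: c_def)
  moreover have "c (x + Suc B) = c x" for x by (simp only: c_def mod_add_self2)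
  ultimately show ?thesis by blast
qed

text \<open>More occurrences of \<open>e\<close> than configurations in a broadcast-free segment
  force a broadcast-free loop through \<open>e\<close>. Such loops occur arbitrarily late, so some
  configuration \<open>f\<close> starts infinitely many of them and hence also lies on a cycle with
  broadcasts.\<close>

lemma light_green_cycle:
  assumes "light_green k A Q e"
  shows "\<exists>n f B. visited n f \<and> (\<forall>c d. rdz_station {1..n} f c d e) \<and> (brd {1..n} ^^ Suc B) f f"
proof -
  obtain n \<rho> where run: "inf_run k A Q n \<rho>" and inf: "infinite {j. is_broadcast (\<rho> j)}"
    and seg: "\<And>N. \<exists>b c. (\<forall>j\<in>{b..<c}. \<not> is_broadcast (\<rho> j)) \<and> N \<le> card {j \<in> {b..<c}. appears n e (\<rho> j)}"
    using assms unfolding light_green_def by blast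
  define K where "K = card (configs Q n)"
  have fin: "finite (configs Q n)"
    unfolding configs_def using finite_states by (intro finite_PiE) auto
  have conf: "fst (\<rho> p) \<in> configs Q n" for p
  proof -
    have "\<rho> p \<in> sys_trans k A Q n" using run by (simp add: inf_run_def)
    then show ?thesis by (cases rule: sys_transE) auto
  qed
  define X where "X = {p. appears n e (\<rho> p) \<and>
    (\<exists>p'>p. fst (\<rho> p) = fst (\<rho> p') \<and> (\<forall>j\<in>{p..<p'}. \<not> is_broadcast (\<rho> j)))}"
  have "\<exists>p\<ge>p0. p \<in> X" for p0
  proof -
    obtain \<beta> where \<beta>: "\<beta> \<ge> p0" "is_broadcast (\<rho> \<beta>)"
      using inf unfolding infinite_nat_iff_unbounded_le by blast
    \<comment> \<open>\<open>K\<close> serves the pigeonhole; the summand \<open>\<beta>\<close>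
      pushes the end of the segment past the broadcast at \<open>\<beta>\<close>, and with it the
      start.\<close>
    obtain b c where bc: "\<forall>j\<in>{b..<c}. \<not> is_broadcast (\<rho> j)"
      "Suc (K + \<beta>) \<le> card {j \<in> {b..<c}. appears n e (\<rho> j)}"
      using seg by blast
    let ?Y = "{j \<in> {b..<c}. appears n e (\<rho> j)}"
    have "card ?Y \<le> card {b..<c}" by (intro card_mono) auto
    then have "\<beta> < c" using bc(2) by simp
    then have "b > \<beta>" using bc(1) \<beta>(2) by (meson atLeastLessThan_iff not_le)
    have "(\<lambda>p. fst (\<rho> p)) ` ?Y \<subseteq> configs Q n" using conf by blast
    then have "card ((\<lambda>p. fst (\<rho> p)) ` ?Y) \<le> K" unfolding K_def by (intro card_mono fin)
    then have "\<not> inj_on (\<lambda>p. fst (\<rho> p)) ?Y" using bc(2) by (intro pigeonhole) simp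
    then obtain x y where xy: "x \<in> ?Y" "y \<in> ?Y" "fst (\<rho> x) = fst (\<rho> y)" "x < y"
      unfolding inj_on_def by (metis (mono_tags, lifting) linorder_neqE_nat)
    then have "x \<in> X" using bc(1) unfolding X_def by auto
    moreover have "x \<ge> p0" using xy(1) \<open>b > \<beta>\<close> \<beta>(1) by auto
    ultimately show ?thesis by blast
  qed
  then have "infinite X" unfolding infinite_nat_iff_unbounded_le by blast
  then obtain f where "infinite {p \<in> X. fst (\<rho> p) = f}" using recurring_config[OF run] by blast
  then have ex: "\<exists>p\<ge>q. p \<in> X \<and> fst (\<rho> p) = f" for q
    unfolding infinite_nat_iff_unbounded_le by blast
  obtain p where p: "p \<in> X" "fst (\<rho> p) = f" using ex by blast
  obtain \<beta> where \<beta>: "\<beta> \<ge> p" "is_broadcast (\<rho> \<beta>)"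
    using inf unfolding infinite_nat_iff_unbounded_le by blast
  obtain p2 where p2: "p2 \<ge> Suc \<beta>" "fst (\<rho> p2) = f" using ex by blast
  obtain B where B: "brds {1..n} B (fst (\<rho> p)) (fst (\<rho> p2))"
    "B = 0 \<longleftrightarrow> (\<forall>j\<in>{p..<p2}. \<not> is_broadcast (\<rho> j))"
    using run_segment[OF run, of p p2] \<beta>(1) p2(1) by auto
  have "\<beta> \<in> {p..<p2}" using \<beta>(1) p2(1) by simp
  then obtain B' where "B = Suc B'" using B(2) \<beta>(2) by (cases B) auto
  then have "(brd {1..n} ^^ Suc B') f f" using B(1) p(2) p2(2) by (simp add: brds_def)
  moreover have "rdz_station {1..n} f c d e" for c d
    using p local_station[OF run, of p _ e c d] unfolding X_def by blast
  moreover have "visited n f" using run p(2) unfolding visited_def by blast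
  ultimately show ?thesis by blast
qed

text \<open>The rest configurations form an endless cycle, one per broadcast, with \<open>e\<close>
  available at \<open>c 0\<close>. A light green rendezvous comes with a broadcast-free loop at
  \<open>c 0\<close>; for other edges a recurrence of the source configuration beyond a later
  broadcast closes the cycle.\<close>

lemma green_station:
  assumes "green k A Q e"
  shows "\<exists>n c B. visited n (c 0) \<and> (\<forall>x. c (x + Suc B) = c x) \<and> (\<forall>x. brd {1..n} (c x) (c (Suc x))) \<and>
    (if fst (snd e) = Bcast then bc_station {1..n} (c 0) (c 1) e
     else rdz_station {1..n} (c 0) (c 1) (dark_green k A Q e) e)"
proof (cases "fst (snd e) \<noteq> Bcast \<and> light_green k A Q e")
  case True
  then obtain n f B where f: "visited n f" "\<And>c d. rdz_station {1..n} f c d e" "(brd {1..n} ^^ Suc B) f f"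
    using light_green_cycle by blast
  then obtain c1 where "brd {1..n} f c1" "(brd {1..n} ^^ B) c1 f" by (metis relpowp_Suc_D2)
  then obtain c where "c 0 = f" "\<forall>x. c (x + Suc B) = c x" "\<forall>x. brd {1..n} (c x) (c (Suc x))"
    using periodic_config by blast
  then show ?thesis using f True by (intro exI[of _ n] exI[of _ c] exI[of _ B]) simp
next
  case False
  obtain n \<rho> where run: "inf_run k A Q n \<rho>" and inf: "infinite {j. is_broadcast (\<rho> j)}"
    "infinite {j. appears n e (\<rho> j)}"
    using assms unfolding green_def by blast
  obtain f where "infinite {p \<in> {j. appears n e (\<rho> j)}. fst (\<rho> p) = f}"
    using recurring_config[OF run inf(2)] by blast
  then have ex: "\<exists>p\<ge>q. appears n e (\<rho> p) \<and> fst (\<rho> p) = f" for q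
    unfolding infinite_nat_iff_unbounded_le by blast
  obtain p where p: "appears n e (\<rho> p)" "fst (\<rho> p) = f" using ex by blast
  \<comment> \<open>The broadcast comes strictly after the occurrence of \<open>e\<close> at
    \<open>p\<close>, so the way back contains one even if \<open>e\<close> is a broadcast.\<close>
  obtain \<beta> where \<beta>: "\<beta> \<ge> Suc p" "is_broadcast (\<rho> \<beta>)"
    using inf(1) unfolding infinite_nat_iff_unbounded_le by blast
  obtain p2 where p2: "p2 \<ge> Suc \<beta>" "fst (\<rho> p2) = f" using ex by blast
  obtain B where B: "brds {1..n} B (fst (\<rho> (Suc p))) f"
    "B = 0 \<longleftrightarrow> (\<forall>j\<in>{Suc p..<p2}. \<not> is_broadcast (\<rho> j))"
    using run_segment[OF run, of "Suc p" p2] \<beta>(1) p2 by auto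
  have "\<beta> \<in> {Suc p..<p2}" using \<beta>(1) p2(1) by simp
  then obtain B' where B': "B = Suc B'" using B(2) \<beta>(2) by (cases B) auto
  define g where "g = fst (\<rho> (Suc p))"
  have ret: "(brd {1..n} ^^ Suc B') g f" using B(1) unfolding B' g_def by (simp add: brds_def)
  have \<rho>p: "\<rho> p \<in> sys_trans k A Q n" "snd (snd (\<rho> p)) = g"
    using run by (auto simp: inf_run_def g_def)
  obtain i where i: "i \<in> {1..n}" "takes n (\<rho> p) i e" using p(1) by (auto simp: appears_def)
  have vis: "visited n f" using run p(2) unfolding visited_def by blast
  from \<rho>p(1) show ?thesis
  proof (cases rule: sys_trans_steps)
    case bcast
    have e: "e = (f i, Bcast, g i)" using i(2) bcast(3) p(2) \<rho>p(2) by simp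
    have fg: "bst {1..n} f g" using bcast(2) p(2) \<rho>p(2) by simp
    \<comment> \<open>The broadcast \<open>e\<close> leads to \<open>c 1\<close> and adds one to the
      \<open>Suc B'\<close> broadcasts of the way back.\<close>
    obtain c where c: "c 0 = f" "c (Suc 0) = g" "\<forall>x. c (x + Suc (Suc B')) = c x"
      "\<forall>x. brd {1..n} (c x) (c (Suc x))"
      using periodic_config[OF bst_brd[OF fg] ret] by blast
    have "pend {1..n} g g" unfolding pend_def using rdzs_refl by blast
    then have "bc_station {1..n} (c 0) (c 1) e"
      using bc_stationI[OF fg i(1)] c(1,2) e by simp
    then show ?thesis using vis c e by (intro exI[of _ n] exI[of _ c] exI[of _ "Suc B'"]) simp
  next
    case (rdz m)
    obtain \<sigma> where \<sigma>: "m i = Some \<sigma>" and e: "e = (f i, \<sigma>, g i)"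
      using i(2) rdz(3) p(2) \<rho>p(2) by blast
    have fg: "rst {1..n} f m g" using rdz(2) p(2) \<rho>p(2) by simp
    have nb: "\<sigma> \<noteq> Bcast" using rst_edge[OF fg \<sigma>] by blast
    have dark: "dark_green k A Q e" using False assms nb e by (simp add: dark_green_def)
    obtain c1 where c1: "brd {1..n} g c1" "(brd {1..n} ^^ B') c1 f"
      using ret by (metis relpowp_Suc_D2)
    \<comment> \<open>The rendezvous \<open>e\<close> is absorbed into the first of the
      \<open>Suc B'\<close> steps, so after taking \<open>e\<close> the group is bound for
      \<open>c 1\<close>.\<close>
    obtain c where c: "c 0 = f" "c (Suc 0) = c1" "\<forall>x. c (x + Suc B') = c x"
      "\<forall>x. brd {1..n} (c x) (c (Suc x))"
      using periodic_config[OF rdzs_brd[OF rst_rdzs[OF fg] c1(1)] c1(2)] by blast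
    have "bpend {1..n} g c1" unfolding bpend_def using c1(1) by blast
    then have "rdz_station {1..n} (c 0) (c 1) (dark_green k A Q e) e"
      using rdz_stationI[OF fg i(1) \<sigma>] c(1,2) dark e by simp
    then show ?thesis using vis c e nb by (intro exI[of _ n] exI[of _ c] exI[of _ B']) simp
  qed
qed

section \<open>Renaming stations\<close>

lemma rdz_station_transfer:
  assumes "rdz_station J c c' d e" "inj_on \<psi> J" "\<forall>i\<in>J. C (\<psi> i) = c i" "\<forall>i\<in>J. C' (\<psi> i) = c' i"
  shows "rdz_station (\<psi> ` J) C C' d e"
proof -
  obtain s \<sigma> t where e: "e = (s, \<sigma>, t)" by (cases e)
  obtain j m g where j: "j \<in> J" "c j = s" "rst J c m g" "m j = Some \<sigma>" "g j = t"
    "pend J g c \<or> d \<and> bpend J g c'"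
    using assms(1) unfolding rdz_station_def e by auto
  obtain M G where G: "rst (\<psi> ` J) C M G" "\<forall>i\<in>J. G (\<psi> i) = g i \<and> M (\<psi> i) = m i"
    using rst_transfer[OF j(3) assms(2,3)] by blast
  have "\<forall>i\<in>J. G (\<psi> i) = g i" using G(2) by blast
  then have "pend (\<psi> ` J) G C \<or> d \<and> bpend (\<psi> ` J) G C'"
    using j(6) pend_transfer[OF _ assms(2) _ assms(3)] bpend_transfer[OF _ assms(2) _ assms(4)] by metis
  moreover have "\<psi> j \<in> \<psi> ` J" "M (\<psi> j) = Some \<sigma>" using j G(2) by simp_all
  ultimately have "rdz_station (\<psi> ` J) C C' d (C (\<psi> j), \<sigma>, G (\<psi> j))"
    using rdz_stationI[OF G(1)] by metis
  then show ?thesis using assms(3) G(2) j e by simp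
qed

lemma bc_station_transfer:
  assumes "bc_station J c c' e" "inj_on \<psi> J" "\<forall>i\<in>J. C (\<psi> i) = c i" "\<forall>i\<in>J. C' (\<psi> i) = c' i"
    and "fst (snd e) = Bcast"
  shows "bc_station (\<psi> ` J) C C' e"
proof -
  obtain s t where e: "e = (s, Bcast, t)" using assms(5) by (cases e) auto
  obtain j g where j: "j \<in> J" "c j = s" "bst J c g" "g j = t" "pend J g c'"
    using assms(1) unfolding bc_station_def e by auto
  obtain G where G: "bst (\<psi> ` J) C G" "\<forall>i\<in>J. G (\<psi> i) = g i"
    using bst_transfer[OF j(3) assms(2,3)] by blast
  have "\<psi> j \<in> \<psi> ` J" "pend (\<psi> ` J) G C'" using j(1) pend_transfer[OF j(5) assms(2) G(2) assms(4)] by auto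
  then have "bc_station (\<psi> ` J) C C' (C (\<psi> j), Bcast, G (\<psi> j))" by (rule bc_stationI[OF G(1)])
  then show ?thesis using assms(3) G(2) j e by simp
qed

lemma rdz_station_source: "rdz_station J c c' d e \<Longrightarrow> \<exists>j\<in>J. c j = fst e"
  unfolding rdz_station_def by auto

lemma bc_station_source: "bc_station J c c' e \<Longrightarrow> \<exists>j\<in>J. c j = fst e"
  unfolding bc_station_def by auto

end

section \<open>The reachability-unwinding\<close>

lemma sat_edges_iff:
  "(s, \<sigma>, t) \<in> sat_edges k P X \<longleftrightarrow> (\<exists>a h. \<sigma> = Rdz a h \<and> (s, \<sigma>, t) \<in> edges P \<and> h \<in> {1..k} \<and>
     s \<in> sat_states k P X \<and>
     (\<forall>l\<in>{1..k} - {h}. \<exists>s' t'. (s', Rdz a l, t') \<in> edges P \<and> s' \<in> sat_states k P X))"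
  by (subst sat_edges.simps) auto

lemma sat_states_subset:
  assumes "X \<subseteq> S" "\<And>s \<sigma> t. (s, \<sigma>, t) \<in> edges P \<Longrightarrow> t \<in> S"
  shows "sat_states k P X \<subseteq> S"
proof
  fix s assume "s \<in> sat_states k P X"
  then show "s \<in> S"
    by (induction rule: sat_states_sat_edges.inducts(1)[where ?P2.0 = "\<lambda>_ _ _. True"]) (use assms in auto)
qed

lemma sat_edges_target: "(s, \<sigma>, t) \<in> sat_edges k P X \<Longrightarrow> t \<in> sat_states k P X"
  unfolding sat_edges_iff by (blast intro: sat_states_sat_edges.state)

text \<open>A rendezvous enabled for one participant is enabled for all: seen from position
  \<open>l\<close>, the partner required at \<open>h\<close> is the given edge itself.\<close>

lemma sat_edges_partner:
  assumes e: "(s, Rdz a h, t) \<in> sat_edges k P X"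
    and "(s', Rdz a l, t') \<in> edges P" "s' \<in> sat_states k P X" "l \<in> {1..k}"
  shows "(s', Rdz a l, t') \<in> sat_edges k P X"
proof -
  have E: "(s, Rdz a h, t) \<in> edges P" "s \<in> sat_states k P X"
    and p: "\<forall>l\<in>{1..k} - {h}. \<exists>s' t'. (s', Rdz a l, t') \<in> edges P \<and> s' \<in> sat_states k P X"
    using e unfolding sat_edges_iff by auto
  have "\<exists>s' t'. (s', Rdz a l', t') \<in> edges P \<and> s' \<in> sat_states k P X" if "l' \<in> {1..k} - {l}" for l'
    using that p E by (cases "l' = h") blast+
  then show ?thesis using assms(2-) by (simp add: sat_edges_iff)
qed

section \<open>Components and phases\<close>

locale template =
  fixes k :: nat and A :: "'a set" and P :: "('s, 'a, 'p) lts"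
  assumes template: "rb_template k A P"
begin

abbreviation U :: "('s \<times> nat, 'a, 'p) lts" where "U \<equiv> unwinding k P"

definition nxt :: "nat \<Rightarrow> nat" where
  "nxt i = (if i < unw_last k P then Suc i else unw_back k P)"

text \<open>The component of the unwinding that all processes are in after \<open>N\<close> broadcasts.\<close>

definition phase :: "nat \<Rightarrow> nat" where
  "phase N = (nxt ^^ N) 0"

lemma P_edge: "(s, \<sigma>, t) \<in> edges P \<Longrightarrow> s \<in> states P \<and> t \<in> states P \<and> \<sigma> \<in> rdz_symbols k A \<union> {Bcast}"
  using template unfolding rb_template_def finite_lts_def by blast

lemma P_rdz: "(s, Rdz a h, t) \<in> edges P \<Longrightarrow> a \<in> A \<and> h \<in> {1..k}"
  using P_edge unfolding rdz_symbols_def by blast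

lemma unw_inits_subset: "unw_inits k P i \<subseteq> states P"
proof (induction i)
  case 0
  then show ?case using template by (simp add: rb_template_def finite_lts_def)
next
  case (Suc i)
  then show ?case using P_edge by auto
qed

lemma unw_states_subset: "unw_states k P i \<subseteq> states P"
  using sat_states_subset[OF unw_inits_subset] P_edge by blast

text \<open>The \<open>LEAST\<close> terms need a witness: all \<open>unw_inits k P i\<close> are
  subsets of a finite set, so two of them coincide.\<close>

lemma unw_last_back:
  "unw_back k P \<le> unw_last k P \<and> unw_inits k P (Suc (unw_last k P)) = unw_inits k P (unw_back k P)"
proof -
  have "finite (Pow (states P))" using template by (simp add: rb_template_def finite_lts_def)
  moreover have "range (unw_inits k P) \<subseteq> Pow (states P)" using unw_inits_subset by blast
  ultimately have "finite (range (unw_inits k P))" using finite_subset by blast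
  then have "\<not> inj (unw_inits k P)" using finite_imageD infinite_UNIV_nat by blast
  then obtain x y where "unw_inits k P x = unw_inits k P y" "x < y"
    unfolding inj_def by (metis linorder_neqE_nat)
  \<comment> \<open>\<open>y\<close> is positive, and \<open>y - 1\<close> is the candidate for the
    last component.\<close>
  then have "\<exists>n\<le>y - 1. unw_inits k P (Suc (y - 1)) = unw_inits k P n"
    by (intro exI[of _ x]) auto
  then have "\<exists>n\<le>unw_last k P. unw_inits k P (Suc (unw_last k P)) = unw_inits k P n"
    unfolding unw_last_def by (rule LeastI)
  then obtain n where "n \<le> unw_last k P \<and> unw_inits k P (Suc (unw_last k P)) = unw_inits k P n" by blast
  then show ?thesis unfolding unw_back_def by (rule LeastI)
qed

lemma nxt_le: "nxt i \<le> unw_last k P"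
  using unw_last_back by (simp add: nxt_def)

lemma unw_inits_nxt: "i \<le> unw_last k P \<Longrightarrow> unw_inits k P (nxt i) = unw_inits k P (Suc i)"
  using unw_last_back by (auto simp: nxt_def simp del: unw_inits.simps dest: le_antisym)

lemma phase_0: "phase 0 = 0" and phase_Suc: "phase (Suc N) = nxt (phase N)"
  by (simp_all add: phase_def)

lemma phase_add: "phase (N + x) = (nxt ^^ x) (phase N)"
  by (subst add.commute) (simp add: phase_def funpow_add)

lemma phase_le: "phase N \<le> unw_last k P"
  by (cases N) (simp_all add: phase_0 phase_Suc nxt_le)

lemma U_simps:
  "props U = props P" "states U = {(s, i) | s i. i \<le> unw_last k P \<and> s \<in> unw_states k P i}"
  "inits U = {(s, 0) | s. s \<in> inits P}" "label U (s, i) = label P s"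
  by (simp_all add: unwinding_def Let_def)

lemma U_label: "label U x = label P (fst x)"
  by (cases x) (simp add: U_simps)

lemma U_edge_iff:
  "((s, i), \<sigma>, (t, j)) \<in> edges U \<longleftrightarrow> i \<le> unw_last k P \<and>
     (if \<sigma> = Bcast then j = nxt i \<and> s \<in> unw_states k P i \<and> (s, Bcast, t) \<in> edges P
      else j = i \<and> (s, \<sigma>, t) \<in> unw_edges k P i)"
proof (cases "\<sigma> = Bcast")
  case True
  then have "(s, \<sigma>, t) \<notin> unw_edges k P i" by (simp add: sat_edges_iff)
  then show ?thesis using True unfolding unwinding_def Let_def nxt_def by auto
next
  case False
  then show ?thesis unfolding unwinding_def Let_def by auto
qed

lemma U_edge_fst: "((s, i), \<sigma>, (t, j)) \<in> edges U \<Longrightarrow> (s, \<sigma>, t) \<in> edges P"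
  unfolding U_edge_iff by (auto simp: sat_edges_iff split: if_splits)

lemma U_edge_states: assumes "(x, \<sigma>, y) \<in> edges U" shows "x \<in> states U \<and> y \<in> states U"
proof -
  obtain s i t j where xy: "x = (s, i)" "y = (t, j)" by (cases x, cases y)
  have e: "i \<le> unw_last k P" "if \<sigma> = Bcast then j = nxt i \<and> s \<in> unw_states k P i \<and> (s, Bcast, t) \<in> edges P
      else j = i \<and> (s, \<sigma>, t) \<in> unw_edges k P i"
    using assms unfolding xy U_edge_iff by blast+
  show ?thesis
  proof (cases "\<sigma> = Bcast")
    case True
    then have "t \<in> unw_inits k P (nxt i)" unfolding unw_inits_nxt[OF e(1)] using e(2) by auto
    then have "t \<in> unw_states k P (nxt i)" by (rule sat_states_sat_edges.init)
    then show ?thesis using True e nxt_le unfolding xy U_simps by auto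
  next
    case False
    then have st: "(s, \<sigma>, t) \<in> unw_edges k P i" "j = i" using e(2) by auto
    then have "s \<in> unw_states k P i" using sat_edges_iff by metis
    moreover have "t \<in> unw_states k P i" by (rule sat_edges_target[OF st(1)])
    ultimately show ?thesis using e(1) st(2) unfolding xy U_simps by auto
  qed
qed

lemma finite_U: "finite (states U)"
proof -
  have "states U \<subseteq> states P \<times> {..unw_last k P}"
    using unw_states_subset unfolding U_simps by auto
  then show ?thesis
    using template by (auto simp: rb_template_def finite_lts_def intro: finite_subset)
qed

lemma finite_U_edges: "finite (edges U)"
proof -
  have "edges U \<subseteq> states U \<times> alphabet P \<times> states U"
  proof
    fix e assume e: "e \<in> edges U"
    obtain s i \<sigma> t j where "e = ((s, i), \<sigma>, (t, j))" by (metis prod.exhaust)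
    then have "e \<in> states U \<times> alphabet P \<times> states U"
      using e U_edge_states[of "(s, i)" \<sigma> "(t, j)"] U_edge_fst[of s i \<sigma> t j] P_edge template
      unfolding rb_template_def by auto
    then show "e \<in> states U \<times> alphabet P \<times> states U" .
  qed
  moreover have "finite (alphabet P)" using template unfolding rb_template_def finite_lts_def by blast
  ultimately show ?thesis using finite_U by (meson finite_SigmaI finite_subset)
qed

sublocale rb_net k A U
proof
  show "inits U \<subseteq> states U" by (auto simp: U_simps intro: sat_states_sat_edges.init)
next
  fix x assume "x \<in> states U"
  then obtain s i where x: "x = (s, i)" "i \<le> unw_last k P" "s \<in> unw_states k P i"
    unfolding U_simps by auto
  then obtain t where "(s, Bcast, t) \<in> edges P"
    using template unw_states_subset unfolding rb_template_def by blast
  then have "((s, i), Bcast, (t, nxt i)) \<in> edges U" using x unfolding U_edge_iff by simp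
  then show "\<exists>y. (x, Bcast, y) \<in> edges U" unfolding x by blast
qed (use U_edge_states finite_U in auto)

lemma U_edge_phase:
  "(x, \<sigma>, y) \<in> edges U \<Longrightarrow> snd y = (if \<sigma> = Bcast then nxt (snd x) else snd x)"
  by (cases x, cases y) (auto simp: U_edge_iff split: if_splits)

lemma rst_phase:
  assumes "rst J f m g" shows "snd (g i) = snd (f i)"
proof (cases "m i")
  case None
  then show ?thesis using rst_idle[OF assms] by simp
next
  case (Some \<sigma>)
  then show ?thesis using rst_edge[OF assms Some] U_edge_phase[of "f i" \<sigma> "g i"] by simp
qed

lemma rdzs_phase:
  assumes "rdzs J f g" shows "snd (g i) = snd (f i)"
  using assms
proof (induction rule: rdzs_induct)
  case (step g m h)
  then show ?case using rst_phase[OF step.hyps(2), of i] by simp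
qed simp

lemma bst_phase:
  assumes "bst J f g" "i \<in> J" shows "snd (g i) = nxt (snd (f i))"
proof -
  have "(f i, Bcast, g i) \<in> edges U" using assms by (simp add: bst_def)
  from U_edge_phase[OF this] show ?thesis by simp
qed

lemma brd_phase_states:
  assumes "brd J f g" "i \<in> J" shows "snd (g i) = nxt (snd (f i)) \<and> g i \<in> states U"
proof -
  obtain f' g' where s: "rdzs J f f'" "bst J f' g'" "rdzs J g' g"
    using assms(1) unfolding brd_def by blast
  have "(f' i, Bcast, g' i) \<in> edges U" using s(2) assms(2) by (simp add: bst_def)
  then have "g' i \<in> states U" using U_edge_states by blast
  then show ?thesis
    using rdzs_phase[OF s(1), of i] bst_phase[OF s(2) assms(2)] rdzs_phase[OF s(3), of i] rdzs_states[OF s(3), of i]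
    by simp
qed

lemma U_partners:
  assumes "(x, Rdz a h, y) \<in> edges U"
  shows "a \<in> A \<and> h \<in> {1..k} \<and>
    (\<forall>l\<in>{1..k} - {h}. \<exists>x' y'. (x', Rdz a l, y') \<in> edges U \<and> snd x' = snd x)"
proof -
  obtain s i t j where xy: "x = (s, i)" "y = (t, j)" by (cases x, cases y)
  have e: "i \<le> unw_last k P" "(s, Rdz a h, t) \<in> unw_edges k P i"
    using assms unfolding xy U_edge_iff by auto
  then have E: "(s, Rdz a h, t) \<in> edges P" "s \<in> unw_states k P i"
    and p: "\<forall>l\<in>{1..k} - {h}. \<exists>s' t'. (s', Rdz a l, t') \<in> edges P \<and> s' \<in> unw_states k P i"
    unfolding sat_edges_iff by auto
  have "\<exists>x' y'. (x', Rdz a l, y') \<in> edges U \<and> snd x' = snd x" if l: "l \<in> {1..k} - {h}" for l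
  proof -
    obtain s' t' where s': "(s', Rdz a l, t') \<in> edges P" "s' \<in> unw_states k P i" using p l by blast
    then have "(s', Rdz a l, t') \<in> unw_edges k P i" using sat_edges_partner[OF e(2) s'] l by blast
    then have "((s', i), Rdz a l, (t', i)) \<in> edges U" using e(1) by (simp add: U_edge_iff)
    then show ?thesis unfolding xy by fastforce
  qed
  then show ?thesis using P_rdz[OF E(1)] by blast
qed

section \<open>Reachability in the unwinding\<close>

text \<open>Saturation adds a state under the very condition of \<open>reach_rdz\<close>: for every
  other symbol a partner is already reachable after \<open>N\<close> broadcasts.\<close>

lemma reach_sat:
  assumes i: "i \<le> unw_last k P" and base: "\<And>s. s \<in> unw_inits k P i \<Longrightarrow> reach N (s, i)"
    and s: "s \<in> unw_states k P i"
  shows "reach N (s, i)"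
  using s
proof (induction rule: sat_states_sat_edges.inducts(1)[where ?P2.0 = "\<lambda>_ _ _. True"])
  case (init s)
  then show ?case by (rule base)
next
  case (state s a h t)
  have part: "\<forall>l\<in>{1..k} - {h}. \<exists>s' t'. (s', Rdz a l, t') \<in> edges P \<and> s' \<in> unw_states k P i"
    using state.IH(2) by blast
  have e: "(s, Rdz a h, t) \<in> unw_edges k P i"
    by (rule sat_states_sat_edges.edge) (use state part in auto)
  have "\<exists>x' y'. (x', Rdz a l, y') \<in> edges U \<and> reach N x'" if l: "l \<in> {1..k} - {h}" for l
  proof -
    obtain s' t' where s': "(s', Rdz a l, t') \<in> edges P" "s' \<in> unw_states k P i" "reach N (s', i)"
      using state.IH(2) l by blast
    then have "(s', Rdz a l, t') \<in> unw_edges k P i" using sat_edges_partner[OF e s'(1,2)] l by blast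
    then have "((s', i), Rdz a l, (t', i)) \<in> edges U" using i by (simp add: U_edge_iff)
    then show ?thesis using s'(3) by blast
  qed
  moreover have "((s, i), Rdz a h, (t, i)) \<in> edges U" using e i by (simp add: U_edge_iff)
  moreover have "reach N (s, i)" using state.IH(1) by blast
  moreover have "a \<in> A" "h \<in> {1..k}" using P_rdz state.hyps(1) by blast+
  ultimately show ?case using reach_rdz by blast
qed simp

text \<open>This covers every \<open>N\<close>, not only the first visit to a component, so the
  states can be synchronised with a prefix of arbitrary length.\<close>

lemma reach_all: "s \<in> unw_states k P (phase N) \<Longrightarrow> reach N (s, phase N)"
proof (induction N arbitrary: s)
  case 0
  show ?case
    by (rule reach_sat[OF phase_le _ 0]) (auto simp: U_simps phase_0 intro: reach_init)
next
  case (Suc N)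
  show ?case
  proof (rule reach_sat[OF phase_le _ Suc.prems])
    fix s assume "s \<in> unw_inits k P (phase (Suc N))"
    then obtain h where h: "h \<in> unw_states k P (phase N)" "(h, Bcast, s) \<in> edges P"
      unfolding phase_Suc unw_inits_nxt[OF phase_le] by auto
    then have "((h, phase N), Bcast, (s, phase (Suc N))) \<in> edges U"
      using phase_le by (simp add: U_edge_iff phase_Suc)
    then show "reach (Suc N) (s, phase (Suc N))" using reach_bcast Suc.IH[OF h(1)] by blast
  qed
qed

lemma reach_state: "x \<in> states U \<Longrightarrow> snd x = phase N \<Longrightarrow> reach N x"
  using reach_all unfolding U_simps by auto

definition bcount :: "(nat \<Rightarrow> ('s \<times> nat, 'a) edge) \<Rightarrow> nat \<Rightarrow> nat" where
  "bcount es M = card {m. m < M \<and> fst (snd (es m)) = Bcast}"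

lemma bcount_Suc: "bcount es (Suc M) = (if fst (snd (es M)) = Bcast then Suc (bcount es M) else bcount es M)"
proof -
  have "{m. m < Suc M \<and> fst (snd (es m)) = Bcast} = {m. m < M \<and> fst (snd (es m)) = Bcast} \<union>
      (if fst (snd (es M)) = Bcast then {M} else {})"
    by (auto simp: less_Suc_eq)
  then show ?thesis unfolding bcount_def by simp
qed

text \<open>Each rendezvous on the path is made possible by fresh partners, reached with as many
  broadcasts as the path has made so far.\<close>

lemma path_load:
  assumes "fst (es 0) \<in> inits U" "\<And>m. es m \<in> edges U" "\<And>m. fst (es (Suc m)) = snd (snd (es m))"
  shows "(\<exists>(I::nat set) p F. finite I \<and> p \<in> I \<and> frun I p (bcount es M) (map es [0..<M]) F \<and>
    F p = fst (es M)) \<and> snd (fst (es M)) = phase (bcount es M)"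
proof (induction M)
  case 0
  have "frun {0::nat} 0 0 [] (\<lambda>_. fst (es 0))" using assms(1) by (intro frun.base) simp
  moreover have "snd (fst (es 0)) = phase 0" using assms(1) by (auto simp: U_simps phase_0)
  ultimately show ?case by (intro conjI exI[of _ "{0}"] exI[of _ 0] exI[of _ "\<lambda>_. fst (es 0)"]) (auto simp: bcount_def)
next
  case (Suc M)
  obtain x \<sigma> y where e: "es M = (x, \<sigma>, y)" by (cases "es M")
  have xy: "(x, \<sigma>, y) \<in> edges U" "fst (es M) = x" "fst (es (Suc M)) = y" "fst (snd (es M)) = \<sigma>"
    using assms(2)[of M] assms(3)[of M] e by auto
  obtain I :: "nat set" and p F where I: "finite I" "p \<in> I" "frun I p (bcount es M) (map es [0..<M]) F" "F p = x"
    using Suc.IH xy(2) by auto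
  have c: "snd x = phase (bcount es M)" using Suc.IH xy(2) by simp
  have map: "map es [0..<Suc M] = map es [0..<M] @ [(F p, \<sigma>, y)]" using I(4) e by simp
  show ?case
  proof (cases \<sigma>)
    case (Rdz a h)
    have b: "bcount es (Suc M) = bcount es M" using xy(4) Rdz by (simp add: bcount_Suc)
    have Fp: "(F p, Rdz a h, y) \<in> edges U" using xy(1) I(4) Rdz by simp
    note parts = U_partners[OF Fp]
    have "\<exists>x' y'. (x', Rdz a l, y') \<in> edges U \<and> reach (bcount es M) x'" if "l \<in> {1..k} - {h}" for l
      using parts that U_edge_states reach_state c I(4) by metis
    then have "\<exists>I' g. finite I' \<and> p \<in> I' \<and> I' \<inter> {} = {} \<and>
        frun I' p (bcount es M) (map es [0..<M] @ [(F p, Rdz a h, y)]) g \<and> g p = y"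
      using frun_snoc_rdz[OF I(1-3) finite.emptyI Int_empty_right Fp] parts by blast
    moreover have "snd y = phase (bcount es M)" using U_edge_phase[OF xy(1)] c Rdz by simp
    ultimately show ?thesis unfolding b map xy(3) Rdz by blast
  next
    case Bcast
    have b: "bcount es (Suc M) = Suc (bcount es M)" using xy(4) Bcast by (simp add: bcount_Suc)
    have "(F p, Bcast, y) \<in> edges U" using xy(1) I(4) Bcast by simp
    from frun_snoc_bcast[OF I(2,3) this]
    obtain g where "frun I p (bcount es (Suc M)) (map es [0..<Suc M]) g" "g p = y"
      unfolding b map Bcast by (elim exE conjE)
    moreover have "snd y = phase (bcount es (Suc M))" using U_edge_phase[OF xy(1)] c Bcast b by (simp add: phase_Suc)
    ultimately show ?thesis unfolding xy(3)
      by (intro conjI exI[of _ I] exI[of _ p] exI[of _ g]) (rule I(1) I(2) | assumption)+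
  qed
qed

text \<open>Rendezvous keep the component and a broadcast moves all processes together, so they
  never part.\<close>

lemma visited_states:
  assumes "visited n f"
  shows "(\<forall>i\<in>{1..n}. f i \<in> states U) \<and> (\<exists>N. \<forall>i\<in>{1..n}. snd (f i) = phase N)"
proof -
  obtain \<rho> p where run: "inf_run k A U n \<rho>" and p: "fst (\<rho> p) = f"
    using assms unfolding visited_def by blast
  have "(\<forall>i\<in>{1..n}. fst (\<rho> q) i \<in> states U) \<and> (\<exists>N. \<forall>i\<in>{1..n}. snd (fst (\<rho> q) i) = phase N)" for q
  proof (induction q)
    case 0
    have "\<forall>i\<in>{1..n}. fst (\<rho> 0) i \<in> inits U" using run by (auto simp: inf_run_def init_configs_def)
    moreover have "snd x = phase 0" if "x \<in> inits U" for x using that by (auto simp: U_simps phase_0)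
    ultimately show ?case using inits_states by blast
  next
    case (Suc q)
    have \<rho>: "\<rho> q \<in> sys_trans k A U n" "snd (snd (\<rho> q)) = fst (\<rho> (Suc q))"
      using run by (auto simp: inf_run_def)
    from \<rho>(1) show ?case
    proof (cases rule: sys_trans_steps)
      case bcast
      then have b: "bst {1..n} (fst (\<rho> q)) (fst (\<rho> (Suc q)))" using \<rho>(2) by simp
      obtain N where "\<forall>i\<in>{1..n}. snd (fst (\<rho> q) i) = phase N" using Suc by blast
      then have "\<forall>i\<in>{1..n}. snd (fst (\<rho> (Suc q)) i) = phase (Suc N)"
        using bst_phase[OF b] by (simp add: phase_Suc)
      moreover have "\<forall>i\<in>{1..n}. fst (\<rho> (Suc q)) i \<in> states U"
        using brd_phase_states[OF bst_brd[OF b]] by blast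
      ultimately show ?thesis by blast
    next
      case (rdz m)
      then have r: "rst {1..n} (fst (\<rho> q)) m (fst (\<rho> (Suc q)))" using \<rho>(2) by simp
      show ?thesis using rst_phase[OF r] rst_states[OF r] Suc by auto
    qed
  qed
  then show ?thesis using p by blast
qed

section \<open>Realising accepted words\<close>

text \<open>Groups are given abstractly, with processes \<open>{1..n \<gamma>}\<close> and a rest
  configuration \<open>d \<gamma> T\<close> for each number \<open>T\<close> of broadcasts. All
  pairs \<open>(\<gamma>, i)\<close> are loaded as distinct indices, in the states due after the
  first \<open>M\<close> edges.\<close>

lemma stations_exec:
  fixes \<Gamma> :: "'g set" and n :: "'g \<Rightarrow> nat" and d :: "'g \<Rightarrow> nat \<Rightarrow> ('s \<times> nat) config"
  assumes path: "fst (es 0) \<in> inits U" "\<And>m. es m \<in> edges U" "\<And>m. fst (es (Suc m)) = snd (snd (es m))"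
    and \<Gamma>: "finite \<Gamma>"
    and start: "\<And>\<gamma> i. \<gamma> \<in> \<Gamma> \<Longrightarrow> i \<in> {1..n \<gamma>} \<Longrightarrow> d \<gamma> (bcount es M) i \<in> states U \<and>
      snd (d \<gamma> (bcount es M) i) = phase (bcount es M)"
    and rest: "\<And>m \<gamma>. m \<ge> M \<Longrightarrow> fst (snd (es m)) = Bcast \<Longrightarrow> \<gamma> \<in> \<Gamma> \<Longrightarrow>
      brd {1..n \<gamma>} (d \<gamma> (bcount es m)) (d \<gamma> (Suc (bcount es m)))"
    and u: "\<And>m. m \<ge> M \<Longrightarrow> fst (snd (es m)) \<noteq> Bcast \<Longrightarrow>
      u (Suc m) = (if dark (es m) then Suc (u m) else u m)"
    and ub: "\<And>m. u m \<le> b"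
    and st: "\<And>m. m \<ge> M \<Longrightarrow> \<exists>\<Gamma>'\<subseteq>\<Gamma>. card \<Gamma>' \<ge> b + 2 \<and> (\<forall>\<gamma>\<in>\<Gamma>'.
      if fst (snd (es m)) = Bcast
      then bc_station {1..n \<gamma>} (d \<gamma> (bcount es m)) (d \<gamma> (Suc (bcount es m))) (es m)
      else rdz_station {1..n \<gamma>} (d \<gamma> (bcount es m)) (d \<gamma> (Suc (bcount es m))) (dark (es m)) (es m))"
  shows "(\<lambda>m. label U (fst (es m))) \<in> exec_inf k A U"
proof -
  let ?T = "bcount es"
  obtain I0 :: "nat set" and p F0 where I0: "finite I0" "p \<in> I0" "frun I0 p (?T M) (map es [0..<M]) F0"
    "F0 p = fst (es M)"
    using path_load[OF path, of M] by auto
  define R where "R = Sigma \<Gamma> (\<lambda>\<gamma>. {1..n \<gamma>})"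
  have fR: "finite R" unfolding R_def using \<Gamma> by auto
  have reachR: "reach (?T M) (case \<rho> of (\<gamma>, i) \<Rightarrow> d \<gamma> (?T M) i)" if "\<rho> \<in> R" for \<rho>
  proof -
    obtain \<gamma> i where "\<rho> = (\<gamma>, i)" "\<gamma> \<in> \<Gamma>" "i \<in> {1..n \<gamma>}" using \<open>\<rho> \<in> R\<close> unfolding R_def by blast
    then show ?thesis using reach_state start by simp
  qed
  obtain I F \<iota> where L: "finite I" "I0 \<subseteq> I" "frun I p (?T M) (map es [0..<M]) F" "\<forall>i\<in>I0. F i = F0 i"
    "inj_on \<iota> R" "\<iota> ` R \<subseteq> I - I0" "\<forall>\<rho>\<in>R. F (\<iota> \<rho>) = (case \<rho> of (\<gamma>, i) \<Rightarrow> d \<gamma> (?T M) i)"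
    using load[where st = "\<lambda>(\<gamma>, i). d \<gamma> (?T M) i", OF fR _ I0(1-3) finite.emptyI Int_empty_right] reachR
    by (elim exE conjE meta_impE) (assumption | rule that)+
  define \<psi> where "\<psi> \<gamma> i = \<iota> (\<gamma>, i)" for \<gamma> i
  define J where "J \<gamma> = \<psi> \<gamma> ` {1..n \<gamma>}" for \<gamma>
  define c where "c T x = (case inv_into R \<iota> x of (\<gamma>, i) \<Rightarrow> d \<gamma> T i)" for T x
  have inR: "(\<gamma>, i) \<in> R" if "\<gamma> \<in> \<Gamma>" "i \<in> {1..n \<gamma>}" for \<gamma> i using that by (simp add: R_def)
  have c: "c T (\<psi> \<gamma> i) = d \<gamma> T i" if "\<gamma> \<in> \<Gamma>" "i \<in> {1..n \<gamma>}" for \<gamma> T i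
    using inR[OF that] L(5) by (simp add: c_def \<psi>_def)
  have inj: "inj_on (\<psi> \<gamma>) {1..n \<gamma>}" if "\<gamma> \<in> \<Gamma>" for \<gamma>
  proof (rule inj_onI)
    fix x y assume "x \<in> {1..n \<gamma>}" "y \<in> {1..n \<gamma>}" "\<psi> \<gamma> x = \<psi> \<gamma> y"
    then have "(\<gamma>, x) = (\<gamma>, y)" using inj_onD[OF L(5)] inR[OF that] unfolding \<psi>_def by blast
    then show "x = y" by simp
  qed
  show ?thesis
  proof (rule exec_inf_of_stations[where I = I and p = p and N = "?T M" and M = M and F = F and \<Gamma> = \<Gamma>
        and J = J and c = c and T = ?T and u = u and dark = dark and b = b])
    show "finite I" "p \<in> I" "frun I p (?T M) (map es [0..<M]) F" using L(1-3) I0(2) by auto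
    show "F p = fst (es M)" using L(4) I0(2,4) by simp
    show "fst (es (Suc m)) = snd (snd (es m))" for m by (rule path(3))
    show "finite \<Gamma>" by (rule \<Gamma>)
    show "J \<gamma> \<subseteq> I" if "\<gamma> \<in> \<Gamma>" for \<gamma>
      unfolding J_def \<psi>_def using L(6) inR[OF that] by blast
    show "J \<gamma> \<inter> J \<delta> = {}" if "\<gamma> \<in> \<Gamma>" "\<delta> \<in> \<Gamma>" "\<gamma> \<noteq> \<delta>" for \<gamma> \<delta>
    proof (rule ccontr)
      assume "J \<gamma> \<inter> J \<delta> \<noteq> {}"
      then obtain z where "z \<in> J \<gamma>" "z \<in> J \<delta>" by blast
      then obtain x y where "x \<in> {1..n \<gamma>}" "y \<in> {1..n \<delta>}" "\<iota> (\<gamma>, x) = \<iota> (\<delta>, y)"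
        unfolding J_def \<psi>_def by (elim imageE) metis
      then have "(\<gamma>, x) = (\<delta>, y)" using inj_onD[OF L(5)] inR that by blast
      then show False using that(3) by simp
    qed
    show "F x = c (?T M) x" if g: "\<gamma> \<in> \<Gamma>" "x \<in> J \<gamma>" for \<gamma> x
    proof -
      obtain i where i: "i \<in> {1..n \<gamma>}" "x = \<psi> \<gamma> i" using g(2) unfolding J_def by blast
      have "F (\<iota> (\<gamma>, i)) = d \<gamma> (?T M) i" using bspec[OF L(7) inR[OF g(1) i(1)]] by simp
      then show ?thesis using c[OF g(1) i(1)] i(2) by (simp add: \<psi>_def)
    qed
    show "?T (Suc m) = (if fst (snd (es m)) = Bcast then Suc (?T m) else ?T m)" for m
      by (rule bcount_Suc)
    show "u (Suc m) = (if dark (es m) then Suc (u m) else u m)"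
      if "m \<ge> M" "fst (snd (es m)) \<noteq> Bcast" for m using u that by blast
    show "u m \<le> b" for m by (rule ub)
    show "\<exists>\<Gamma>'\<subseteq>\<Gamma>. card \<Gamma>' \<ge> b + 2 \<and>
      (\<forall>\<gamma>\<in>\<Gamma>'. rdz_station (J \<gamma>) (c (?T m)) (c (Suc (?T m))) (dark (es m)) (es m))"
      if m: "m \<ge> M" "fst (snd (es m)) \<noteq> Bcast" for m
    proof -
      obtain \<Gamma>' where \<Gamma>': "\<Gamma>' \<subseteq> \<Gamma>" "card \<Gamma>' \<ge> b + 2"
        "\<forall>\<gamma>\<in>\<Gamma>'. rdz_station {1..n \<gamma>} (d \<gamma> (?T m)) (d \<gamma> (Suc (?T m))) (dark (es m)) (es m)"
        using st[OF m(1)] m(2) by auto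
      have "rdz_station (J \<gamma>) (c (?T m)) (c (Suc (?T m))) (dark (es m)) (es m)" if "\<gamma> \<in> \<Gamma>'" for \<gamma>
        unfolding J_def
        by (rule rdz_station_transfer[OF bspec[OF \<Gamma>'(3) that]]) (use \<Gamma>'(1) that inj c in auto)
      then show ?thesis using \<Gamma>'(1,2) by blast
    qed
    show "\<exists>\<Gamma>'\<subseteq>\<Gamma>. card \<Gamma>' \<ge> b + 2 \<and>
      (\<forall>\<gamma>\<in>\<Gamma>'. bc_station (J \<gamma>) (c (?T m)) (c (Suc (?T m))) (es m))"
      if m: "m \<ge> M" "fst (snd (es m)) = Bcast" for m
    proof -
      obtain \<Gamma>' where \<Gamma>': "\<Gamma>' \<subseteq> \<Gamma>" "card \<Gamma>' \<ge> b + 2"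
        "\<forall>\<gamma>\<in>\<Gamma>'. bc_station {1..n \<gamma>} (d \<gamma> (?T m)) (d \<gamma> (Suc (?T m))) (es m)"
        using st[OF m(1)] m(2) by auto
      have "bc_station (J \<gamma>) (c (?T m)) (c (Suc (?T m))) (es m)" if "\<gamma> \<in> \<Gamma>'" for \<gamma>
        unfolding J_def
        by (rule bc_station_transfer[OF bspec[OF \<Gamma>'(3) that]]) (use \<Gamma>'(1) that inj c m(2) in auto)
      then show ?thesis using \<Gamma>'(1,2) by blast
    qed
    show "bpend (J \<gamma>) (c (?T m)) (c (Suc (?T m)))"
      if m: "m \<ge> M" "fst (snd (es m)) = Bcast" "\<gamma> \<in> \<Gamma>" for m \<gamma>
    proof -
      have "bpend {1..n \<gamma>} (d \<gamma> (?T m)) (d \<gamma> (Suc (?T m)))"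
        using rest[OF m] unfolding bpend_def by blast
      then show ?thesis unfolding J_def
        by (rule bpend_transfer) (use m(3) inj c in auto)
    qed
  qed
qed

text \<open>Locally reusable edges are rendezvous, so after \<open>M\<close> neither the broadcast
  count nor the rest configurations change. The source of each edge occurs in its group, which is
  therefore in the component of the path.\<close>

lemma local_exec:
  assumes path: "fst (es 0) \<in> inits U" "\<And>m. es m \<in> edges U" "\<And>m. fst (es (Suc m)) = snd (snd (es m))"
    and loc: "\<And>m. m \<ge> M \<Longrightarrow> locally_reusable k A U (es m)"
  shows "(\<lambda>m. label U (fst (es m))) \<in> exec_inf k A U"
proof -
  have "\<exists>n f. m \<ge> M \<longrightarrow> visited n f \<and> (\<forall>c d. rdz_station {1..n} f c d (es m)) \<and> fst (snd (es m)) \<noteq> Bcast" for m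
    using locally_reusable_station[OF loc] by blast
  then have "\<exists>n f. e \<in> es ` {M..} \<longrightarrow> visited n f \<and> (\<forall>c d. rdz_station {1..n} f c d e) \<and> fst (snd e) \<noteq> Bcast" for e
    by (metis (no_types, lifting) atLeast_iff imageE)
  then obtain n f where nf: "\<And>e. e \<in> es ` {M..} \<Longrightarrow> visited (n e) (f e) \<and>
      (\<forall>c d. rdz_station {1..n e} (f e) c d e) \<and> fst (snd e) \<noteq> Bcast"
    by metis
  have nb: "fst (snd (es m)) \<noteq> Bcast" if "m \<ge> M" for m using nf[of "es m"] that by blast
  have bc: "bcount es m = bcount es M" if "m \<ge> M" for m
    using that by (induction rule: dec_induct) (simp_all add: bcount_Suc nb)
  have fin: "finite (es ` {M..})"
    using finite_U_edges path(2) by (auto intro: finite_subset)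
  show ?thesis
  \<comment> \<open>No group is ever used up: the bound \<open>b\<close> is 0, and two copies of
    each group give the required \<open>b + 2\<close>.\<close>
  proof (rule stations_exec[where \<Gamma> = "es ` {M..} \<times> {..<2::nat}" and n = "\<lambda>\<gamma>. n (fst \<gamma>)"
        and d = "\<lambda>\<gamma> _. f (fst \<gamma>)" and M = M and u = "\<lambda>_. 0" and dark = "\<lambda>_. False" and b = 0, OF path])
    show "finite (es ` {M..} \<times> {..<2::nat})" using fin by simp
    show "f (fst \<gamma>) i \<in> states U \<and> snd (f (fst \<gamma>) i) = phase (bcount es M)"
      if g: "\<gamma> \<in> es ` {M..} \<times> {..<2::nat}" "i \<in> {1..n (fst \<gamma>)}" for \<gamma> i
    proof -
      obtain m where m: "m \<ge> M" "fst \<gamma> = es m" using g(1) by auto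
      have v: "visited (n (es m)) (f (es m))" "rdz_station {1..n (es m)} (f (es m)) (f (es m)) False (es m)"
        using nf[of "es m"] m(1) by auto
      obtain N where N: "\<forall>i\<in>{1..n (es m)}. snd (f (es m) i) = phase N" "\<forall>i\<in>{1..n (es m)}. f (es m) i \<in> states U"
        using visited_states[OF v(1)] by blast
      obtain j where "j \<in> {1..n (es m)}" "f (es m) j = fst (es m)"
        using rdz_station_source[OF v(2)] by blast
      then have "phase N = snd (fst (es m))" using N(1) by metis
      also have "\<dots> = phase (bcount es M)" using path_load[OF path, of m] bc[OF m(1)] by simp
      finally show ?thesis using N g(2) m(2) by simp
    qed
    show "\<exists>\<Gamma>'\<subseteq>es ` {M..} \<times> {..<2::nat}. card \<Gamma>' \<ge> 0 + 2 \<and> (\<forall>\<gamma>\<in>\<Gamma>'.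
      if fst (snd (es m)) = Bcast then bc_station {1..n (fst \<gamma>)} (f (fst \<gamma>)) (f (fst \<gamma>)) (es m)
      else rdz_station {1..n (fst \<gamma>)} (f (fst \<gamma>)) (f (fst \<gamma>)) False (es m))" if "m \<ge> M" for m
    proof (intro exI[of _ "{es m} \<times> {..<2::nat}"] conjI)
      show "{es m} \<times> {..<2::nat} \<subseteq> es ` {M..} \<times> {..<2::nat}" using that by auto
    qed (use nf[of "es m"] that in auto)
  qed (use nb in auto)
qed

lemma phase_periodic:
  assumes "phase (T + L) = phase T"
  shows "phase (T + x + L * q) = phase (T + x)"
proof (induction q)
  case (Suc q)
  have "T + x + L * Suc q = (T + L) + (x + L * q)" by simp
  then have "phase (T + x + L * Suc q) = (nxt ^^ (x + L * q)) (phase (T + L))"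
    by (simp only: phase_add)
  also have "\<dots> = phase (T + (x + L * q))" unfolding assms by (simp only: phase_add)
  finally show ?case using Suc by (simp add: add.assoc)
qed simp

text \<open>All cycles advance with every broadcast, so they are given the common period
  \<open>L\<close>, after which the phase repeats too. One window of \<open>L\<close> broadcast
  counts then suffices for the shifts, and finitely many groups serve the whole path.\<close>

lemma green_exec:
  assumes path: "fst (es 0) \<in> inits U" "\<And>m. es m \<in> edges U" "\<And>m. fst (es (Suc m)) = snd (snd (es m))"
    and grn: "\<And>m. m \<ge> M \<Longrightarrow> green k A U (es m)"
    and u: "\<And>m. m \<ge> M \<Longrightarrow> fst (snd (es m)) \<noteq> Bcast \<Longrightarrow>
      u (Suc m) = (if dark_green k A U (es m) then Suc (u m) else u m)"
    and ub: "\<And>m. u m \<le> b"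
  shows "(\<lambda>m. label U (fst (es m))) \<in> exec_inf k A U"
proof -
  define E where "E = es ` {M..}"
  have fin: "finite E" unfolding E_def using finite_U_edges path(2) by (auto intro: finite_subset)
  have "\<exists>n c B. e \<in> E \<longrightarrow> visited n (c 0) \<and> (\<forall>x. c (x + Suc B) = c x) \<and> (\<forall>x. brd {1..n} (c x) (c (Suc x))) \<and>
    (if fst (snd e) = Bcast then bc_station {1..n} (c 0) (c 1) e
     else rdz_station {1..n} (c 0) (c 1) (dark_green k A U e) e)" for e
    using green_station[of e] grn unfolding E_def by blast
  then obtain n c B where st: "\<And>e. e \<in> E \<Longrightarrow> visited (n e) (c e 0) \<and> (\<forall>x. c e (x + Suc (B e)) = c e x) \<and>
    (\<forall>x. brd {1..n e} (c e x) (c e (Suc x))) \<and>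
    (if fst (snd e) = Bcast then bc_station {1..n e} (c e 0) (c e 1) e
     else rdz_station {1..n e} (c e 0) (c e 1) (dark_green k A U e) e)"
    by metis
  \<comment> \<open>Any positive common multiple of the cycle lengths would do.\<close>
  define L where "L = (\<Prod>e\<in>E. Suc (B e))"
  have L0: "L > 0" unfolding L_def by (intro prod_pos) simp
  have per: "c e (x + L * q) = c e x" if e: "e \<in> E" for e x q
  proof -
    have "Suc (B e) dvd L" unfolding L_def by (rule dvd_prodI[OF fin e])
    then obtain z where "L = Suc (B e) * z" by blast
    then have Lq: "L * q = Suc (B e) * (z * q)" by (simp only: mult.assoc)
    have "c e (x + Suc (B e) * y) = c e x" for y
    proof (induction y)
      case (Suc y)
      have "x + Suc (B e) * Suc y = (x + Suc (B e) * y) + Suc (B e)" by simp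
      then show ?case using st[OF e] Suc by metis
    qed simp
    then show ?thesis unfolding Lq .
  qed
  have start: "\<exists>j\<in>{1..n e}. c e 0 j = fst e" if e: "e \<in> E" for e
  proof (cases "fst (snd e) = Bcast")
    case True
    then have "bc_station {1..n e} (c e 0) (c e 1) e" using st[OF e] by simp
    then show ?thesis by (rule bc_station_source)
  next
    case False
    then have "rdz_station {1..n e} (c e 0) (c e 1) (dark_green k A U e) e" using st[OF e] by simp
    then show ?thesis by (rule rdz_station_source)
  qed
  have conf: "c e x i \<in> states U \<and> snd (c e x i) = (nxt ^^ x) (snd (fst e))"
    if e: "e \<in> E" and i: "i \<in> {1..n e}" for e x i
  proof (induction x)
    case 0
    obtain N where N: "\<forall>i\<in>{1..n e}. snd (c e 0 i) = phase N" "\<forall>i\<in>{1..n e}. c e 0 i \<in> states U"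
      using visited_states st[OF e] by blast
    have "phase N = snd (fst e)" using N(1) start[OF e] by metis
    then show ?case using N i by simp
  next
    case (Suc x)
    have "brd {1..n e} (c e x) (c e (Suc x))" using st[OF e] by blast
    from brd_phase_states[OF this i] show ?case using Suc by simp
  qed
  let ?T = "bcount es"
  have src: "snd (fst (es m)) = phase (?T m)" for m using path_load[OF path, of m] by blast
  have Tmono: "?T M \<le> ?T m" if "m \<ge> M" for m
    using that by (induction rule: dec_induct) (simp_all add: bcount_Suc)
  have eM: "es M \<in> E" by (simp add: E_def)
  \<comment> \<open>The group of \<open>es M\<close> is back in \<open>c (es M) 0\<close> after
    \<open>L\<close> broadcasts, and its configurations determine the phase.\<close>
  have "phase (?T M + L) = phase (?T M)"
  proof -
    obtain j where j: "j \<in> {1..n (es M)}" using start[OF eM] by blast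
    have "c (es M) L = c (es M) 0" using per[OF eM, of 0 1] by simp
    then show ?thesis
      using conf[OF eM j, of 0] conf[OF eM j, of L] src[of M] by (simp add: phase_add)
  qed
  note phase_per = phase_periodic[OF this]
  \<comment> \<open>The group \<open>(e, N, q)\<close> is the \<open>q\<close>-th copy of the cycle of \<open>e\<close>, shifted so that \<open>e\<close> is next
    whenever the number of broadcasts is congruent to \<open>N\<close> modulo \<open>L\<close>.\<close>
  define \<Gamma> where "\<Gamma> = {(e, N, q). e \<in> E \<and> N \<in> {?T M..<?T M + L} \<and> phase N = snd (fst e) \<and> q < b + 2}"
  \<comment> \<open>The summand \<open>L\<close> keeps the subtraction from being cut off at 0,
    since the shift is below \<open>?T M + L\<close>; by periodicity it does no harm.\<close>
  define d where "d \<gamma> T = c (fst \<gamma>) (T + L - fst (snd \<gamma>))"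
    for \<gamma> :: "(('s \<times> nat, 'a) edge \<times> nat \<times> nat)" and T
  have dSuc: "d \<gamma> (Suc T) = c (fst \<gamma>) (Suc (T + L - fst (snd \<gamma>)))" if "\<gamma> \<in> \<Gamma>" "T \<ge> ?T M" for \<gamma> T
    using that unfolding d_def \<Gamma>_def by (auto simp: Suc_diff_le)
  show ?thesis
  proof (rule stations_exec[where \<Gamma> = \<Gamma> and n = "\<lambda>\<gamma>. n (fst \<gamma>)" and d = d and M = M and u = u
        and dark = "dark_green k A U" and b = b, OF path])
    have "\<Gamma> \<subseteq> E \<times> {?T M..<?T M + L} \<times> {..<b + 2}" unfolding \<Gamma>_def by auto
    then show "finite \<Gamma>" using fin by (auto intro: finite_subset)
    show "d \<gamma> (?T M) i \<in> states U \<and> snd (d \<gamma> (?T M) i) = phase (?T M)"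
      if \<gamma>: "\<gamma> \<in> \<Gamma>" and i: "i \<in> {1..n (fst \<gamma>)}" for \<gamma> i
    proof -
      obtain e N q where g: "\<gamma> = (e, N, q)" "e \<in> E" "N < ?T M + L" "phase N = snd (fst e)"
        using \<gamma> unfolding \<Gamma>_def by auto
      let ?x = "?T M + L - N"
      have "(nxt ^^ ?x) (snd (fst e)) = phase (N + ?x)" unfolding g(4)[symmetric] by (simp only: phase_add)
      also have "\<dots> = phase (?T M)" using g(3) phase_per[of 0 1] by simp
      finally show ?thesis using conf[OF g(2), of i ?x] i g(1) by (simp add: d_def)
    qed
    show "brd {1..n (fst \<gamma>)} (d \<gamma> (?T m)) (d \<gamma> (Suc (?T m)))" if "m \<ge> M" "\<gamma> \<in> \<Gamma>" for m \<gamma>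
    proof -
      have "fst \<gamma> \<in> E" using that(2) unfolding \<Gamma>_def by auto
      then have "brd {1..n (fst \<gamma>)} (c (fst \<gamma>) (?T m + L - fst (snd \<gamma>))) (c (fst \<gamma>) (Suc (?T m + L - fst (snd \<gamma>))))"
        using st by blast
      then show ?thesis unfolding dSuc[OF that(2) Tmono[OF that(1)]] by (simp only: d_def)
    qed
    show "u (Suc m) = (if dark_green k A U (es m) then Suc (u m) else u m)"
      if "m \<ge> M" "fst (snd (es m)) \<noteq> Bcast" for m using u that by blast
    show "u m \<le> b" for m by (rule ub)
    show "\<exists>\<Gamma>'\<subseteq>\<Gamma>. card \<Gamma>' \<ge> b + 2 \<and> (\<forall>\<gamma>\<in>\<Gamma>'.
      if fst (snd (es m)) = Bcast then bc_station {1..n (fst \<gamma>)} (d \<gamma> (?T m)) (d \<gamma> (Suc (?T m))) (es m)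
      else rdz_station {1..n (fst \<gamma>)} (d \<gamma> (?T m)) (d \<gamma> (Suc (?T m))) (dark_green k A U (es m)) (es m))"
      if m: "m \<ge> M" for m
    proof -
      \<comment> \<open>\<open>?T M + y\<close> represents the current broadcast count in the
        window; up to multiples of \<open>L\<close>, its groups are at position 0 of their
        cycles.\<close>
      define y where "y = (?T m - ?T M) mod L"
      define z where "z = (?T m - ?T M) div L"
      let ?N = "?T M + y"
      have Tm: "?T m = ?T M + y + L * z" using Tmono[OF m] by (simp add: y_def z_def)
      have y: "y < L" using L0 by (simp add: y_def)
      have e: "es m \<in> E" using m by (simp add: E_def)
      have "phase (?T m) = phase ?N" using phase_per[of y z] Tm by metis
      then have N: "phase ?N = snd (fst (es m))" using src[of m] by simp
      let ?\<Gamma>' = "{es m} \<times> {?N} \<times> {..<b + 2}"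
      have sub: "?\<Gamma>' \<subseteq> \<Gamma>" using e y N unfolding \<Gamma>_def by auto
      have at: "?T m + L - ?N = 0 + L * Suc z" using Tm by simp
      have d0: "d \<gamma> (?T m) = c (es m) 0" "d \<gamma> (Suc (?T m)) = c (es m) 1" "fst \<gamma> = es m"
        if "\<gamma> \<in> ?\<Gamma>'" for \<gamma>
      proof -
        obtain q where g: "\<gamma> = (es m, ?N, q)" using \<open>\<gamma> \<in> ?\<Gamma>'\<close> by auto
        have "\<gamma> \<in> \<Gamma>" using sub \<open>\<gamma> \<in> ?\<Gamma>'\<close> by blast
        show "fst \<gamma> = es m" using g by simp
        have "d \<gamma> (?T m) = c (es m) (?T m + L - ?N)" unfolding g d_def by simp
        also have "\<dots> = c (es m) 0" unfolding at by (rule per[OF e])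
        finally show "d \<gamma> (?T m) = c (es m) 0" .
        have "d \<gamma> (Suc (?T m)) = c (es m) (Suc (?T m + L - ?N))"
          using dSuc[OF \<open>\<gamma> \<in> \<Gamma>\<close> Tmono[OF m]] g by simp
        also have "\<dots> = c (es m) (1 + L * Suc z)" unfolding at by simp
        also have "\<dots> = c (es m) 1" by (rule per[OF e])
        finally show "d \<gamma> (Suc (?T m)) = c (es m) 1" .
      qed
      show ?thesis
      proof (intro exI[of _ ?\<Gamma>'] conjI ballI sub)
        show "card ?\<Gamma>' \<ge> b + 2" by (simp add: card_cartesian_product)
        fix \<gamma> assume "\<gamma> \<in> ?\<Gamma>'"
        from d0[OF this] st[OF e]
        show "if fst (snd (es m)) = Bcast
          then bc_station {1..n (fst \<gamma>)} (d \<gamma> (?T m)) (d \<gamma> (Suc (?T m))) (es m)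
          else rdz_station {1..n (fst \<gamma>)} (d \<gamma> (?T m)) (d \<gamma> (Suc (?T m))) (dark_green k A U (es m)) (es m)"
          by metis
      qed
    qed
  qed
qed

section \<open>Forgetting components\<close>

text \<open>The projection maps edges of the unwinding to edges of \<open>P\<close> and keeps the
  labels and the moments at which process 1 moves.\<close>

lemma exec_inf_U_P:
  assumes "(\<lambda>m. label U (fst (es m))) \<in> exec_inf k A U"
  shows "(\<lambda>m. label U (fst (es m))) \<in> exec_inf k A P"
proof -
  obtain n \<rho> ds where n: "n \<ge> 1" and run: "inf_run k A U n \<rho>" and ds: "edge_sequence n \<rho> 1 ds"
    and w: "(\<lambda>m. label U (fst (es m))) = (\<lambda>m. label U (fst (ds m)))"
    using assms unfolding exec_inf_def by blast
  define pr :: "('s \<times> nat) config \<Rightarrow> 's config" where "pr f = restrict (\<lambda>i. fst (f i)) {1..n}" for f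
  define \<rho>' where "\<rho>' j = (pr (fst (\<rho> j)), fst (snd (\<rho> j)), pr (snd (snd (\<rho> j))))" for j
  have U_P: "fst x \<in> states P" if x: "x \<in> states U" for x
  proof -
    obtain s i where "x = (s, i)" "s \<in> unw_states k P i" using x unfolding U_simps by blast
    then show ?thesis using unw_states_subset[of i] by auto
  qed
  have U_P_edge: "(fst x, \<sigma>, fst y) \<in> edges P" if "(x, \<sigma>, y) \<in> edges U" for x \<sigma> y
    using that by (cases x, cases y) (auto dest: U_edge_fst)
  have conf: "pr f \<in> configs P n" if "f \<in> configs U n" for f
    unfolding pr_def configs_def restrict_PiE_iff
  proof
    fix i assume "i \<in> {1..n}"
    with that have "f i \<in> states U" unfolding configs_def by (rule PiE_mem)
    then show "fst (f i) \<in> states P" by (rule U_P)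
  qed
  have trans: "\<rho>' j \<in> sys_trans k A P n" for j
  proof -
    have "\<rho> j \<in> sys_trans k A U n" using run by (simp add: inf_run_def)
    then show ?thesis
    proof (cases rule: sys_transE)
      case (broadcast f g)
      have "(pr f, GBcast, pr g) \<in> sys_trans k A P n"
        by (rule sys_trans.broadcast) (use broadcast conf U_P_edge in \<open>auto simp: pr_def\<close>)
      then show ?thesis using broadcast(1) by (simp add: \<rho>'_def)
    next
      case (rendezvous f g a ps)
      have "(pr f, GRdz a ps, pr g) \<in> sys_trans k A P n"
      proof (rule sys_trans.rendezvous)
        show "\<forall>j<k. (pr f (ps ! j), Rdz a (Suc j), pr g (ps ! j)) \<in> edges P"
        proof (intro allI impI)
          fix j assume j: "j < k"
          then have "ps ! j \<in> {1..n}" using rendezvous(5,7) by (metis nth_mem subsetD)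
          moreover have "(f (ps ! j), Rdz a (Suc j), g (ps ! j)) \<in> edges U" using rendezvous(8) j by blast
          ultimately show "(pr f (ps ! j), Rdz a (Suc j), pr g (ps ! j)) \<in> edges P"
            using U_P_edge by (simp add: pr_def)
        qed
        show "\<forall>i\<in>{1..n} - set ps. pr g i = pr f i" using rendezvous(9) by (simp add: pr_def)
      qed (use rendezvous conf in auto)
      then show ?thesis using rendezvous(1) by (simp add: \<rho>'_def)
    qed
  qed
  have "fst (\<rho>' 0) \<in> init_configs P n"
  proof -
    have "fst (\<rho> 0) \<in> init_configs U n" using run by (simp add: inf_run_def)
    then have "fst (\<rho> 0) i \<in> inits U" if "i \<in> {1..n}" for i using that by (auto simp: init_configs_def)
    then have "fst (fst (\<rho> 0) i) \<in> inits P" if "i \<in> {1..n}" for i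
      using that unfolding U_simps by fastforce
    then show ?thesis by (auto simp: \<rho>'_def pr_def init_configs_def)
  qed
  then have run': "inf_run k A P n \<rho>'"
    using trans run unfolding inf_run_def by (simp add: \<rho>'_def)
  have one: "1 \<in> {1..n}" using n by simp
  have tk: "takes n (\<rho>' j) 1 (fst s, \<sigma>, fst t)" if "takes n (\<rho> j) 1 (s, \<sigma>, t)" for j s \<sigma> t
  proof -
    obtain f x g where "\<rho> j = (f, x, g)" by (cases "\<rho> j")
    then show ?thesis using that one by (cases x) (auto simp: \<rho>'_def pr_def)
  qed
  have kt: "\<exists>e. takes n (\<rho> j) 1 e" if "takes n (\<rho>' j) 1 e" for j e
  proof -
    obtain f x g where "\<rho> j = (f, x, g)" by (cases "\<rho> j")
    then have "takes n (\<rho> j) 1 (f 1, fst (snd e), g 1)" using that by (cases x) (auto simp: \<rho>'_def)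
    then show ?thesis by blast
  qed
  define es' where "es' m = (fst (fst (ds m)), fst (snd (ds m)), fst (snd (snd (ds m))))" for m
  have "edge_sequence n \<rho>' 1 es'"
  proof -
    obtain h :: "nat \<Rightarrow> nat" where h: "strict_mono h" "range h = {j. \<exists>e. takes n (\<rho> j) 1 e}"
      "\<forall>m. takes n (\<rho> (h m)) 1 (ds m)"
      using ds unfolding edge_sequence_def by blast
    have "{j. \<exists>e. takes n (\<rho> j) 1 e} = {j. \<exists>e. takes n (\<rho>' j) 1 e}"
    proof (intro Collect_cong iffI)
      fix j assume "\<exists>e. takes n (\<rho> j) 1 e"
      then obtain s \<sigma> t where "takes n (\<rho> j) 1 (s, \<sigma>, t)" by (metis prod.exhaust)
      then show "\<exists>e. takes n (\<rho>' j) 1 e" using tk by blast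
    qed (use kt in blast)
    moreover have "takes n (\<rho>' (h m)) 1 (es' m)" for m
      using h(3)[rule_format, of m] tk[of "h m" "fst (ds m)"] unfolding es'_def by simp
    ultimately show ?thesis using h(1,2) unfolding edge_sequence_def by auto
  qed
  moreover have "(\<lambda>m. label U (fst (ds m))) = (\<lambda>m. label P (fst (es' m)))"
    by (simp add: U_label es'_def)
  ultimately show ?thesis unfolding w exec_inf_def using n run' by blast
qed

section \<open>From accepting runs to executions\<close>

abbreviation B :: "(mode \<times> 's \<times> nat, 'p set, ('s \<times> nat, 'a) edge) bautomaton" where
  "B \<equiv> template_automaton k A P"

lemma B_simps:
  "ba_alphabet B = Pow (props P)" "ba_inits B = {Init} \<times> inits U"
  "ba_good B = {Init, Grn, Loc} \<times> states U"
  by (simp_all add: template_automaton_def Let_def U_simps)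

lemma B_trans_iff:
  "((x, s), l, e, (y, t)) \<in> ba_trans B \<longleftrightarrow>
    e \<in> edges U \<and> fst e = s \<and> snd (snd e) = t \<and> l = label U s \<and>
    (x = Init \<or> x = Grn \<and> y = Grn \<and> green k A U e \<or> x = Loc \<and> y = Loc \<and> locally_reusable k A U e)"
  by (cases e; cases y) (auto simp: template_automaton_def Let_def)

lemma B_cc:
  "ba_cc B ((x, s), l, e, q) = (case x of Init \<Rightarrow> Inc
     | Grn \<Rightarrow> (if fst (snd e) \<noteq> Bcast \<and> dark_green k A U e then Inc
              else if fst (snd e) = Bcast then Reset else Skip)
     | Loc \<Rightarrow> Skip)"
  by (cases e) (simp add: template_automaton_def Let_def split: mode.split)

lemma label_U_props: "x \<in> states U \<Longrightarrow> label U x \<in> Pow (props P)"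
proof -
  assume "x \<in> states U"
  then obtain s i where "x = (s, i)" "s \<in> unw_states k P i" unfolding U_simps by blast
  then have "fst x \<in> states P" using unw_states_subset[of i] by auto
  then show ?thesis using template by (simp add: U_label rb_template_def finite_lts_def)
qed

text \<open>The tags of the transitions spell out a path of the unwinding. \<open>Init\<close> only
  increments, so a bounded counter forces it to be left, and the mode entered then is never
  left.\<close>

lemma language_subset: "ba_language B \<subseteq> exec_inf k A P"
proof
  fix w assume "w \<in> ba_language B"
  then obtain q es b where run: "ba_run B w q es"
    and bound: "\<And>i. counter (\<lambda>j. ba_cc B (q j, w j, es j, q (Suc j))) i \<le> b"
    unfolding ba_language_def ba_accepting_def by blast
  define md where "md i = fst (q i)" for i
  define cs where "cs j = ba_cc B (q j, w j, es j, q (Suc j))" for j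
  have q: "q i = (md i, snd (q i))" for i by (simp add: md_def)
  have tr: "es i \<in> edges U \<and> fst (es i) = snd (q i) \<and> snd (snd (es i)) = snd (q (Suc i)) \<and>
      w i = label U (snd (q i)) \<and> (md i = Init \<or> md i = Grn \<and> md (Suc i) = Grn \<and> green k A U (es i) \<or>
        md i = Loc \<and> md (Suc i) = Loc \<and> locally_reusable k A U (es i))" for i
  proof -
    have "(q i, w i, es i, q (Suc i)) \<in> ba_trans B" using run by (simp add: ba_run_def)
    then show ?thesis using B_trans_iff q by metis
  qed
  have cs: "cs j = (case md j of Init \<Rightarrow> Inc
     | Grn \<Rightarrow> (if fst (snd (es j)) \<noteq> Bcast \<and> dark_green k A U (es j) then Inc
              else if fst (snd (es j)) = Bcast then Reset else Skip)
     | Loc \<Rightarrow> Skip)" for j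
    unfolding cs_def using B_cc[of "md j" "snd (q j)"] q[of j] by metis
  have path: "fst (es 0) \<in> inits U" "\<And>m. es m \<in> edges U" "\<And>m. fst (es (Suc m)) = snd (snd (es m))"
  proof -
    have "q 0 \<in> {Init} \<times> inits U" using run by (simp add: ba_run_def B_simps)
    then have "snd (q 0) \<in> inits U" by auto
    then show "fst (es 0) \<in> inits U" using tr[of 0] by simp
  qed (use tr in auto)
  have w: "w = (\<lambda>m. label U (fst (es m)))" using tr by auto
  have "\<exists>M. md M \<noteq> Init"
  proof (rule ccontr)
    assume "\<nexists>M. md M \<noteq> Init"
    then have "counter cs i = i" for i by (induction i) (simp_all add: cs)
    then have "counter cs (Suc b) = Suc b" by blast
    moreover have "counter cs (Suc b) \<le> b" using bound[of "Suc b"] unfolding cs_def[symmetric] .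
    ultimately show False by linarith
  qed
  then obtain M where M: "md M \<noteq> Init" by blast
  have "(\<lambda>m. label U (fst (es m))) \<in> exec_inf k A U"
  proof (cases "md M")
    case Loc
    have "md m = Loc" if "m \<ge> M" for m
      using that by (induction rule: dec_induct) (use Loc tr in \<open>metis mode.distinct\<close>)+
    then have "locally_reusable k A U (es m)" if "m \<ge> M" for m using that tr[of m] by auto
    from local_exec[OF path this] show ?thesis by blast
  next
    case Grn
    have g: "md m = Grn" if "m \<ge> M" for m
      using that by (induction rule: dec_induct) (use Grn tr in \<open>metis mode.distinct\<close>)+
    then have "green k A U (es m)" if "m \<ge> M" for m using that tr[of m] by auto
    \<comment> \<open>Apart from broadcasts, the counter grows exactly at the dark green edges, so
      it can serve as the bound \<open>u\<close> on the groups used up.\<close>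
    from green_exec[where u = "counter cs" and b = b, OF path this]
    show ?thesis using g bound cs unfolding cs_def[symmetric] by auto
  qed (use M in simp)
  then show "w \<in> exec_inf k A P" unfolding w by (rule exec_inf_U_P)
qed

section \<open>Accepting executions\<close>

text \<open>The component is the phase of the number of broadcasts so far. A rendezvous survives in
  the unwinding because its other participants are the partners that saturation asks for.\<close>

lemma lift_run:
  assumes run: "inf_run k A P n \<rho>" and n: "n \<ge> 1" and es: "edge_sequence n \<rho> 1 es"
  shows "\<exists>\<rho>' ds. inf_run k A U n \<rho>' \<and> edge_sequence n \<rho>' 1 ds \<and>
    (\<lambda>m. label P (fst (es m))) = (\<lambda>m. label U (fst (ds m)))"
proof -
  define b where "b j = rec_nat 0 (\<lambda>i x. if is_broadcast (\<rho> i) then Suc x else x) j" for j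
  have b: "b 0 = 0" "b (Suc j) = (if is_broadcast (\<rho> j) then Suc (b j) else b j)" for j
    by (simp_all add: b_def)
  define f where "f j = fst (\<rho> j)" for j
  define g where "g j = restrict (\<lambda>i. (f j i, phase (b j))) {1..n}" for j
  define \<rho>' where "\<rho>' j = (g j, fst (snd (\<rho> j)), g (Suc j))" for j
  have \<rho>: "\<rho> j \<in> sys_trans k A P n" "snd (snd (\<rho> j)) = f (Suc j)" for j
    using run by (auto simp: inf_run_def f_def)
  have bc_edge: "((s, phase N), Bcast, (t, phase (Suc N))) \<in> edges U \<and> t \<in> unw_states k P (phase (Suc N))"
    if "s \<in> unw_states k P (phase N)" "(s, Bcast, t) \<in> edges P" for s t N
  proof -
    have "((s, phase N), Bcast, (t, phase (Suc N))) \<in> edges U"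
      using that phase_le by (simp add: U_edge_iff phase_Suc)
    moreover from U_edge_states[OF this] have "t \<in> unw_states k P (phase (Suc N))"
      unfolding U_simps by simp
    ultimately show ?thesis by blast
  qed
  have step: "(\<forall>i\<in>{1..n}. f (Suc j) i \<in> unw_states k P (phase (b (Suc j)))) \<and> \<rho>' j \<in> sys_trans k A U n"
    if inv: "\<forall>i\<in>{1..n}. f j i \<in> unw_states k P (phase (b j))" for j
  proof -
    have gU: "g j \<in> configs U n" if "\<forall>i\<in>{1..n}. f j i \<in> unw_states k P (phase (b j))" for j
      using that phase_le unfolding g_def configs_def U_simps by auto
    from \<rho>(1)[of j] show ?thesis
    proof (cases rule: sys_transE)
      case (broadcast f' g')
      then have f': "f' = f j" "g' = f (Suc j)" using \<rho>(2)[of j] by (auto simp: f_def)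
      have bj: "b (Suc j) = Suc (b j)" using broadcast(1) by (simp add: b)
      have E: "((f j i, phase (b j)), Bcast, (f (Suc j) i, phase (b (Suc j)))) \<in> edges U \<and>
          f (Suc j) i \<in> unw_states k P (phase (b (Suc j)))" if "i \<in> {1..n}" for i
        unfolding bj using bc_edge inv broadcast(4) that f' by blast
      have "(g j, GBcast, g (Suc j)) \<in> sys_trans k A U n"
        by (rule sys_trans.broadcast) (use gU inv E in \<open>auto simp: g_def\<close>)
      then show ?thesis using E broadcast(1) by (simp add: \<rho>'_def)
    next
      case (rendezvous f' g' a ps)
      then have f': "f' = f j" "g' = f (Suc j)" using \<rho>(2)[of j] by (auto simp: f_def)
      have bj: "b (Suc j) = b j" using rendezvous(1) by (simp add: b)
      have ps: "ps ! l \<in> {1..n}" if "l < k" for l using that rendezvous(5,7) by (metis nth_mem subsetD)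
      have R: "(f j (ps ! l), Rdz a (Suc l), f (Suc j) (ps ! l)) \<in> unw_edges k P (phase (b j))" if l: "l < k" for l
      proof (rule sat_states_sat_edges.edge)
        show "(f j (ps ! l), Rdz a (Suc l), f (Suc j) (ps ! l)) \<in> edges P" using rendezvous(8) l f' by blast
        show "f j (ps ! l) \<in> unw_states k P (phase (b j))" using inv ps[OF l] by blast
        show "\<forall>h\<in>{1..k} - {Suc l}. \<exists>s' t'. (s', Rdz a h, t') \<in> edges P \<and> s' \<in> unw_states k P (phase (b j))"
        proof
          fix h assume "h \<in> {1..k} - {Suc l}"
          then obtain l' where l': "h = Suc l'" "l' < k" by (cases h) auto
          then have "(f j (ps ! l'), Rdz a h, f (Suc j) (ps ! l')) \<in> edges P" using rendezvous(8) f' by blast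
          then show "\<exists>s' t'. (s', Rdz a h, t') \<in> edges P \<and> s' \<in> unw_states k P (phase (b j))"
            using inv ps[OF l'(2)] by blast
        qed
      qed (use l in simp)
      have inv': "\<forall>i\<in>{1..n}. f (Suc j) i \<in> unw_states k P (phase (b (Suc j)))"
      proof
        fix i assume i: "i \<in> {1..n}"
        show "f (Suc j) i \<in> unw_states k P (phase (b (Suc j)))"
        proof (cases "i \<in> set ps")
          case True
          then obtain l where "l < k" "i = ps ! l" using rendezvous(5) by (metis in_set_conv_nth)
          then show ?thesis using sat_edges_target[OF R] unfolding bj by simp
        next
          case False
          then show ?thesis using rendezvous(9) f' i inv unfolding bj by simp
        qed
      qed
      have "(g j, GRdz a ps, g (Suc j)) \<in> sys_trans k A U n"
      proof (rule sys_trans.rendezvous)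
        show "\<forall>l<k. (g j (ps ! l), Rdz a (Suc l), g (Suc j) (ps ! l)) \<in> edges U"
          using R ps phase_le by (simp add: g_def U_edge_iff bj)
        show "\<forall>i\<in>{1..n} - set ps. g (Suc j) i = g j i" using rendezvous(9) f' by (simp add: g_def bj)
      qed (use rendezvous gU inv inv' in auto)
      then show ?thesis using inv' rendezvous(1) by (simp add: \<rho>'_def)
    qed
  qed
  have init: "f 0 i \<in> inits P" if "i \<in> {1..n}" for i
    using that run by (auto simp: inf_run_def init_configs_def f_def)
  have inv: "\<forall>i\<in>{1..n}. f j i \<in> unw_states k P (phase (b j))" for j
  proof (induction j)
    case 0
    then show ?case using init by (auto simp: b phase_0 intro: sat_states_sat_edges.init)
  next
    case (Suc j)
    then show ?case using step by blast
  qed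
  have "g 0 \<in> init_configs U n"
    using init by (auto simp: g_def init_configs_def U_simps b phase_0)
  then have run': "inf_run k A U n \<rho>'" using step inv by (auto simp: inf_run_def \<rho>'_def)
  have one: "1 \<in> {1..n}" using n by simp
  define up where "up j e = ((fst e, phase (b j)), fst (snd e), (snd (snd e), phase (b (Suc j))))"
    for j and e :: "('s, 'a) edge"
  have tk: "takes n (\<rho>' j) 1 (up j e)" if "takes n (\<rho> j) 1 e" for j e
  proof -
    obtain x where x: "\<rho> j = (f j, x, f (Suc j))" using \<rho>(2)[of j] unfolding f_def by (metis prod.collapse)
    then show ?thesis using that one by (cases x) (auto simp: \<rho>'_def g_def up_def)
  qed
  have kt: "\<exists>e. takes n (\<rho> j) 1 e" if "takes n (\<rho>' j) 1 e" for j e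
  proof -
    obtain x where "\<rho> j = (f j, x, f (Suc j))" using \<rho>(2)[of j] unfolding f_def by (metis prod.collapse)
    then have "takes n (\<rho> j) 1 (f j 1, fst (snd e), f (Suc j) 1)"
      using that by (cases x) (auto simp: \<rho>'_def)
    then show ?thesis by blast
  qed
  obtain h :: "nat \<Rightarrow> nat" where h: "strict_mono h" "range h = {j. \<exists>e. takes n (\<rho> j) 1 e}"
    "\<forall>m. takes n (\<rho> (h m)) 1 (es m)"
    using es unfolding edge_sequence_def by blast
  have "{j. \<exists>e. takes n (\<rho> j) 1 e} = {j. \<exists>e. takes n (\<rho>' j) 1 e}" using tk kt by blast
  then have "edge_sequence n \<rho>' 1 (\<lambda>m. up (h m) (es m))"
    using h tk unfolding edge_sequence_def by (intro exI[of _ h]) auto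
  moreover have "label P (fst (es m)) = label U (fst (up (h m) (es m)))" for m
    by (simp add: up_def U_label split: prod.split)
  ultimately show ?thesis using run' by blast
qed

text \<open>Process 1 keeps its state at positions outside the range of \<open>h\<close>, so the
  edges it takes fit together.\<close>

lemma edge_sequence_path:
  assumes run: "inf_run k A U n \<rho>" and n: "n \<ge> 1" and h: "strict_mono (h :: nat \<Rightarrow> nat)"
    "range h = {j. \<exists>e. takes n (\<rho> j) 1 e}" "\<And>m. takes n (\<rho> (h m)) 1 (es m)"
  shows "fst (es 0) \<in> inits U" "es m \<in> edges U" "fst (es (Suc m)) = snd (snd (es m))"
    "fst (snd (es m)) = Bcast \<longleftrightarrow> is_broadcast (\<rho> (h m))"
proof -
  define f where "f j = fst (\<rho> j) 1" for j
  have one: "1 \<in> {1..n}" using n by simp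
  have \<rho>: "\<rho> j \<in> sys_trans k A U n" "snd (snd (\<rho> j)) = fst (\<rho> (Suc j))" for j
    using run by (auto simp: inf_run_def)
  have mv: "fst e = f j \<and> snd (snd e) = f (Suc j) \<and> e \<in> edges U \<and> (fst (snd e) = Bcast \<longleftrightarrow> is_broadcast (\<rho> j))"
    if tk: "takes n (\<rho> j) 1 e" for j e
    using \<rho>(1)[of j]
  proof (cases rule: sys_trans_steps)
    case bcast
    then show ?thesis using tk one \<rho>(2)[of j] by (auto simp: bst_def f_def)
  next
    case (rdz m)
    obtain \<sigma> where "m 1 = Some \<sigma>" "e = (fst (\<rho> j) 1, \<sigma>, snd (snd (\<rho> j)) 1)" using tk rdz(3) by blast
    then show ?thesis using rst_edge[OF rdz(2), of 1 \<sigma>] rdz(1) \<rho>(2)[of j] by (simp add: f_def)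
  qed
  have stay: "f (Suc j) = f j" if "\<nexists>e. takes n (\<rho> j) 1 e" for j
    using \<rho>(1)[of j]
  proof (cases rule: sys_trans_steps)
    case bcast
    then show ?thesis using that one by blast
  next
    case (rdz m)
    then have "m 1 = None" using that by (cases "m 1") auto
    then show ?thesis using rst_idle[OF rdz(2)] \<rho>(2)[of j] by (simp add: f_def)
  qed
  have const: "f j = f i" if "i \<le> j" "\<And>l. l \<in> {i..<j} \<Longrightarrow> l \<notin> range h" for i j
    using that
  proof (induction rule: dec_induct)
    case (step l)
    then have "\<nexists>e. takes n (\<rho> l) 1 e" using h(2) by auto
    then show ?case using stay step by auto
  qed simp
  have inits: "f 0 \<in> inits U" using run one by (auto simp: inf_run_def init_configs_def f_def)
  have "f (h 0) = f 0"
  proof (rule const)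
    fix l assume "l \<in> {0..<h 0}"
    then show "l \<notin> range h" using strict_mono_less[OF h(1), of _ 0] by auto
  qed simp
  then show "fst (es 0) \<in> inits U" using mv[OF h(3)[of 0]] inits by simp
  show "es m \<in> edges U" "fst (snd (es m)) = Bcast \<longleftrightarrow> is_broadcast (\<rho> (h m))" using mv[OF h(3)[of m]] by auto
  have "f (h (Suc m)) = f (Suc (h m))"
  proof (rule const)
    show "Suc (h m) \<le> h (Suc m)" using h(1) by (simp add: Suc_leI strict_mono_Suc_iff)
    fix l assume l: "l \<in> {Suc (h m)..<h (Suc m)}"
    show "l \<notin> range h"
    proof
      assume "l \<in> range h"
      then obtain x where "l = h x" by blast
      then have "h m < h x" "h x < h (Suc m)" using l by auto
      then have "m < x" "x < Suc m" using strict_mono_less[OF h(1)] by blast+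
      then show False by simp
    qed
  qed
  then show "fst (es (Suc m)) = snd (snd (es m))" using mv[OF h(3)[of m]] mv[OF h(3)[of "Suc m"]] by simp
qed

text \<open>The automaton stays in \<open>Init\<close> for \<open>M\<close> steps, which raises the
  counter to \<open>M\<close>, and then in mode \<open>x\<close>. \<open>M\<close> is positive
  because runs start in \<open>Init\<close>.\<close>

lemma accepted:
  assumes path: "fst (es 0) \<in> inits U" "\<And>m. es m \<in> edges U" "\<And>m. fst (es (Suc m)) = snd (snd (es m))"
    and M: "M \<ge> 1"
    and md: "x = Loc \<and> (\<forall>m\<ge>M. locally_reusable k A U (es m)) \<or>
      x = Grn \<and> (\<forall>m\<ge>M. green k A U (es m)) \<and>
        (\<forall>l m. M \<le> l \<longrightarrow> l \<le> m \<longrightarrow> (\<forall>i\<in>{l..<m}. fst (snd (es i)) \<noteq> Bcast) \<longrightarrow>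
          card {i \<in> {l..<m}. dark_green k A U (es i)} \<le> K)"
  shows "(\<lambda>m. label U (fst (es m))) \<in> ba_language B"
proof -
  define q where "q m = (if m < M then Init else x, fst (es m))" for m
  let ?w = "\<lambda>m. label U (fst (es m))"
  have st: "fst (es m) \<in> states U" for m using path(2)[of m] U_edge_states by (metis prod.collapse)
  have "(q m, ?w m, es m, q (Suc m)) \<in> ba_trans B" for m
    using md path(2,3) unfolding q_def B_trans_iff by auto
  then have "ba_run B ?w q es"
    using path(1) M by (auto simp: ba_run_def B_simps q_def)
  moreover have "ba_accepting B ?w q es"
    unfolding ba_accepting_def
  proof
    have "q i \<in> ba_good B" for i using st md by (auto simp: B_simps q_def)
    then show "infinite {i. q i \<in> ba_good B}" by simp
    define cs where "cs j = ba_cc B (q j, ?w j, es j, q (Suc j))" for j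
    have cs: "cs j = (if j < M then Inc else case x of Init \<Rightarrow> Inc
     | Grn \<Rightarrow> (if fst (snd (es j)) \<noteq> Bcast \<and> dark_green k A U (es j) then Inc
              else if fst (snd (es j)) = Bcast then Reset else Skip)
     | Loc \<Rightarrow> Skip)" for j
      unfolding cs_def q_def B_cc by simp
    have low: "counter cs m = m" if "m \<le> M" for m
      using that by (induction m) (simp_all add: cs)
    have "counter cs m \<le> M + K" for m
    proof (cases "m \<le> M")
      case True
      then show ?thesis using low by simp
    next
      case False
      from md show ?thesis
      proof
        assume x: "x = Loc \<and> (\<forall>m\<ge>M. locally_reusable k A U (es m))"
        have "M \<le> m" using False by simp
        then have "counter cs m = M"
        proof (induction rule: dec_induct)
          case (step m)
          then have "cs m = Skip" using x by (simp add: cs)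
          then show ?case using step.IH by simp
        qed (use low[of M] in simp)
        then show ?thesis by simp
      next
        assume x: "x = Grn \<and> (\<forall>m\<ge>M. green k A U (es m)) \<and>
          (\<forall>l m. M \<le> l \<longrightarrow> l \<le> m \<longrightarrow> (\<forall>i\<in>{l..<m}. fst (snd (es i)) \<noteq> Bcast) \<longrightarrow>
          card {i \<in> {l..<m}. dark_green k A U (es i)} \<le> K)"
        have "M \<le> m" using False by simp
        \<comment> \<open>\<open>l\<close> is the position after the last broadcast since
          \<open>M\<close>, or \<open>M\<close> itself if there is none.\<close>
        then have "\<exists>l. M \<le> l \<and> l \<le> m \<and> (\<forall>i\<in>{l..<m}. fst (snd (es i)) \<noteq> Bcast) \<and>
          counter cs m \<le> M + card {i \<in> {l..<m}. dark_green k A U (es i)}"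
        proof (induction rule: dec_induct)
          case base
          then show ?case using low[of M] by (intro exI[of _ M]) simp
        next
          case (step m)
          then obtain l where l: "M \<le> l" "l \<le> m" "\<forall>i\<in>{l..<m}. fst (snd (es i)) \<noteq> Bcast"
            "counter cs m \<le> M + card {i \<in> {l..<m}. dark_green k A U (es i)}" by blast
          show ?case
          proof (cases "fst (snd (es m)) = Bcast")
            case True
            then have "counter cs (Suc m) = 0" using step(1) x by (simp add: cs)
            then show ?thesis using step(1) by (intro exI[of _ "Suc m"]) simp
          next
            case False
            have "{i \<in> {l..<Suc m}. dark_green k A U (es i)} = {i \<in> {l..<m}. dark_green k A U (es i)} \<union>
              (if dark_green k A U (es m) then {m} else {})"
              using l(2) by (auto simp: less_Suc_eq)
            then have "card {i \<in> {l..<Suc m}. dark_green k A U (es i)} = card {i \<in> {l..<m}. dark_green k A U (es i)} +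
              (if dark_green k A U (es m) then 1 else 0)" by simp
            moreover have "counter cs (Suc m) = counter cs m + (if dark_green k A U (es m) then 1 else 0)"
              using False step(1) x by (simp add: cs)
            moreover have "\<forall>i\<in>{l..<Suc m}. fst (snd (es i)) \<noteq> Bcast"
              using l(3) False by (auto simp: less_Suc_eq)
            ultimately show ?thesis using l by (intro exI[of _ l]) simp
          qed
        qed
        then show ?thesis using x by (meson add_left_mono le_trans)
      qed
    qed
    then show "\<exists>b. \<forall>i. counter (\<lambda>j. ba_cc B (q j, ?w j, es j, q (Suc j))) i \<le> b"
      unfolding cs_def[symmetric] by blast
  qed
  moreover have "?w i \<in> ba_alphabet B" for i using label_U_props[OF st] by (simp only: B_simps)
  ultimately show ?thesis unfolding ba_language_def by blast
qed

text \<open>An edge that is not light green occurs boundedly often between two broadcasts of one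
  run, and process 1 takes part in every broadcast.\<close>

lemma dark_bound:
  assumes run: "inf_run k A U n \<rho>" and n: "n \<ge> 1" and inf: "infinite {j. is_broadcast (\<rho> j)}"
    and h: "strict_mono (h :: nat \<Rightarrow> nat)" "range h = {j. \<exists>e. takes n (\<rho> j) 1 e}"
    "\<And>m. takes n (\<rho> (h m)) 1 (es m)"
  shows "\<exists>K. \<forall>l m. (\<forall>i\<in>{l..<m}. fst (snd (es i)) \<noteq> Bcast) \<longrightarrow>
    card {i \<in> {l..<m}. dark_green k A U (es i)} \<le> K"
proof -
  note path = edge_sequence_path[OF run n h]
  define D where "D = {e \<in> edges U. dark_green k A U e}"
  have fin: "finite D" unfolding D_def using finite_U_edges by simp
  \<comment> \<open>The failure of light greenness is applied to this very run.\<close>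
  have "\<exists>N. \<forall>b c. (\<forall>j\<in>{b..<c}. \<not> is_broadcast (\<rho> j)) \<longrightarrow> card {j \<in> {b..<c}. appears n e (\<rho> j)} < N"
    if "e \<in> D" for e
  proof -
    have "\<not> light_green k A U e" using that by (simp add: D_def dark_green_def)
    then have "\<not> (\<forall>N. \<exists>b c. (\<forall>j\<in>{b..<c}. \<not> is_broadcast (\<rho> j)) \<and>
        N \<le> card {j \<in> {b..<c}. appears n e (\<rho> j)})"
      using run n inf unfolding light_green_def by blast
    then show ?thesis by (meson not_le)
  qed
  then obtain N where N: "\<And>e b c. e \<in> D \<Longrightarrow> \<forall>j\<in>{b..<c}. \<not> is_broadcast (\<rho> j) \<Longrightarrow>
      card {j \<in> {b..<c}. appears n e (\<rho> j)} < N e"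
    by metis
  have "card {i \<in> {l..<m}. dark_green k A U (es i)} \<le> (\<Sum>e\<in>D. N e)"
    if nb: "\<forall>i\<in>{l..<m}. fst (snd (es i)) \<noteq> Bcast" for l m
  proof -
    have free: "\<forall>j\<in>{h l..<h m}. \<not> is_broadcast (\<rho> j)"
    proof (intro ballI notI)
      fix j assume j: "j \<in> {h l..<h m}" and bj: "is_broadcast (\<rho> j)"
      have "\<rho> j \<in> sys_trans k A U n" using run by (simp add: inf_run_def)
      then have "\<exists>e. takes n (\<rho> j) 1 e"
        by (cases rule: sys_trans_steps) (use bj n in auto)
      then obtain i where i: "j = h i" using h(2) by blast
      then have "i \<in> {l..<m}" using j strict_mono_less[OF h(1)] strict_mono_less_eq[OF h(1)] by auto
      moreover have "fst (snd (es i)) = Bcast" using path(4)[of i] bj i by blast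
      ultimately show False using nb by blast
    qed
    have "card {i \<in> {l..<m}. es i = e} \<le> N e" if e: "e \<in> D" for e
    proof -
      \<comment> \<open>As \<open>h\<close> is injective, distinct places on the path give distinct
        positions of the run.\<close>
      have "h ` {i \<in> {l..<m}. es i = e} \<subseteq> {j \<in> {h l..<h m}. appears n e (\<rho> j)}"
        using h(3) n strict_mono_less[OF h(1)] strict_mono_less_eq[OF h(1)]
        unfolding appears_def by fastforce
      then have "card (h ` {i \<in> {l..<m}. es i = e}) \<le> card {j \<in> {h l..<h m}. appears n e (\<rho> j)}"
        by (intro card_mono) auto
      moreover have "card (h ` {i \<in> {l..<m}. es i = e}) = card {i \<in> {l..<m}. es i = e}"
        by (rule card_image, rule inj_on_subset[OF strict_mono_imp_inj_on[OF h(1)] subset_UNIV])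
      ultimately show ?thesis using N[OF e free] by linarith
    qed
    then have "(\<Sum>e\<in>D. card {i \<in> {l..<m}. es i = e}) \<le> (\<Sum>e\<in>D. N e)" by (rule sum_mono)
    moreover have "{i \<in> {l..<m}. dark_green k A U (es i)} = (\<Union>e\<in>D. {i \<in> {l..<m}. es i = e})"
      using path(2) unfolding D_def by auto
    ultimately show ?thesis using card_UN_le[OF fin, of "\<lambda>e. {i \<in> {l..<m}. es i = e}"] by simp
  qed
  then show ?thesis by blast
qed

lemma exec_subset: "exec_inf k A P \<subseteq> ba_language B"
proof
  fix w assume "w \<in> exec_inf k A P"
  then obtain n \<rho>0 es0 where "n \<ge> 1" "inf_run k A P n \<rho>0" "edge_sequence n \<rho>0 1 es0"
    "w = (\<lambda>m. label P (fst (es0 m)))"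
    unfolding exec_inf_def by blast
  then obtain \<rho> es where n: "n \<ge> 1" and run: "inf_run k A U n \<rho>" and seq: "edge_sequence n \<rho> 1 es"
    and w: "w = (\<lambda>m. label U (fst (es m)))"
    using lift_run by metis
  obtain h :: "nat \<Rightarrow> nat" where h: "strict_mono h" "range h = {j. \<exists>e. takes n (\<rho> j) 1 e}"
    "\<And>m. takes n (\<rho> (h m)) 1 (es m)"
    using seq unfolding edge_sequence_def by blast
  note path = edge_sequence_path[OF run n h]
  \<comment> \<open>There are finitely many edges, so those occurring finitely often together occupy
    finitely many positions.\<close>
  define X where "X = {e \<in> edges U. finite {j. appears n e (\<rho> j)}}"
  have "{m. es m \<in> X} \<subseteq> h -` (\<Union>e\<in>X. {j. appears n e (\<rho> j)})"
    using h(3) n unfolding appears_def by fastforce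
  moreover have "finite (h -` (\<Union>e\<in>X. {j. appears n e (\<rho> j)}))"
    by (rule finite_vimageI) (use finite_U_edges strict_mono_imp_inj_on[OF h(1)] in \<open>auto simp: X_def\<close>)
  ultimately have "finite {m. es m \<in> X}" by (rule finite_subset)
  then obtain M0 where M0: "\<And>m. es m \<in> X \<Longrightarrow> m < M0" by (auto simp: finite_nat_set_iff_bounded)
  \<comment> \<open>The successor makes \<open>M\<close> positive, as \<open>accepted\<close>
    demands.\<close>
  define M where "M = Suc M0"
  have often: "infinite {j. appears n (es m) (\<rho> j)}" if "m \<ge> M" for m
    using M0[of m] that path(2)[of m] unfolding X_def M_def by auto
  show "w \<in> ba_language B"
  proof (cases "finite {j. is_broadcast (\<rho> j)}")
    case True
    have "locally_reusable k A U (es m)" if "m \<ge> M" for m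
      using often[OF that] True run n unfolding locally_reusable_def by blast
    then show ?thesis unfolding w by (intro accepted[OF path(1-3), of M Loc]) (auto simp: M_def)
  next
    case False
    have "green k A U (es m)" if "m \<ge> M" for m
      using often[OF that] False run n unfolding green_def by blast
    moreover obtain K where "\<forall>l m. (\<forall>i\<in>{l..<m}. fst (snd (es i)) \<noteq> Bcast) \<longrightarrow>
        card {i \<in> {l..<m}. dark_green k A U (es i)} \<le> K"
      using dark_bound[OF run n False h] by blast
    ultimately show ?thesis unfolding w by (intro accepted[OF path(1-3), of M Grn K]) (auto simp: M_def)
  qed
qed

end

theorem theorem6p6:
  fixes k :: nat and A :: "'a set" and P :: "('s, 'a, 'p) lts"
  assumes "k \<ge> 1" and "finite A" and "rb_template k A P"
  shows "ba_language (template_automaton k A P) = exec_inf k A P"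
proof -
  interpret template k A P by unfold_locales (rule assms(3))
  show ?thesis using language_subset exec_subset by (rule subset_antisym)
qed

end
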